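(* Let $n\geqslant 3$. Then there is a planar polynomial vector field $X$ of degree $n$ with a polycycle $\Gamma^n$ that has cyclicity at least $n$ inside the space of planar polynomial vector fields of degree $n$, endowed with the coefficients topology.
   Context: A graphic for a planar smooth vector field is a compact, non-empty invariant subset which is a continuous (not necessarily homeomorphic) image of $\mathbb{S}^1$ and consists of a finite number of isolated singularities $p_1,\dots,p_n$ (not necessarily distinct) and a compatible set of distinct regular orbits $L_1,\dots,L_n$ such that $p_i$ is the $\omega$-limit of $L_i$ (compatible: following the curve, each orbit $L_i$ joins two consecutive singularities). A polycycle is a graphic with a well-defined first return map on one of its sides; it is hyperbolic if all its singularities are hyperbolic saddles. $\Gamma^n$ denotes a hyperbolic polycycle with $n$ hyperbolic saddles $p_1,\dots,p_n$ and $n$ distinct regular orbits $L_1,\dots,L_n$. The degree of a planar polynomial vector field $(P,Q)$ is $\max\{\deg P,\deg Q\}$. The coefficients topology is the one obtained by identifying a vector field with the vector of the coefficients of its components, in a Euclidean space. A limit cycle is an isolated periodic orbit, and $d_H$ denotes the Hausdorff distance between compact subsets of $\mathbb{R}^2$. Given a topological space $\mathcal{X}$ of vector fields, the polycycle $\Gamma^n$ of $X\in\mathcal{X}$ has cyclicity at least $k$ inside $\mathcal{X}$ if for any $\varepsilon>0$ there is $Y_\varepsilon\in\mathcal{X}$ having at least $k$ limit cycles $\gamma_1(\varepsilon),\dots,\gamma_k(\varepsilon)$ with $\max\{d_H(\gamma_j(\varepsilon),\Gamma^n)\colon j\in\{1,\dots,k\}\}<\varepsilon$, and $Y_\varepsilon\to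 X$ in $\mathcal{X}$ as $\varepsilon\to0$. *)

theory Defs
  imports "HOL-Analysis.Analysis" "HOL-Computational_Algebra.Polynomial"
begin

type_synonym vfield = "real \<times> real \<Rightarrow> real \<times> real"

section \<open>Solutions, orbits and limit sets\<close>

definition solves :: "vfield \<Rightarrow> real set \<Rightarrow> (real \<Rightarrow> real \<times> real) \<Rightarrow> bool" where
  "solves X I \<phi> \<longleftrightarrow> (\<forall>t\<in>I. (\<phi> has_vector_derivative X (\<phi> t)) (at t within I))"

text \<open>The orbit is that of the maximal solution: solutions may blow up in finite time, so we
  take the union over all time intervals containing 0 on which a solution exists.\<close>

definition orbit :: "vfield \<Rightarrow> real \<times> real \<Rightarrow> (real \<times> real) set" where
  "orbit X p = {q. \<exists>I \<phi> t. is_interval I \<and> 0 \<in> I \<and> t \<in> I \<and> solves X I \<phi> \<and> \<phi> 0 = p \<and> q = \<phi> t}"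

definition regular_orbit :: "vfield \<Rightarrow> (real \<times> real) set \<Rightarrow> bool" where
  "regular_orbit X L \<longleftrightarrow> (\<exists>q. X q \<noteq> 0 \<and> L = orbit X q)"

definition invariant_set :: "vfield \<Rightarrow> (real \<times> real) set \<Rightarrow> bool" where
  "invariant_set X S \<longleftrightarrow> (\<forall>p\<in>S. orbit X p \<subseteq> S)"

text \<open>Limit sets of an orbit, which are empty when the solution is not defined for all positive
  (negative) times. Orbits inside a compact set are defined for all times.\<close>

definition omega_limit :: "vfield \<Rightarrow> (real \<times> real) set \<Rightarrow> (real \<times> real) set" where
  "omega_limit X L = {z. \<exists>\<phi> (\<tau> :: nat \<Rightarrow> real). solves X {0..} \<phi> \<and> \<phi> 0 \<in> L
     \<and> filterlim \<tau> at_top sequentially \<and> (\<lambda>k. \<phi> (\<tau> k)) \<longlonglongrightarrow> z}"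

definition alpha_limit :: "vfield \<Rightarrow> (real \<times> real) set \<Rightarrow> (real \<times> real) set" where
  "alpha_limit X L = {z. \<exists>\<phi> (\<tau> :: nat \<Rightarrow> real). solves X {..0} \<phi> \<and> \<phi> 0 \<in> L
     \<and> filterlim \<tau> at_bot sequentially \<and> (\<lambda>k. \<phi> (\<tau> k)) \<longlonglongrightarrow> z}"

definition singularities :: "vfield \<Rightarrow> (real \<times> real) set" where
  "singularities X = {p. X p = 0}"

text \<open>The derivative at the singularity has a negative and a positive real eigenvalue.\<close>

definition hyperbolic_saddle :: "vfield \<Rightarrow> real \<times> real \<Rightarrow> bool" where
  "hyperbolic_saddle X p \<longleftrightarrow> p \<in> singularities X \<and>
     (\<exists>A a b u v. (X has_derivative A) (at p) \<and> a < 0 \<and> 0 < b \<and>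
        u \<noteq> 0 \<and> A u = a *\<^sub>R u \<and> v \<noteq> 0 \<and> A v = b *\<^sub>R v)"

section \<open>Periodic orbits and limit cycles\<close>

definition periodic_orbit :: "vfield \<Rightarrow> (real \<times> real) set \<Rightarrow> bool" where
  "periodic_orbit X \<gamma> \<longleftrightarrow> (\<exists>\<phi> T. 0 < T \<and> solves X UNIV \<phi> \<and> (\<forall>t. \<phi> (t + T) = \<phi> t)
     \<and> X (\<phi> 0) \<noteq> 0 \<and> \<gamma> = range \<phi>)"

definition limit_cycle :: "vfield \<Rightarrow> (real \<times> real) set \<Rightarrow> bool" where
  "limit_cycle X \<gamma> \<longleftrightarrow> periodic_orbit X \<gamma> \<and>
     (\<exists>U. open U \<and> \<gamma> \<subseteq> U \<and> (\<forall>\<gamma>'. periodic_orbit X \<gamma>' \<and> \<gamma>' \<subseteq> U \<longrightarrow> \<gamma>' = \<gamma>))"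

text \<open>Meaningful for nonempty bounded sets, in particular for nonempty compact ones.\<close>

definition hausdorff_dist :: "'a::metric_space set \<Rightarrow> 'a set \<Rightarrow> real" where
  "hausdorff_dist A B = max (SUP a\<in>A. infdist a B) (SUP b\<in>B. infdist b A)"

section \<open>Graphics and polycycles\<close>

text \<open>Indices run over 0, ..., n - 1 cyclically, and are chosen so that the curve is followed in
  the direction of the flow: \<open>p i\<close> is the \<open>\<omega>\<close>-limit of \<open>L i\<close> and the
  \<open>\<alpha>\<close>-limit of the next orbit. The singularities need not be distinct.\<close>

definition graphic ::
  "vfield \<Rightarrow> nat \<Rightarrow> (nat \<Rightarrow> real \<times> real) \<Rightarrow> (nat \<Rightarrow> (real \<times> real) set) \<Rightarrow> (real \<times> real) set \<Rightarrow> bool"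
where
  "graphic X n p L \<Gamma> \<longleftrightarrow>
     1 \<le> n \<and> compact \<Gamma> \<and> \<Gamma> \<noteq> {} \<and> invariant_set X \<Gamma> \<and>
     (\<exists>c. continuous_on (sphere (0 :: complex) 1) c \<and> c ` sphere 0 1 = \<Gamma>) \<and>
     \<Gamma> = p ` {..<n} \<union> (\<Union>i<n. L i) \<and>
     (\<forall>i<n. p i isolated_in singularities X) \<and>
     (\<forall>i<n. regular_orbit X (L i)) \<and> inj_on L {..<n} \<and>
     (\<forall>i<n. omega_limit X (L i) = {p i} \<and> alpha_limit X (L (Suc i mod n)) = {p i})"

text \<open>A first return map of \<open>\<Gamma>\<close> on one side: \<open>q\<close> is a regular point of \<open>\<Gamma>\<close> and the
  segment \<open>q + s v\<close>, \<open>0 \<le> s < \<delta>\<close>, is transversal to the flow and meets \<open>\<Gamma>\<close> only at \<open>q\<close>.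
  The orbit of \<open>q + s v\<close>, for \<open>0 < s < \<rho>\<close>, comes back to the segment, for the first time,
  at time \<open>T s\<close> and at the point with parameter \<open>P s\<close>. The last condition says that the returning
  arcs run along the whole of \<open>\<Gamma>\<close>, so that it is a return map of \<open>\<Gamma>\<close> and not just of
  a part of it (such as one loop of a figure eight) or one due to some global recurrence.\<close>

definition has_first_return_map :: "vfield \<Rightarrow> (real \<times> real) set \<Rightarrow> bool" where
  "has_first_return_map X \<Gamma> \<longleftrightarrow>
    (\<exists>q v \<delta> \<rho> P T \<phi>.
       q \<in> \<Gamma> \<and> X q \<noteq> 0 \<and> v \<noteq> 0 \<and> 0 < \<rho> \<and> \<rho> \<le> \<delta> \<and>
       (\<forall>s\<in>{0..<\<delta>}. X (q + s *\<^sub>R v) \<notin> span {v}) \<and>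
       (\<forall>s\<in>{0<..<\<delta>}. q + s *\<^sub>R v \<notin> \<Gamma>) \<and>
       (\<forall>s\<in>{0<..<\<rho>}.
          0 < T s \<and> solves X {0..T s} (\<phi> s) \<and> \<phi> s 0 = q + s *\<^sub>R v \<and>
          P s \<in> {0<..<\<delta>} \<and> \<phi> s (T s) = q + P s *\<^sub>R v \<and>
          (\<forall>t\<in>{0<..<T s}. \<phi> s t \<notin> (\<lambda>r. q + r *\<^sub>R v) ` {0<..<\<delta>})) \<and>
       (P \<longlongrightarrow> 0) (at_right 0) \<and>
       ((\<lambda>s. hausdorff_dist (\<phi> s ` {0..T s}) \<Gamma>) \<longlongrightarrow> 0) (at_right 0))"

definition polycycle ::
  "vfield \<Rightarrow> nat \<Rightarrow> (nat \<Rightarrow> real \<times> real) \<Rightarrow> (nat \<Rightarrow> (real \<times> real) set) \<Rightarrow> (real \<times> real) set \<Rightarrow> bool"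
where
  "polycycle X n p L \<Gamma> \<longleftrightarrow> graphic X n p L \<Gamma> \<and> has_first_return_map X \<Gamma>"

definition hyperbolic_polycycle :: "vfield \<Rightarrow> nat \<Rightarrow> (real \<times> real) set \<Rightarrow> bool" where
  "hyperbolic_polycycle X n \<Gamma> \<longleftrightarrow>
     (\<exists>p L. polycycle X n p L \<Gamma> \<and> (\<forall>i<n. hyperbolic_saddle X (p i)))"

section \<open>Cyclicity\<close>

definition cyclicity_at_least ::
  "vfield topology \<Rightarrow> vfield \<Rightarrow> (real \<times> real) set \<Rightarrow> nat \<Rightarrow> bool"
where
  "cyclicity_at_least \<X> X \<Gamma> k \<longleftrightarrow>
    (\<exists>Y :: real \<Rightarrow> vfield.
       (\<forall>\<epsilon>>0. Y \<epsilon> \<in> topspace \<X> \<and>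
          (\<exists>C. finite C \<and> card C = k \<and>
               (\<forall>\<gamma>\<in>C. limit_cycle (Y \<epsilon>) \<gamma> \<and> hausdorff_dist \<gamma> \<Gamma> < \<epsilon>))) \<and>
       limitin \<X> Y X (at_right 0))"

section \<open>Planar polynomial vector fields\<close>

text \<open>Elements of \<open>real poly poly\<close> are polynomials in \<open>y\<close> whose coefficients are
  polynomials in \<open>x\<close>.\<close>

definition coeff2 :: "real poly poly \<Rightarrow> nat \<times> nat \<Rightarrow> real" where
  "coeff2 p = (\<lambda>(i, j). coeff (coeff p j) i)"

definition eval2 :: "real poly poly \<Rightarrow> real \<times> real \<Rightarrow> real" where
  "eval2 p = (\<lambda>(x, y). poly (poly p [:y:]) x)"

definition total_degree :: "real poly poly \<Rightarrow> nat" where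
  "total_degree p = Max (insert 0 {i + j | i j. coeff2 p (i, j) \<noteq> 0})"

definition poly_vfield :: "real poly poly \<times> real poly poly \<Rightarrow> vfield" where
  "poly_vfield = (\<lambda>(P, Q) z. (eval2 P z, eval2 Q z))"

definition poly_vfields :: "nat \<Rightarrow> vfield set" where
  "poly_vfields n = {poly_vfield (P, Q) | P Q. max (total_degree P) (total_degree Q) = n}"

lemma inj_poly_vfield: "inj poly_vfield"
proof -
  have *: "p = q" if "eval2 p = eval2 q" for p q :: "real poly poly"
  proof -
    have "poly p [:y:] = poly q [:y:]" for y
      using fun_cong[OF that] by (auto simp: eval2_def poly_eq_poly_eq_iff[symmetric])
    then have "range (\<lambda>y. [:y:]) \<subseteq> {u. poly (p - q) u = 0}"
      by auto
    moreover have "infinite (range (\<lambda>y :: real. [:y:]))"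
      by (simp add: finite_image_iff inj_def infinite_UNIV_char_0)
    ultimately show ?thesis
      using poly_roots_finite[of "p - q"] finite_subset by (metis right_minus_eq)
  qed
  show ?thesis
    by (rule injI) (auto simp: poly_vfield_def fun_eq_iff intro!: *)
qed

text \<open>The vector of all coefficients of monomials of total degree at most \<open>n\<close>, and the topology
  it induces from the Euclidean space of such vectors (a finite power of the plane).\<close>

definition coeff_vector :: "nat \<Rightarrow> vfield \<Rightarrow> nat \<times> nat \<Rightarrow> real \<times> real" where
  "coeff_vector n X =
     (let (P, Q) = the_inv poly_vfield X
      in (\<lambda>m\<in>{(i, j). i + j \<le> n}. (coeff2 P m, coeff2 Q m)))"

definition coeff_topology :: "nat \<Rightarrow> vfield topology" where
  "coeff_topology n = pullback_topology (poly_vfields n) (coeff_vector n)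
     (product_topology (\<lambda>_. euclidean) {(i, j). i + j \<le> n})"

lemma coeff_vector_poly_vfield:
  "coeff_vector n (poly_vfield (P, Q)) =
     (\<lambda>m\<in>{(i, j). i + j \<le> n}. (coeff2 P m, coeff2 Q m))"
  by (simp add: coeff_vector_def the_inv_f_f[OF inj_poly_vfield])

lemma topspace_coeff_topology: "topspace (coeff_topology n) = poly_vfields n"
  by (auto simp: coeff_topology_def topspace_pullback_topology poly_vfields_def
      coeff_vector_poly_vfield)

end

theory Submission
  imports Defs
begin

text \<open>The unperturbed field is Darboux integrable. Let \<open>side j z = 1 + u j \<bullet> z\<close>, \<open>j < n\<close>, be affine
  functions whose zero lines bound a convex \<open>n\<close>-gon around the origin, and let
  \<open>F = (\<Sum>j<n. lam j * ln (side j z))\<close> with weights such that \<open>(\<Sum>j<n. lam j *\<^sub>R u j) = 0\<close>. Put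
  \<open>P = (\<Prod>j<n. side j z)\<close> and let \<open>D z = fst z + c\<close> be positive on the closed polygon. Then
  \<open>X = D P (\<partial>\<^sub>y F, - \<partial>\<^sub>x F)\<close> is polynomial of degree \<open>n\<close>, the lines \<open>side j = 0\<close> are invariant, the corners are
  hyperbolic saddles, and the interior is filled by the ovals \<open>F = const\<close>, which shrink to the origin
  for \<open>F \<rightarrow> 0\<close> and accumulate on the polygon for \<open>F \<rightarrow> -\<infinity>\<close>. So the boundary of the polygon is a
  hyperbolic polycycle with \<open>n\<close> saddles and \<open>n\<close> regular orbits (\<open>base_field_hyperbolic_polycycle\<close>).

  The perturbation adds \<open>(\<Sum>i<n. b (i + 1) * P / side i) z + b 0 * P * (1, 0)\<close>, again of degree \<open>n\<close>. The
  coefficients \<open>b (i + 1)\<close> break the connections one at a time, while the last term leaves every line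
  invariant. All ovals are star-shaped about the origin, so \<open>x = F\<close> and the polar angle \<open>\<theta>\<close> are
  coordinates on the punctured polygon, and for \<open>b = e a\<close> the perturbed field becomes a scalar
  equation \<open>dx / d\<theta> = e G\<close>. Its average is a combination \<open>(\<Sum>k\<le>n. a k * M k)\<close> of Melnikov functions.
  Along the side \<open>i\<close> the oval \<open>F = x\<close> is at distance of order \<open>exp (x / lam i)\<close> from the line, whence
  \<open>\<bar>M (i + 1)\<bar> = \<integral> r\<^sup>2 / (D * side i)\<close> is of order \<open>exp (- x / lam i)\<close>, and \<open>M 0 = - \<integral> dy / D\<close> stays
  between positive constants, because \<open>D\<close> is not constant. For \<open>lam i = 1 / (i + 1)\<close> and \<open>s = exp (- x)\<close>
  the Melnikov functions are thus comparable with \<open>1, s, \<dots>, s\<^sup>n\<close> as \<open>s \<rightarrow> \<infinity>\<close>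
  (\<open>melnikov_Suc_bounds\<close>, \<open>melnikov_0_bounds\<close>), and alternating coefficients of widely separated sizes give a
  combination with \<open>n\<close> sign changes beyond any prescribed \<open>s\<close> (\<open>alternating_combination\<close>), that is,
  as close to the polygon as desired.

  By Sard's theorem, applied to the quotient by \<open>M 0\<close>, a small change of \<open>a 0\<close> makes the zeros simple
  (\<open>regular_value_exists\<close>), and by averaging (\<open>periodic_averaging\<close>) each simple zero produces an isolated
  periodic orbit for all small \<open>e > 0\<close>. This gives the \<open>n\<close> limit cycles of \<open>many_limit_cycles\<close>. Solutions of
  the planar equations are always obtained from curves that are tangent to the field, by a change
  of the time parameter (\<open>reparametrize_to_solution\<close>).\<close>

section \<open>Uniqueness of solutions, orbits and limit sets\<close>

text \<open>Bounded sets are used in place of neighbourhoods of points, since a pair of solutions on a compact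
  time interval stays in one ball.\<close>

definition locally_lipschitz :: "('a::real_normed_vector \<Rightarrow> 'b::real_normed_vector) \<Rightarrow> bool" where
  "locally_lipschitz f \<longleftrightarrow>
     (\<forall>B. \<exists>L. \<forall>p q. norm p \<le> B \<longrightarrow> norm q \<le> B \<longrightarrow> norm (f p - f q) \<le> L * norm (p - q))"

lemma locally_lipschitzE:
  assumes "locally_lipschitz f"
  obtains L where "0 \<le> L"
    "\<And>p q. norm p \<le> B \<Longrightarrow> norm q \<le> B \<Longrightarrow> norm (f p - f q) \<le> L * norm (p - q)"
proof -
  obtain L where L: "\<And>p q. norm p \<le> B \<Longrightarrow> norm q \<le> B \<Longrightarrow> norm (f p - f q) \<le> L * norm (p - q)"
    using assms unfolding locally_lipschitz_def by blast
  have "norm (f p - f q) \<le> \<bar>L\<bar> * norm (p - q)" if "norm p \<le> B" "norm q \<le> B" for p q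
    using order_trans[OF L[OF that] mult_right_mono[OF abs_ge_self norm_ge_zero]] .
  then show ?thesis using that[of "\<bar>L\<bar>"] by auto
qed

lemma locally_lipschitz_const: "locally_lipschitz (\<lambda>_. c)"
  unfolding locally_lipschitz_def by (auto intro: exI[of _ 0])

lemma locally_lipschitz_linear:
  assumes "bounded_linear f" shows "locally_lipschitz f"
  unfolding locally_lipschitz_def
proof (intro allI)
  obtain K where "\<And>x. norm (f x) \<le> norm x * K"
    using bounded_linear.bounded[OF assms] by blast
  then show "\<exists>L. \<forall>p q. norm p \<le> B \<longrightarrow> norm q \<le> B \<longrightarrow> norm (f p - f q) \<le> L * norm (p - q)" for B
    by (metis bounded_linear.linear[OF assms] linear_diff mult.commute)
qed

lemma locally_lipschitz_add:
  assumes "locally_lipschitz f" "locally_lipschitz g"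
  shows "locally_lipschitz (\<lambda>x. f x + g x)"
  unfolding locally_lipschitz_def
proof
  fix B
  obtain L where L: "\<And>p q. norm p \<le> B \<Longrightarrow> norm q \<le> B \<Longrightarrow> norm (f p - f q) \<le> L * norm (p - q)"
    using locally_lipschitzE[OF assms(1)] by metis
  obtain M where M: "\<And>p q. norm p \<le> B \<Longrightarrow> norm q \<le> B \<Longrightarrow> norm (g p - g q) \<le> M * norm (p - q)"
    using locally_lipschitzE[OF assms(2)] by metis
  have "norm (f p + g p - (f q + g q)) \<le> (L + M) * norm (p - q)"
    if "norm p \<le> B" "norm q \<le> B" for p q
    using L[OF that] M[OF that] norm_triangle_ineq[of "f p - f q" "g p - g q"]
    by (simp add: algebra_simps)
  then show "\<exists>L. \<forall>p q. norm p \<le> B \<longrightarrow> norm q \<le> B \<longrightarrow>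
      norm (f p + g p - (f q + g q)) \<le> L * norm (p - q)" by blast
qed

text \<open>A Lipschitz bound on a ball bounds the function there, and these two bounds control the product.\<close>

lemma locally_lipschitz_scaleR:
  fixes f :: "'a::real_normed_vector \<Rightarrow> real"
  assumes "locally_lipschitz f" "locally_lipschitz g"
  shows "locally_lipschitz (\<lambda>x. f x *\<^sub>R g x)"
  unfolding locally_lipschitz_def
proof
  fix B :: real
  show "\<exists>L. \<forall>p q. norm p \<le> B \<longrightarrow> norm q \<le> B \<longrightarrow>
      norm (f p *\<^sub>R g p - f q *\<^sub>R g q) \<le> L * norm (p - q)"
  proof (cases "B < 0")
    case True
    then have "\<not> norm (p::'a) \<le> B" for p using norm_ge_zero[of p] by linarith
    then show ?thesis by auto
  next
    case False
    then have B: "0 \<le> B" by simp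
    obtain L where L: "0 \<le> L" "\<And>p q. norm p \<le> B \<Longrightarrow> norm q \<le> B \<Longrightarrow> norm (f p - f q) \<le> L * norm (p - q)"
      using locally_lipschitzE[OF assms(1)] by metis
    obtain M where M: "0 \<le> M" "\<And>p q. norm p \<le> B \<Longrightarrow> norm q \<le> B \<Longrightarrow> norm (g p - g q) \<le> M * norm (p - q)"
      using locally_lipschitzE[OF assms(2)] by metis
    have bf: "\<bar>f p\<bar> \<le> \<bar>f 0\<bar> + L * B" if "norm p \<le> B" for p
    proof -
      have "\<bar>f p - f 0\<bar> \<le> L * norm p" using L(2)[OF that, of 0] B by simp
      moreover have "L * norm p \<le> L * B" using that L(1) by (rule mult_left_mono)
      ultimately show ?thesis by linarith
    qed
    have bg: "norm (g p) \<le> norm (g 0) + M * B" if "norm p \<le> B" for p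
    proof -
      have "norm (g p - g 0) \<le> M * norm p" using M(2)[OF that, of 0] B by simp
      moreover have "M * norm p \<le> M * B" using that M(1) by (rule mult_left_mono)
      moreover have "norm (g p) \<le> norm (g 0) + norm (g p - g 0)" by (rule norm_triangle_sub)
      ultimately show ?thesis by linarith
    qed
    have "norm (f p *\<^sub>R g p - f q *\<^sub>R g q) \<le>
        ((\<bar>f 0\<bar> + L * B) * M + L * (norm (g 0) + M * B)) * norm (p - q)"
      if "norm p \<le> B" "norm q \<le> B" for p q
    proof -
      have "f p *\<^sub>R g p - f q *\<^sub>R g q = f p *\<^sub>R (g p - g q) + (f p - f q) *\<^sub>R g q"
        by (simp add: algebra_simps)
      then have "norm (f p *\<^sub>R g p - f q *\<^sub>R g q) \<le> \<bar>f p\<bar> * norm (g p - g q) + \<bar>f p - f q\<bar> * norm (g q)"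
        by (metis norm_scaleR norm_triangle_ineq)
      also have "\<dots> \<le> (\<bar>f 0\<bar> + L * B) * (M * norm (p - q)) + L * norm (p - q) * (norm (g 0) + M * B)"
        using bf[OF that(1)] bg[OF that(2)] L(2)[OF that] M(2)[OF that] L(1) M(1) B
        by (intro add_mono mult_mono) auto
      finally show ?thesis by (simp add: algebra_simps)
    qed
    then show ?thesis by blast
  qed
qed

lemma locally_lipschitz_mult:
  fixes f g :: "'a::real_normed_vector \<Rightarrow> real"
  assumes "locally_lipschitz f" "locally_lipschitz g"
  shows "locally_lipschitz (\<lambda>x. f x * g x)"
  using locally_lipschitz_scaleR[OF assms] by simp

lemma locally_lipschitz_sum:
  assumes "\<And>i. i \<in> A \<Longrightarrow> locally_lipschitz (f i)"
  shows "locally_lipschitz (\<lambda>x. \<Sum>i\<in>A. f i x)"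
  using assms
proof (induction A rule: infinite_finite_induct)
  case (insert a A)
  then show ?case by (simp add: locally_lipschitz_add)
qed (simp_all add: locally_lipschitz_const)

lemma locally_lipschitz_prod:
  fixes f :: "'i \<Rightarrow> 'a::real_normed_vector \<Rightarrow> real"
  assumes "\<And>i. i \<in> A \<Longrightarrow> locally_lipschitz (f i)"
  shows "locally_lipschitz (\<lambda>x. \<Prod>i\<in>A. f i x)"
  using assms
proof (induction A rule: infinite_finite_induct)
  case (insert a A)
  then show ?case by (simp add: locally_lipschitz_mult)
qed (simp_all add: locally_lipschitz_const)

text \<open>The function \<open>w t * exp (- K * t)\<close> is nonincreasing.\<close>

lemma gronwall_zero:
  fixes w w' :: "real \<Rightarrow> real"
  assumes "a \<le> b" "continuous_on {a..b} w"
    "\<And>t. a < t \<Longrightarrow> t < b \<Longrightarrow> (w has_real_derivative w' t) (at t)"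
    "\<And>t. a < t \<Longrightarrow> t < b \<Longrightarrow> w' t \<le> K * w t"
    "w a = 0" "0 \<le> w b"
  shows "w b = 0"
proof -
  have "w b * exp (- K * b) \<le> w a * exp (- K * a)"
  proof (rule DERIV_nonpos_imp_decreasing_open[OF assms(1), of "\<lambda>t. w t * exp (- K * t)"])
    fix t assume t: "a < t" "t < b"
    have "((\<lambda>t. w t * exp (- K * t)) has_real_derivative
        (w' t * exp (- K * t) + w t * (exp (- K * t) * - K))) (at t)"
      using assms(3)[OF t] by (auto intro!: derivative_eq_intros)
    moreover have "w' t * exp (- K * t) + w t * (exp (- K * t) * - K) = (w' t - K * w t) * exp (- K * t)"
      by (simp add: algebra_simps)
    moreover have "\<dots> \<le> 0" using assms(4)[OF t] by (simp add: mult_nonpos_nonneg)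
    ultimately show "\<exists>y. ((\<lambda>t. w t * exp (- K * t)) has_real_derivative y) (at t) \<and> y \<le> 0"
      by metis
  next
    show "continuous_on {a..b} (\<lambda>t. w t * exp (- K * t))"
      using assms(2) by (intro continuous_intros)
  qed
  then have "w b * exp (- K * b) \<le> 0" using assms(5) by simp
  then show ?thesis using assms(6) by (simp add: mult_le_0_iff)
qed

lemma solves_subset: "solves X I \<phi> \<Longrightarrow> J \<subseteq> I \<Longrightarrow> solves X J \<phi>"
  unfolding solves_def using has_vector_derivative_within_subset by blast

lemma solves_shift:
  assumes "solves X UNIV \<phi>" shows "solves X UNIV (\<lambda>t. \<phi> (t + s))"
  unfolding solves_def
proof
  fix t
  have "((\<lambda>t. t + s) has_real_derivative 1) (at t)"
    by (auto intro!: derivative_eq_intros)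
  moreover have "(\<phi> has_vector_derivative X (\<phi> (t + s))) (at (t + s))"
    using assms unfolding solves_def by simp
  ultimately have "(\<phi> \<circ> (\<lambda>t. t + s) has_vector_derivative 1 *\<^sub>R X (\<phi> (t + s))) (at t)"
    by (rule vector_diff_chain_at[where g = \<phi> and f = "\<lambda>t. t + s", unfolded has_real_derivative_iff_has_vector_derivative[symmetric]])
  then show "((\<lambda>t. \<phi> (t + s)) has_vector_derivative X (\<phi> (t + s))) (at t)" by (simp add: o_def)
qed

lemma solves_reflect:
  assumes "solves X I \<phi>" shows "solves (\<lambda>z. - X z) (uminus ` I) (\<lambda>t. \<phi> (- t))"
  unfolding solves_def
proof
  fix t assume "t \<in> uminus ` I"
  then have "- t \<in> I" by auto
  then have 1: "(\<phi> has_vector_derivative X (\<phi> (- t))) (at (- t) within uminus ` (uminus ` I))"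
    using assms unfolding solves_def by (simp add: image_image)
  have 2: "(uminus has_vector_derivative -1) (at t within uminus ` I)"
    by (auto intro!: derivative_eq_intros)
  have "(\<phi> \<circ> uminus has_vector_derivative (-1) *\<^sub>R X (\<phi> (- t))) (at t within uminus ` I)"
    using vector_diff_chain_within[OF 2 1] by simp
  then show "((\<lambda>t. \<phi> (- t)) has_vector_derivative - X (\<phi> (- t))) (at t within uminus ` I)"
    by (simp add: o_def)
qed

text \<open>Gronwall for the squared distance of the two solutions.\<close>

lemma solves_unique_forward:
  fixes X :: vfield
  assumes X: "locally_lipschitz X" and "a \<le> b"
    and \<phi>: "solves X {a..b} \<phi>" and \<psi>: "solves X {a..b} \<psi>" and "\<phi> a = \<psi> a"
  shows "\<phi> b = \<psi> b"
proof -
  have cont: "continuous_on {a..b} \<phi>" "continuous_on {a..b} \<psi>"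
    using \<phi> \<psi> unfolding solves_def
    by (meson continuous_on_eq_continuous_within has_vector_derivative_continuous)+
  have "bounded (\<phi> ` {a..b} \<union> \<psi> ` {a..b})"
    using cont by (simp add: compact_continuous_image compact_imp_bounded)
  then obtain B where "\<forall>x \<in> \<phi> ` {a..b} \<union> \<psi> ` {a..b}. norm x \<le> B" unfolding bounded_iff by blast
  then have B: "norm (\<phi> t) \<le> B" "norm (\<psi> t) \<le> B" if "t \<in> {a..b}" for t using that by auto
  obtain L where L: "\<And>p q. norm p \<le> B \<Longrightarrow> norm q \<le> B \<Longrightarrow> norm (X p - X q) \<le> L * norm (p - q)"
    using locally_lipschitzE[OF X] by metis
  let ?w = "\<lambda>t. (\<phi> t - \<psi> t) \<bullet> (\<phi> t - \<psi> t)"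
  have "?w b = 0"
  proof (rule gronwall_zero[of a b ?w "\<lambda>t. 2 * ((\<phi> t - \<psi> t) \<bullet> (X (\<phi> t) - X (\<psi> t)))" "2 * L"])
    show "continuous_on {a..b} ?w" using cont by (intro continuous_intros)
    fix t assume t: "a < t" "t < b"
    have at: "at t within {a..b} = at t" using t by (intro at_within_interior) (simp add: interior_atLeastAtMost_real)
    have "(\<phi> has_vector_derivative X (\<phi> t)) (at t)" "(\<psi> has_vector_derivative X (\<psi> t)) (at t)"
      using \<phi>[unfolded solves_def, THEN bspec, of t] \<psi>[unfolded solves_def, THEN bspec, of t] t at
      by auto
    then show "(?w has_real_derivative 2 * ((\<phi> t - \<psi> t) \<bullet> (X (\<phi> t) - X (\<psi> t)))) (at t)"
      unfolding has_field_derivative_def has_vector_derivative_def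
      by (auto intro!: derivative_eq_intros simp: inner_commute algebra_simps)
    have "(\<phi> t - \<psi> t) \<bullet> (X (\<phi> t) - X (\<psi> t)) \<le> norm (\<phi> t - \<psi> t) * norm (X (\<phi> t) - X (\<psi> t))"
      by (rule norm_cauchy_schwarz)
    also have "\<dots> \<le> norm (\<phi> t - \<psi> t) * (L * norm (\<phi> t - \<psi> t))"
      using t by (intro mult_left_mono L B) auto
    also have "\<dots> = L * ?w t" by (simp add: dot_square_norm power2_eq_square)
    finally show "2 * ((\<phi> t - \<psi> t) \<bullet> (X (\<phi> t) - X (\<psi> t))) \<le> 2 * L * ?w t" by simp
  qed (use assms in auto)
  then show ?thesis by simp
qed

lemma locally_lipschitz_minus: "locally_lipschitz X \<Longrightarrow> locally_lipschitz (\<lambda>z. - X z)"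
  unfolding locally_lipschitz_def by (simp add: norm_minus_commute)

text \<open>Backward uniqueness is forward uniqueness for the reflected field.\<close>

lemma solves_unique:
  fixes X :: vfield
  assumes X: "locally_lipschitz X" and I: "is_interval I"
    and \<phi>: "solves X I \<phi>" and \<psi>: "solves X I \<psi>" and "s \<in> I" "t \<in> I" "\<phi> s = \<psi> s"
  shows "\<phi> t = \<psi> t"
proof -
  have between: "x \<in> I" if "a \<in> I" "b \<in> I" "a \<le> x" "x \<le> b" for a b x
    using mem_is_interval_1_I[OF I that] .
  show ?thesis
  proof (cases "s \<le> t")
    case True
    have "{s..t} \<subseteq> I" using between[OF \<open>s \<in> I\<close> \<open>t \<in> I\<close>] by auto
    then have "solves X {s..t} \<phi>" "solves X {s..t} \<psi>"
      using solves_subset[OF \<phi>] solves_subset[OF \<psi>] by simp_all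
    from solves_unique_forward[OF X True this assms(7)] show ?thesis .
  next
    case False
    have "{t..s} \<subseteq> I" using between[OF \<open>t \<in> I\<close> \<open>s \<in> I\<close>] by auto
    then have "solves X {t..s} \<phi>" "solves X {t..s} \<psi>"
      using solves_subset[OF \<phi>] solves_subset[OF \<psi>] by simp_all
    from this[THEN solves_reflect]
    have "solves (\<lambda>z. - X z) {-s..-t} (\<lambda>t. \<phi> (- t))" "solves (\<lambda>z. - X z) {-s..-t} (\<lambda>t. \<psi> (- t))"
      by simp_all
    from solves_unique_forward[OF locally_lipschitz_minus[OF X] _ this] False assms(7)
    show ?thesis by simp
  qed
qed

text \<open>Every solution through a point of \<open>range \<phi>\<close> is a time shift of \<open>\<phi>\<close>.\<close>

lemma orbit_eq_range:
  fixes X :: vfield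
  assumes X: "locally_lipschitz X" and \<phi>: "solves X UNIV \<phi>"
  shows "orbit X (\<phi> s) = range \<phi>"
proof
  show "orbit X (\<phi> s) \<subseteq> range \<phi>"
  proof
    fix q assume "q \<in> orbit X (\<phi> s)"
    then obtain I \<psi> t where *: "is_interval I" "0 \<in> I" "t \<in> I" "solves X I \<psi>" "\<psi> 0 = \<phi> s" "q = \<psi> t"
      unfolding orbit_def by auto
    have "solves X I (\<lambda>t. \<phi> (t + s))" using solves_shift[OF \<phi>] solves_subset by blast
    from solves_unique[OF X *(1) *(4) this *(2,3)] * show "q \<in> range \<phi>" by simp
  qed
  show "range \<phi> \<subseteq> orbit X (\<phi> s)"
  proof
    fix q assume "q \<in> range \<phi>"
    then obtain t where "q = \<phi> t" by auto
    then show "q \<in> orbit X (\<phi> s)"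
      unfolding orbit_def mem_Collect_eq
      by (intro exI[of _ UNIV] exI[of _ "\<lambda>t. \<phi> (t + s)"] exI[of _ "t - s"]) (simp add: solves_shift[OF \<phi>])
  qed
qed

lemma orbit_singularity:
  fixes X :: vfield
  assumes "locally_lipschitz X" "X p = 0" shows "orbit X p = {p}"
  using orbit_eq_range[OF assms(1), of "\<lambda>_. p"] assms(2) by (simp add: solves_def)

text \<open>By uniqueness the limit set sees only time shifts of \<open>\<phi>\<close>, and these have the same limit.\<close>

lemma omega_limit_eq:
  fixes X :: vfield
  assumes X: "locally_lipschitz X" and \<phi>: "solves X UNIV \<phi>" and lim: "(\<phi> \<longlongrightarrow> p) at_top"
  shows "omega_limit X (range \<phi>) = {p}"
proof
  show "omega_limit X (range \<phi>) \<subseteq> {p}"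
  proof
    fix z assume "z \<in> omega_limit X (range \<phi>)"
    then obtain \<psi> \<tau> s where *: "solves X {0..} \<psi>" "\<psi> 0 = \<phi> s" "filterlim \<tau> at_top sequentially"
        "(\<lambda>k::nat. \<psi> (\<tau> k)) \<longlonglongrightarrow> z" unfolding omega_limit_def by auto
    have "solves X {0..} (\<lambda>t. \<phi> (t + s))" using solves_shift[OF \<phi>] solves_subset by blast
    then have eq: "\<psi> t = \<phi> (t + s)" if "0 \<le> t" for t
      using solves_unique[OF X is_interval_ci *(1), of "\<lambda>t. \<phi> (t + s)" 0 t] that *(2) by simp
    have "filterlim (\<lambda>k. \<tau> k + s) at_top sequentially"
      using *(3) filterlim_tendsto_add_at_top[OF tendsto_const[of s]] by (simp add: add.commute)
    then have "(\<lambda>k. \<phi> (\<tau> k + s)) \<longlonglongrightarrow> p" using lim filterlim_compose by blast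
    moreover have "\<forall>\<^sub>F k in sequentially. \<phi> (\<tau> k + s) = \<psi> (\<tau> k)"
      using filterlim_at_top[THEN iffD1, OF *(3), rule_format, of 0] by eventually_elim (simp add: eq)
    ultimately have "(\<lambda>k. \<psi> (\<tau> k)) \<longlonglongrightarrow> p" by (rule Lim_transform_eventually)
    then show "z \<in> {p}" using *(4) LIMSEQ_unique by blast
  qed
  have "solves X {0..} \<phi>" using solves_subset[OF \<phi>] by simp
  moreover have "(\<lambda>k. \<phi> (real k)) \<longlonglongrightarrow> p"
    using lim filterlim_real_sequentially filterlim_compose by blast
  ultimately show "{p} \<subseteq> omega_limit X (range \<phi>)"
    unfolding omega_limit_def using filterlim_real_sequentially by blast
qed

lemma alpha_limit_eq:
  fixes X :: vfield
  assumes X: "locally_lipschitz X" and \<phi>: "solves X UNIV \<phi>" and lim: "(\<phi> \<longlongrightarrow> p) at_bot"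
  shows "alpha_limit X (range \<phi>) = {p}"
proof
  show "alpha_limit X (range \<phi>) \<subseteq> {p}"
  proof
    fix z assume "z \<in> alpha_limit X (range \<phi>)"
    then obtain \<psi> \<tau> s where *: "solves X {..0} \<psi>" "\<psi> 0 = \<phi> s" "filterlim \<tau> at_bot sequentially"
        "(\<lambda>k::nat. \<psi> (\<tau> k)) \<longlonglongrightarrow> z" unfolding alpha_limit_def by auto
    have "solves X {..0} (\<lambda>t. \<phi> (t + s))" using solves_shift[OF \<phi>] solves_subset by blast
    then have eq: "\<psi> t = \<phi> (t + s)" if "t \<le> 0" for t
      using solves_unique[OF X is_interval_ic *(1), of "\<lambda>t. \<phi> (t + s)" 0 t] that *(2) by simp
    have "filterlim (\<lambda>k. \<tau> k + s) at_bot sequentially"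
      using filterlim_tendsto_add_at_top[OF tendsto_const[of "- s"] *(3)[unfolded filterlim_uminus_at_bot]]
      by (simp add: filterlim_uminus_at_bot add.commute)
    then have "(\<lambda>k. \<phi> (\<tau> k + s)) \<longlonglongrightarrow> p" using lim filterlim_compose by blast
    moreover have "\<forall>\<^sub>F k in sequentially. \<phi> (\<tau> k + s) = \<psi> (\<tau> k)"
      using filterlim_at_bot[THEN iffD1, OF *(3), rule_format, of 0] by eventually_elim (simp add: eq)
    ultimately have "(\<lambda>k. \<psi> (\<tau> k)) \<longlonglongrightarrow> p" by (rule Lim_transform_eventually)
    then show "z \<in> {p}" using *(4) LIMSEQ_unique by blast
  qed
  have "solves X {..0} \<phi>" using solves_subset[OF \<phi>] by simp
  moreover have m: "filterlim (\<lambda>k. - real k) at_bot sequentially"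
    using filterlim_real_sequentially filterlim_uminus_at_top by blast
  moreover have "(\<lambda>k. \<phi> (- real k)) \<longlonglongrightarrow> p"
    using lim m filterlim_compose by blast
  ultimately show "{p} \<subseteq> alpha_limit X (range \<phi>)"
    unfolding alpha_limit_def by blast
qed

lemma antiderivative_exists:
  fixes f :: "real \<Rightarrow> 'a::euclidean_space"
  assumes "continuous_on UNIV f"
  obtains A where "A 0 = 0" "\<And>t. (A has_vector_derivative f t) (at t)"
proof -
  obtain A where A: "\<And>t. (A has_vector_derivative f t) (at t)"
    using einterval_antiderivative[of "-\<infinity>" "\<infinity>" f] assms
    by (auto simp: continuous_on_eq_continuous_at)
  show ?thesis
  proof (rule that[of "\<lambda>t. A t - A 0"])
    show "((\<lambda>t. A t - A 0) has_vector_derivative f t) (at t)" for t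
      using A[of t] by (auto intro!: derivative_eq_intros)
  qed simp
qed

lemma antiderivative_exists_real:
  fixes f :: "real \<Rightarrow> real"
  assumes "continuous_on UNIV f"
  obtains A where "A 0 = 0" "\<And>t. (A has_real_derivative f t) (at t)"
  using antiderivative_exists[OF assms] unfolding has_real_derivative_iff_has_vector_derivative by metis

lemma antiderivative_shift:
  fixes A f :: "real \<Rightarrow> real"
  assumes A: "\<And>t. (A has_real_derivative f t) (at t)" and f: "\<And>t. f (t + p) = f t"
  shows "A (t + p) - A t = A p - A 0"
proof -
  have "((\<lambda>t. A (t + p) - A t) has_real_derivative 0) (at t)" for t
    using A[of t] A[of "t + p"] f[of t]
    by (auto intro!: derivative_eq_intros simp: DERIV_shift)
  then have "A (t + p) - A t = A (0 + p) - A 0"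
    using DERIV_isconst_all[of "\<lambda>t. A (t + p) - A t" t 0] by blast
  then show ?thesis by simp
qed

text \<open>A curve that is everywhere tangent to the field is given the right speed by the new time
  \<open>\<tau>\<close> with \<open>\<tau>' = \<kappa>\<close>. The lower bound on \<open>\<kappa>\<close> makes \<open>\<tau>\<close> surjective, so that the solution is defined
  for all times. All global solutions below come from this lemma.\<close>

lemma reparametrize_to_solution:
  fixes z :: "real \<Rightarrow> real \<times> real"
  assumes \<kappa>: "continuous_on UNIV \<kappa>" "\<And>s. c \<le> \<kappa> s" "0 < c"
    and z: "\<And>s. (z has_vector_derivative \<kappa> s *\<^sub>R Y (z s)) (at s)"
  obtains \<phi> \<tau> where "solves Y UNIV \<phi>" "\<tau> 0 = 0" "\<And>s. (\<tau> has_real_derivative \<kappa> s) (at s)"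
    "strict_mono \<tau>" "surj \<tau>" "\<And>s. \<phi> (\<tau> s) = z s"
proof -
  obtain \<tau> where \<tau>: "\<tau> 0 = 0" "\<And>s. (\<tau> has_real_derivative \<kappa> s) (at s)"
    using antiderivative_exists_real[OF \<kappa>(1)] by metis
  have pos: "0 < \<kappa> s" for s using \<kappa>(2)[of s] \<kappa>(3) by linarith
  have mono: "strict_mono \<tau>"
    using DERIV_pos_imp_increasing[of _ _ \<tau>] \<tau>(2) pos by (meson strict_monoI)
  have grow: "c * (b - a) \<le> \<tau> b - \<tau> a" if "a \<le> b" for a b
  proof (cases "a = b")
    case False
    then have "a < b" using that by simp
    then obtain \<xi> where "\<tau> b - \<tau> a = (b - a) * \<kappa> \<xi>"
      using MVT2[of a b \<tau> \<kappa>] \<tau>(2) by blast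
    then show ?thesis using \<kappa>(2)[of \<xi>] that by (metis diff_ge_0_iff_ge mult.commute mult_left_mono)
  qed simp
  have cont: "continuous_on UNIV \<tau>"
    using \<tau>(2) DERIV_isCont continuous_on_eq_continuous_at by blast
  have surj: "surj \<tau>"
    unfolding surj_def
  proof
    fix y
    define b where "b = \<bar>y\<bar> / c"
    have "\<tau> (-b) \<le> y" "y \<le> \<tau> b"
      using grow[of "-b" 0] grow[of 0 b] \<tau>(1) \<kappa>(3) unfolding b_def by (auto simp: abs_if split: if_splits)
    moreover have "continuous_on {-b..b} \<tau>" using cont continuous_on_subset by blast
    moreover have "-b \<le> b" using \<kappa>(3) unfolding b_def by simp
    ultimately show "\<exists>x. y = \<tau> x" using IVT'[of \<tau> "-b" y b] by metis
  qed
  have inj: "inj \<tau>" using mono strict_mono_imp_inj_on by blast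
  define g where "g = inv \<tau>"
  have g\<tau>: "g (\<tau> s) = s" for s using inj unfolding g_def by simp
  have \<tau>g: "\<tau> (g t) = t" for t using surj unfolding g_def by (simp add: surj_f_inv_f)
  have dg: "(g has_real_derivative 1 / \<kappa> s) (at (\<tau> s))" for s
    unfolding has_field_derivative_def
  proof (rule has_derivative_inverse_strong[of UNIV s \<tau> g "(*) (\<kappa> s)"])
    show "(*) (\<kappa> s) \<circ> (*) (1 / \<kappa> s) = id" using pos[of s] by (auto simp: fun_eq_iff)
  qed (use \<tau>(2)[of s] cont g\<tau> in \<open>simp_all add: has_field_derivative_def\<close>)
  have "solves Y UNIV (z \<circ> g)"
    unfolding solves_def
  proof
    fix t
    have "(g has_vector_derivative 1 / \<kappa> (g t)) (at t)"
      using dg[of "g t"] by (simp add: \<tau>g has_real_derivative_iff_has_vector_derivative)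
    from vector_diff_chain_at[OF this z]
    show "(z \<circ> g has_vector_derivative Y ((z \<circ> g) t)) (at t)" using pos[of "g t"] by simp
  qed
  then show ?thesis using that[of "z \<circ> g" \<tau>] \<tau> mono surj g\<tau> by simp
qed

section \<open>Averaging for periodic scalar equations\<close>

lemma periodic_int:
  fixes f :: "real \<Rightarrow> 'a"
  assumes "\<And>t. f (t + p) = f t"
  shows "f (t + of_int k * p) = f t"
proof (induction k arbitrary: t rule: int_induct[of _ 0])
  case base
  then show ?case by simp
next
  case (step1 i)
  have "f (t + of_int (i + 1) * p) = f ((t + of_int i * p) + p)" by (simp add: algebra_simps)
  then show ?case using step1 assms by metis
next
  case (step2 i)
  have "f (t + of_int i * p) = f ((t + of_int (i - 1) * p) + p)" by (simp add: algebra_simps)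
  then show ?case using step2 assms by metis
qed

lemma reduce_to_period:
  fixes t p :: real
  assumes "0 < p"
  obtains s k where "s \<in> {0..p}" "t = s + of_int k * p"
proof -
  define k where "k = \<lfloor>t / p\<rfloor>"
  have "of_int k \<le> t / p" "t / p < of_int k + 1" unfolding k_def by linarith+
  then have "of_int k * p \<le> t" "t < (of_int k + 1) * p"
    using assms by (simp_all add: field_simps)
  then show ?thesis using that[of "t - of_int k * p" k] by (simp add: algebra_simps)
qed

lemma deriv_bound_from_0:
  fixes A f :: "real \<Rightarrow> real"
  assumes A: "\<And>t. (A has_real_derivative f t) (at t)" and "A 0 = 0"
    and f: "\<And>t. \<bar>f t\<bar> \<le> B" and t: "0 \<le> t"
  shows "\<bar>A t\<bar> \<le> B * t"
proof (cases "t = 0")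
  case False
  then have "0 < t" using t by simp
  then obtain \<xi> where "A t - A 0 = (t - 0) * f \<xi>" using MVT2[of 0 t A f] A by blast
  then have "\<bar>A t\<bar> = t * \<bar>f \<xi>\<bar>" using assms(2) t by (simp add: abs_mult)
  also have "\<dots> \<le> t * B" using f[of \<xi>] t by (intro mult_left_mono)
  finally show ?thesis by (simp add: mult.commute)
qed (use assms in simp)

text \<open>The periodic problem for \<open>x' = e * g x t\<close> is split in two: for each prescribed \<open>x0\<close> the equation is solved up
  to its mean value \<open>\<mu> x0\<close>, which leaves the scalar bifurcation equation \<open>\<mu> x0 = 0\<close>. Subtracting the mean makes
  the integral operator map periodic functions to periodic functions, and for small \<open>e\<close> it is a contraction.\<close>

lemma lyapunov_schmidt:
  fixes g :: "real \<Rightarrow> real \<Rightarrow> real"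
  assumes p: "0 < p" and e: "0 \<le> e" and small: "2 * p * L * e < 1" and L: "0 \<le> L"
    and cont: "continuous_on UNIV (\<lambda>(x, s). g x s)"
    and lip: "\<And>x y s. \<bar>g x s - g y s\<bar> \<le> L * \<bar>x - y\<bar>"
    and bd: "\<And>x s. \<bar>g x s\<bar> \<le> C"
    and per: "\<And>x s. g x (s + p) = g x s"
  shows "\<exists>X \<mu>. \<forall>x0. (\<forall>t. X x0 (t + p) = X x0 t) \<and>
           (\<forall>t. (X x0 has_real_derivative e * (g (X x0 t) t - \<mu> x0)) (at t)) \<and>
           (\<forall>t. \<bar>X x0 t - x0\<bar> \<le> 2 * p * C * e) \<and>
           ((\<lambda>s. g (X x0 s) s) has_integral p * \<mu> x0) {0..p} \<and>
           (\<forall>y0. \<bar>\<mu> x0 - \<mu> y0\<bar> \<le> L / (1 - 2 * p * L * e) * \<bar>x0 - y0\<bar>)"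
proof -
  have C: "0 \<le> C" using bd[of 0 0] by linarith
  have "\<exists>AD. \<forall>f::real\<Rightarrow>real. continuous_on UNIV f \<longrightarrow> AD f 0 = 0 \<and> (\<forall>t. (AD f has_real_derivative f t) (at t))"
    by (intro choice) (metis antiderivative_exists_real)
  then obtain AD :: "(real \<Rightarrow> real) \<Rightarrow> real \<Rightarrow> real" where
    AD: "\<And>f. continuous_on UNIV f \<Longrightarrow> AD f 0 = 0"
        "\<And>f t. continuous_on UNIV f \<Longrightarrow> (AD f has_real_derivative f t) (at t)" by blast
  define \<Phi> where "\<Phi> x = (\<lambda>s. g (apply_bcontfun x s) s)" for x
  define N where "N x = AD (\<Phi> x)" for x
  have cont\<Phi>: "continuous_on UNIV (\<Phi> x)" for x
    unfolding \<Phi>_def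
    using continuous_on_compose2[OF cont, of UNIV "\<lambda>s. (apply_bcontfun x s, s)"]
    by (simp add: continuous_on_Pair)
  have N0: "N x 0 = 0" and dN: "(N x has_real_derivative \<Phi> x t) (at t)" for x t
    unfolding N_def using AD cont\<Phi> by blast+
  define S where "S = {x::real \<Rightarrow>\<^sub>C real. \<forall>t. apply_bcontfun x (t + p) = apply_bcontfun x t}"
  have per\<Phi>: "\<Phi> x (t + p) = \<Phi> x t" if "x \<in> S" for x t
    using that per unfolding S_def \<Phi>_def by simp
  have perN: "N x (t + p) = N x t + N x p" if "x \<in> S" for x t
    using antiderivative_shift[of "N x" "\<Phi> x" p t] dN per\<Phi>[OF that] N0 by simp
  \<comment> \<open>The primitive of the function minus its mean, which is periodic.\<close>
  define W where "W x t = N x t - t / p * N x p" for x t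
  have dW: "(W x has_real_derivative \<Phi> x t - N x p / p) (at t)" for x t
    unfolding W_def[abs_def] using p by (auto intro!: derivative_eq_intros dN)
  have perW: "W x (t + p) = W x t" if "x \<in> S" for x t
    unfolding W_def perN[OF that] using p by (simp add: field_simps)
  have W0: "W x 0 = 0" for x unfolding W_def by (simp add: N0)
  have bdW: "\<bar>W x t\<bar> \<le> 2 * p * C" if "x \<in> S" for x t
  proof -
    obtain s k where s: "s \<in> {0..p}" "t = s + of_int k * p" using reduce_to_period[OF p] by metis
    have "W x t = W x s" using periodic_int[of "W x" p s k] perW[OF that] s(2) by simp
    moreover have NB: "\<bar>N x r\<bar> \<le> C * r" if "0 \<le> r" for r
      using deriv_bound_from_0[of "N x" "\<Phi> x" C r] dN N0 bd that unfolding \<Phi>_def by simp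
    moreover have "\<bar>W x s\<bar> \<le> \<bar>N x s\<bar> + s / p * \<bar>N x p\<bar>"
    proof -
      have "\<bar>s / p * N x p\<bar> = s / p * \<bar>N x p\<bar>" using s p by (simp add: abs_mult)
      then show ?thesis unfolding W_def using abs_triangle_ineq4[of "N x s" "s / p * N x p"] by simp
    qed
    moreover have "s / p * \<bar>N x p\<bar> \<le> 1 * \<bar>N x p\<bar>"
      using s p by (intro mult_right_mono) auto
    moreover have "C * s \<le> C * p" using s C by (simp add: mult_left_mono)
    ultimately show ?thesis using NB[of s] NB[of p] s p by (simp add: algebra_simps)
  qed
  have NN: "\<bar>N x s - N y s\<bar> \<le> L * dist x y * s" if "0 \<le> s" for x y s
  proof (rule deriv_bound_from_0[of "\<lambda>t. N x t - N y t" "\<lambda>t. \<Phi> x t - \<Phi> y t" "L * dist x y" s])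
    show "\<bar>\<Phi> x t - \<Phi> y t\<bar> \<le> L * dist x y" for t
    proof -
      have "\<bar>\<Phi> x t - \<Phi> y t\<bar> \<le> L * \<bar>x t - y t\<bar>" unfolding \<Phi>_def by (rule lip)
      also have "\<dots> \<le> L * dist x y"
        using dist_bounded[of x t y] L by (intro mult_left_mono) (simp_all add: dist_real_def)
      finally show ?thesis .
    qed
    show "((\<lambda>t. N x t - N y t) has_real_derivative \<Phi> x t - \<Phi> y t) (at t)" for t
      by (intro derivative_intros dN)
  qed (use N0 that in simp_all)
  have WW: "\<bar>W x t - W y t\<bar> \<le> 2 * p * L * dist x y" if "x \<in> S" "y \<in> S" for x y t
  proof -
    obtain s k where s: "s \<in> {0..p}" "t = s + of_int k * p" using reduce_to_period[OF p] by metis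
    have "W x t = W x s" "W y t = W y s"
      using periodic_int[of "W x" p s k] periodic_int[of "W y" p s k] perW that s(2) by simp_all
    then have "W x t - W y t = (N x s - N y s) - s / p * (N x p - N y p)"
      unfolding W_def by (simp add: algebra_simps)
    then have "\<bar>W x t - W y t\<bar> \<le> \<bar>N x s - N y s\<bar> + \<bar>s / p * (N x p - N y p)\<bar>"
      by linarith
    also have "\<bar>s / p * (N x p - N y p)\<bar> = s / p * \<bar>N x p - N y p\<bar>"
      using s p by (simp add: abs_mult)
    also have "\<dots> \<le> 1 * \<bar>N x p - N y p\<bar>"
      using s p by (intro mult_right_mono) auto
    also have "\<dots> \<le> L * dist x y * p" using NN[of p x y] p by simp
    also have "\<bar>N x s - N y s\<bar> \<le> L * dist x y * s" using NN s by simp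
    also have "\<dots> \<le> L * dist x y * p" using s L by (simp add: mult_left_mono)
    finally show ?thesis by (simp add: algebra_simps)
  qed
  have bc: "(\<lambda>t. x0 + e * W x t) \<in> bcontfun" if "x \<in> S" for x x0
    unfolding bcontfun_def
  proof (intro CollectI conjI)
    have "continuous_on UNIV (W x)" by (rule DERIV_continuous_on, rule has_field_derivative_at_within, rule dW)
    then show "continuous_on UNIV (\<lambda>t. x0 + e * W x t)" by (intro continuous_intros)
    have "\<bar>x0 + e * W x t\<bar> \<le> \<bar>x0\<bar> + e * (2 * p * C)" for t
      using mult_left_mono[OF bdW[OF that, of t] e] abs_triangle_ineq[of x0 "e * W x t"] e
      by (simp add: abs_mult)
    then show "bounded (range (\<lambda>t. x0 + e * W x t))" unfolding bounded_iff by auto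
  qed
  define T where "T x0 x = Bcontfun (\<lambda>t. x0 + e * W x t)" for x0 x
  have T: "apply_bcontfun (T x0 x) t = x0 + e * W x t" if "x \<in> S" for x x0 t
    unfolding T_def using Bcontfun_inverse[OF bc[OF that]] by simp
  have TS: "T x0 x \<in> S" if "x \<in> S" for x x0
    unfolding S_def using T[OF that] perW[OF that] by simp
  have closedS: "complete S"
  proof -
    have "closed S"
    proof -
      have "closed {x::real \<Rightarrow>\<^sub>C real. apply_bcontfun x (t + p) = apply_bcontfun x t}" for t
      proof (rule closed_Collect_eq)
        have "continuous_on UNIV (\<lambda>x::real \<Rightarrow>\<^sub>C real. apply_bcontfun x r)" for r
          unfolding continuous_on_iff using dist_bounded le_less_trans by blast
        then show "continuous_on UNIV (\<lambda>x::real \<Rightarrow>\<^sub>C real. apply_bcontfun x (t + p))"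
          "continuous_on UNIV (\<lambda>x::real \<Rightarrow>\<^sub>C real. apply_bcontfun x t)" by blast+
      qed
      then have "closed (\<Inter>t. {x::real \<Rightarrow>\<^sub>C real. apply_bcontfun x (t + p) = apply_bcontfun x t})" by blast
      moreover have "(\<Inter>t. {x::real \<Rightarrow>\<^sub>C real. apply_bcontfun x (t + p) = apply_bcontfun x t}) = S"
        unfolding S_def by auto
      ultimately show ?thesis by simp
    qed
    then show ?thesis using complete_eq_closed by blast
  qed
  have neS: "S \<noteq> {}" using S_def by (auto intro!: exI[of _ "const_bcontfun 0"] simp: const_bcontfun.rep_eq)
  define q where "q = 2 * p * L * e"
  have q: "0 \<le> q" "q < 1" unfolding q_def using p L e small by auto
  have contr: "dist (T x0 x) (T y0 y) \<le> \<bar>x0 - y0\<bar> + q * dist x y" if "x \<in> S" "y \<in> S" for x y x0 y0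
  proof (rule dist_bound)
    fix t
    have "\<bar>e * (W x t - W y t)\<bar> \<le> e * (2 * p * L * dist x y)"
      using mult_left_mono[OF WW[OF that, of t] e] e by (simp add: abs_mult)
    then show "dist (apply_bcontfun (T x0 x) t) (apply_bcontfun (T y0 y) t) \<le> \<bar>x0 - y0\<bar> + q * dist x y"
      unfolding T[OF that(1)] T[OF that(2)] dist_real_def q_def by (simp add: algebra_simps)
  qed
  have "\<exists>!x. x \<in> S \<and> T x0 x = x" for x0
  proof (rule Banach_fix[OF closedS neS q])
    show "T x0 ` S \<subseteq> S" using TS by (rule image_subsetI)
    show "dist (T x0 x) (T x0 y) \<le> q * dist x y" if "x \<in> S" "y \<in> S" for x y
      using contr[OF that, of x0 x0] by simp
  qed
  then obtain Z where ZS: "Z x0 \<in> S" and ZT: "T x0 (Z x0) = Z x0" for x0 by metis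
  have Z: "apply_bcontfun (Z x0) t = x0 + e * W (Z x0) t" for x0 t
    using T[OF ZS[of x0], of x0 t] ZT[of x0] by simp
  have Zlip: "dist (Z x0) (Z y0) \<le> \<bar>x0 - y0\<bar> / (1 - q)" for x0 y0
    using contr[OF ZS ZS, of x0 x0 y0 y0] q unfolding ZT by (simp add: field_simps)
  define \<mu> where "\<mu> x0 = N (Z x0) p / p" for x0
  show ?thesis
  proof (intro exI[of _ "\<lambda>x0. apply_bcontfun (Z x0)"] exI[of _ \<mu>] allI conjI)
    fix x0 y0 t
    show "Z x0 (t + p) = Z x0 t" using ZS unfolding S_def by blast
    have "((\<lambda>t. x0 + e * W (Z x0) t) has_real_derivative e * (g (Z x0 t) t - \<mu> x0)) (at t)"
      unfolding \<mu>_def using dW[of "Z x0" t] by (auto intro!: derivative_eq_intros simp: \<Phi>_def)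
    moreover have "apply_bcontfun (Z x0) = (\<lambda>t. x0 + e * W (Z x0) t)" using Z by auto
    ultimately show "(apply_bcontfun (Z x0) has_real_derivative e * (g (Z x0 t) t - \<mu> x0)) (at t)" by simp
    show "\<bar>Z x0 t - x0\<bar> \<le> 2 * p * C * e"
      using Z[of x0 t] mult_left_mono[OF bdW[OF ZS[of x0], of t] e] e by (simp add: abs_mult mult_ac)
    have "((\<Phi> (Z x0)) has_integral (N (Z x0) p - N (Z x0) 0)) {0..p}"
      using p dN by (intro fundamental_theorem_of_calculus)
        (auto simp: has_real_derivative_iff_has_vector_derivative[symmetric] intro: has_field_derivative_at_within)
    then show "((\<lambda>s. g (Z x0 s) s) has_integral p * \<mu> x0) {0..p}"
      using p N0 unfolding \<mu>_def \<Phi>_def by simp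
    have "\<bar>\<mu> x0 - \<mu> y0\<bar> = \<bar>N (Z x0) p - N (Z y0) p\<bar> / p"
      unfolding \<mu>_def using p by (simp add: diff_divide_distrib[symmetric])
    also have "\<dots> \<le> L * dist (Z x0) (Z y0)" using NN[of p "Z x0" "Z y0"] p by (simp add: field_simps)
    also have "\<dots> \<le> L * (\<bar>x0 - y0\<bar> / (1 - q))" using Zlip L by (intro mult_left_mono)
    finally show "\<bar>\<mu> x0 - \<mu> y0\<bar> \<le> L / (1 - 2 * p * L * e) * \<bar>x0 - y0\<bar>" by (simp add: q_def)
  qed
qed

lemma has_integral_abs_bound:
  fixes f :: "real \<Rightarrow> real"
  assumes "(f has_integral I) {0..p}" "0 \<le> p" "0 \<le> B" "\<And>t. t \<in> {0..p} \<Longrightarrow> \<bar>f t\<bar> \<le> B"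
  shows "\<bar>I\<bar> \<le> B * p"
  using has_integral_bound_real[of B "{}" f I 0 p] assms by simp

text \<open>Near a simple zero \<open>xs\<close> of the averaged function, the bifurcation function of \<open>lyapunov_schmidt\<close> is close to
  the average and changes sign, which gives a periodic solution. For isolation, a second motion is allowed to be
  parametrized by its own time with increasing angle \<open>\<theta>\<close>, since this is how the periodic orbits of the planar field
  appear. If it never meets the first solution, then the squared difference, corrected by a periodic factor that
  removes the oscillation of \<open>Gx 0 xs\<close>, is strictly monotone, which contradicts its periodicity.\<close>

lemma periodic_averaging:
  fixes G Gx :: "real \<Rightarrow> real \<Rightarrow> real \<Rightarrow> real"
  assumes p: "0 < p" and E: "0 < E"
    and contG: "continuous_on ({0..E} \<times> {a..b} \<times> UNIV) (\<lambda>(e, x, t). G e x t)"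
    and contGx: "continuous_on ({0..E} \<times> {a..b} \<times> UNIV) (\<lambda>(e, x, t). Gx e x t)"
    and der: "\<And>e x t. e \<in> {0..E} \<Longrightarrow> x \<in> {a..b} \<Longrightarrow>
        ((\<lambda>x. G e x t) has_real_derivative Gx e x t) (at x within {a..b})"
    and per: "\<And>e x t. e \<in> {0..E} \<Longrightarrow> x \<in> {a..b} \<Longrightarrow> G e x (t + p) = G e x t"
    and perx: "\<And>e x t. e \<in> {0..E} \<Longrightarrow> x \<in> {a..b} \<Longrightarrow> Gx e x (t + p) = Gx e x t"
    and xs: "a < xs" "xs < b"
    and M: "((\<lambda>t. G 0 xs t) has_integral 0) {0..p}"
    and m: "((\<lambda>t. Gx 0 xs t) has_integral m) {0..p}" "m \<noteq> 0"
    and \<delta>0: "0 < \<delta>0"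
  obtains \<delta> E' where "0 < \<delta>" "\<delta> \<le> \<delta>0" "a < xs - \<delta>" "xs + \<delta> < b" "0 < E'" "E' \<le> E"
    "\<And>e. 0 < e \<Longrightarrow> e \<le> E' \<Longrightarrow> \<exists>x. (\<forall>t. x (t + p) = x t) \<and>
        (\<forall>t. (x has_real_derivative e * G e (x t) t) (at t)) \<and> (\<forall>t. \<bar>x t - xs\<bar> < \<delta>)"
    "\<And>e x y \<theta> \<theta>' T k. 0 < e \<Longrightarrow> e \<le> E' \<Longrightarrow> (\<And>t. x (t + p) = x t) \<Longrightarrow>
        (\<And>t. (x has_real_derivative e * G e (x t) t) (at t)) \<Longrightarrow> (\<And>t. \<bar>x t - xs\<bar> < \<delta>) \<Longrightarrow>
        (\<And>t. (\<theta> has_real_derivative \<theta>' t) (at t)) \<Longrightarrow> (\<And>t. 0 < \<theta>' t) \<Longrightarrow>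
        (\<And>t. (y has_real_derivative \<theta>' t * (e * G e (y t) (\<theta> t))) (at t)) \<Longrightarrow>
        (\<And>t. \<bar>y t - xs\<bar> < \<delta>) \<Longrightarrow> 0 < T \<Longrightarrow> \<theta> T = \<theta> 0 + of_int k * p \<Longrightarrow> y T = y 0 \<Longrightarrow>
        \<exists>t. y t = x (\<theta> t)"
proof -
  \<comment> \<open>With this tolerance, errors in \<open>Gx\<close> over a period sum up to at most a quarter of \<open>\<bar>m\<bar>\<close>.\<close>
  define q where "q = \<bar>m\<bar> / (4 * p)"
  have q: "0 < q" unfolding q_def using p m by simp
  let ?K = "{0..E} \<times> {a..b} \<times> {0..p}"
  have K: "compact ?K" by (intro compact_Times) auto
  have ucG: "uniformly_continuous_on ?K (\<lambda>(e, x, t). G e x t)"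
    by (rule compact_uniformly_continuous[OF continuous_on_subset[OF contG] K]) auto
  have ucGx: "uniformly_continuous_on ?K (\<lambda>(e, x, t). Gx e x t)"
    by (rule compact_uniformly_continuous[OF continuous_on_subset[OF contGx] K]) auto
  have "bounded ((\<lambda>(e, x, t). G e x t) ` ?K)"
    by (intro compact_imp_bounded compact_continuous_image[OF continuous_on_subset[OF contG] K]) auto
  then obtain C where C: "\<And>e x t. e \<in> {0..E} \<Longrightarrow> x \<in> {a..b} \<Longrightarrow> t \<in> {0..p} \<Longrightarrow> \<bar>G e x t\<bar> \<le> C"
    unfolding bounded_iff by force
  have "bounded ((\<lambda>(e, x, t). Gx e x t) ` ?K)"
    by (intro compact_imp_bounded compact_continuous_image[OF continuous_on_subset[OF contGx] K]) auto
  then obtain L where L: "\<And>e x t. e \<in> {0..E} \<Longrightarrow> x \<in> {a..b} \<Longrightarrow> t \<in> {0..p} \<Longrightarrow> \<bar>Gx e x t\<bar> \<le> L"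
    unfolding bounded_iff by force
  have redG: "\<exists>s\<in>{0..p}. \<forall>e\<in>{0..E}. \<forall>x\<in>{a..b}. G e x t = G e x s \<and> Gx e x t = Gx e x s" for t
  proof -
    obtain s k where s: "s \<in> {0..p}" "t = s + of_int k * p" using reduce_to_period[OF p] by metis
    show ?thesis
    proof (intro bexI[of _ s] ballI s(1) conjI)
      fix e x assume "e \<in> {0..E}" "x \<in> {a..b}"
      then show "G e x t = G e x s" "Gx e x t = Gx e x s"
        using periodic_int[of "G e x" p s k] periodic_int[of "Gx e x" p s k] per perx s(2) by simp_all
    qed
  qed
  have C: "\<bar>G e x t\<bar> \<le> C" and L: "\<bar>Gx e x t\<bar> \<le> L" if "e \<in> {0..E}" "x \<in> {a..b}" for e x t
    using redG[of t] C L that by metis+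
  have E0: "0 \<in> {0..E}" and xsab: "xs \<in> {a..b}" using E xs by auto
  have C0: "0 \<le> C" and L0: "0 \<le> L" using C[OF E0 xsab, of 0] L[OF E0 xsab, of 0] by linarith+
  obtain \<eta> where \<eta>: "0 < \<eta>" "\<And>u v. u \<in> ?K \<Longrightarrow> v \<in> ?K \<Longrightarrow> dist u v < \<eta> \<Longrightarrow>
      dist ((\<lambda>(e, x, t). Gx e x t) u) ((\<lambda>(e, x, t). Gx e x t) v) < q"
    using ucGx q unfolding uniformly_continuous_on_def by metis
  have near: "\<bar>Gx e x t - Gx 0 xs t\<bar> \<le> q" if "e \<in> {0..E}" "x \<in> {a..b}" "e < \<eta> / 2" "\<bar>x - xs\<bar> < \<eta> / 2" for e x t
  proof -
    obtain s where s0: "s \<in> {0..p}"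
        and sE: "\<forall>e\<in>{0..E}. \<forall>x\<in>{a..b}. G e x t = G e x s \<and> Gx e x t = Gx e x s"
      using redG[of t] by (elim bexE)
    have s: "s \<in> {0..p}" "Gx e x t = Gx e x s" "Gx 0 xs t = Gx 0 xs s"
      using s0 sE[rule_format, OF that(1,2)] sE[rule_format, OF E0 xsab] by simp_all
    have "dist (e, x, s) (0, xs, s) \<le> \<bar>e\<bar> + \<bar>x - xs\<bar>"
      using sqrt_sum_squares_le_sum_abs[of e "x - xs"] by (simp add: dist_Pair_Pair dist_real_def)
    then have "dist (e, x, s) (0, xs, s) < \<eta>" using that by auto
    from \<eta>(2)[OF _ _ this] show ?thesis using that s E0 xsab by (simp add: dist_real_def)
  qed
  define \<delta> where "\<delta> = Min {\<delta>0, \<eta> / 4, (xs - a) / 2, (b - xs) / 2}"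
  have \<delta>: "0 < \<delta>" "\<delta> \<le> \<delta>0" "\<delta> < \<eta> / 2" "a < xs - \<delta>" "xs + \<delta> < b"
  proof -
    show "0 < \<delta>" unfolding \<delta>_def using \<delta>0 \<eta>(1) xs by simp
    have "\<delta> \<le> \<delta>0" "\<delta> \<le> \<eta> / 4" "\<delta> \<le> (xs - a) / 2" "\<delta> \<le> (b - xs) / 2"
      unfolding \<delta>_def by (rule Min_le; simp)+
    then show "\<delta> \<le> \<delta>0" "\<delta> < \<eta> / 2" "a < xs - \<delta>" "xs + \<delta> < b" using xs \<eta>(1) by (simp_all add: field_simps)
  qed
  have tube: "x \<in> {a..b}" "\<bar>x - xs\<bar> < \<eta> / 2" if "\<bar>x - xs\<bar> \<le> \<delta>" for x
    using that \<delta> by auto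
  \<comment> \<open>Existence and isolation both rest on this estimate for difference quotients in the tube.\<close>
  have secant: "\<bar>G e x t - G e y t - Gx 0 xs t * (x - y)\<bar> \<le> q * \<bar>x - y\<bar>"
    if e: "e \<in> {0..E}" "e < \<eta> / 2" and xy: "\<bar>x - xs\<bar> \<le> \<delta>" "\<bar>y - xs\<bar> \<le> \<delta>" for e x y t
  proof -
    let ?I = "{xs - \<delta>..xs + \<delta>}"
    have "norm ((\<lambda>x. G e x t - Gx 0 xs t * x) x - (\<lambda>x. G e x t - Gx 0 xs t * x) y) \<le> q * norm (x - y)"
    proof (rule field_differentiable_bound[of ?I _ "\<lambda>x. Gx e x t - Gx 0 xs t"])
      fix z assume z: "z \<in> ?I"
      then have z': "\<bar>z - xs\<bar> \<le> \<delta>" by auto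
      have "((\<lambda>x. G e x t) has_real_derivative Gx e z t) (at z within ?I)"
        by (rule has_field_derivative_subset[OF der[OF e(1) tube(1)[OF z']]]) (use \<delta> in auto)
      then show "((\<lambda>x. G e x t - Gx 0 xs t * x) has_real_derivative Gx e z t - Gx 0 xs t) (at z within ?I)"
        by (auto intro!: derivative_eq_intros)
      show "norm (Gx e z t - Gx 0 xs t) \<le> q" using near[OF e(1) tube(1)[OF z'] e(2) tube(2)[OF z']] by simp
    qed (use xy in auto)
    then show ?thesis by (simp add: algebra_simps)
  qed
  define r where "r = \<bar>m\<bar> * \<delta> / (32 * p)"
  have r: "0 < r" unfolding r_def using p m \<delta> by simp
  obtain \<eta>2 where \<eta>2: "0 < \<eta>2" "\<And>u v. u \<in> ?K \<Longrightarrow> v \<in> ?K \<Longrightarrow> dist u v < \<eta>2 \<Longrightarrow>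
      dist ((\<lambda>(e, x, t). G e x t) u) ((\<lambda>(e, x, t). G e x t) v) < r"
    using ucG r unfolding uniformly_continuous_on_def by metis
  have near0: "\<bar>G e x t - G 0 x t\<bar> \<le> r" if "e \<in> {0..E}" "x \<in> {a..b}" "e < \<eta>2" for e x t
  proof -
    obtain s where s0: "s \<in> {0..p}"
        and sE: "\<forall>e\<in>{0..E}. \<forall>x\<in>{a..b}. G e x t = G e x s \<and> Gx e x t = Gx e x s"
      using redG[of t] by (elim bexE)
    have s: "s \<in> {0..p}" "G e x t = G e x s" "G 0 x t = G 0 x s"
      using s0 sE[rule_format, OF that(1,2)] sE[rule_format, OF E0 that(2)] by simp_all
    have "dist (e, x, s) (0, x, s) < \<eta>2" using that by (simp add: dist_Pair_Pair dist_real_def)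
    from \<eta>2(2)[OF _ _ this] show ?thesis using that s E0 by (simp add: dist_real_def)
  qed
  \<comment> \<open>In this order, the bounds on \<open>e\<close> after the first give the estimate \<open>secant\<close>, the estimate \<open>near0\<close>, the contraction, solutions
    that stay in the tube, and an error of at most \<open>r\<close> from replacing a solution by its initial value.\<close>
  define E' where "E' = Min {E, \<eta> / 4, \<eta>2 / 2, 1 / (4 * p * (L + 1)), \<delta> / (4 * p * (C + 1) + 1), r / (2 * p * (L + 1) * (C + 1))}"
  have pos: "0 < 1 / (4 * p * (L + 1))" "0 < \<delta> / (4 * p * (C + 1) + 1)" "0 < r / (2 * p * (L + 1) * (C + 1))"
    using p L0 C0 \<delta> r by (auto intro!: divide_pos_pos mult_pos_pos add_nonneg_pos mult_nonneg_nonneg)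
  have E': "0 < E'"
    unfolding E'_def using E \<eta>(1) \<eta>2(1) pos by (subst Min_gr_iff) auto
  have E': "0 < E'" "E' \<le> E" "E' \<le> \<eta> / 4" "E' \<le> \<eta>2 / 2" "E' \<le> 1 / (4 * p * (L + 1))"
      "E' \<le> \<delta> / (4 * p * (C + 1) + 1)" "E' \<le> r / (2 * p * (L + 1) * (C + 1))"
    using E' unfolding E'_def by (blast intro!: Min_le)+
  show ?thesis
  proof (rule that[OF \<delta>(1,2,4,5) E'(1,2)])
    fix e assume e: "0 < e" "e \<le> E'"
    then have eE: "e \<in> {0..E}" and e\<eta>: "e < \<eta> / 2" "e < \<eta>2" using E' \<eta>(1) \<eta>2(1) by auto
    have e1: "e * (4 * p * (L + 1)) \<le> 1"
      using order_trans[OF e(2) E'(5)] p L0 by (simp add: pos_le_divide_eq)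
    have "4 * p * (C + 1) + 1 > 0" using p C0 by (simp add: add_nonneg_pos)
    then have e2: "e * (4 * p * (C + 1) + 1) \<le> \<delta>"
      using order_trans[OF e(2) E'(6)] by (simp add: pos_le_divide_eq)
    have "0 < 2 * p * (L + 1) * (C + 1)" using p L0 C0 by simp
    then have e3: "e * (2 * p * (L + 1) * (C + 1)) \<le> r"
      using order_trans[OF e(2) E'(7)] by (simp add: pos_le_divide_eq)
    \<comment> \<open>Clamping to the tube makes the equation globally Lipschitz; the solutions that are found stay in the tube.\<close>
    define cl where "cl x = max (xs - \<delta>) (min (xs + \<delta>) x)" for x
    have cl: "\<bar>cl x - xs\<bar> \<le> \<delta>" for x unfolding cl_def using \<delta>(1) by (auto simp: max_def min_def)
    have cl_id: "cl x = x" if "\<bar>x - xs\<bar> \<le> \<delta>" for x using that unfolding cl_def by (auto simp: max_def min_def)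
    have cl_lip: "\<bar>cl x - cl y\<bar> \<le> \<bar>x - y\<bar>" for x y unfolding cl_def by (auto simp: max_def min_def)
    have cl_cont: "continuous_on UNIV cl" unfolding cl_def[abs_def] by (intro continuous_intros)
    have Glip: "\<bar>G e x t - G e y t\<bar> \<le> L * \<bar>x - y\<bar>" if "x \<in> {a..b}" "y \<in> {a..b}" for x y t
      using field_differentiable_bound[of "{a..b}" "\<lambda>x. G e x t" "\<lambda>x. Gx e x t" L x y] der[OF eE] L[OF eE] that
      by auto
    let ?g = "\<lambda>x t. G e (cl x) t"
    have "\<exists>X \<mu>. \<forall>x0. (\<forall>t. X x0 (t + p) = X x0 t) \<and>
           (\<forall>t. (X x0 has_real_derivative e * (?g (X x0 t) t - \<mu> x0)) (at t)) \<and>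
           (\<forall>t. \<bar>X x0 t - x0\<bar> \<le> 2 * p * C * e) \<and>
           ((\<lambda>s. ?g (X x0 s) s) has_integral p * \<mu> x0) {0..p} \<and>
           (\<forall>y0. \<bar>\<mu> x0 - \<mu> y0\<bar> \<le> L / (1 - 2 * p * L * e) * \<bar>x0 - y0\<bar>)"
    proof (rule lyapunov_schmidt[OF p _ _ L0])
      show "2 * p * L * e < 1"
      proof -
        have "0 < p * e" "0 \<le> L * (p * e)" using p e L0 by simp_all
        then show ?thesis using e1 by (simp add: algebra_simps)
      qed
      show "continuous_on UNIV (\<lambda>(x, s). G e (cl x) s)"
      proof -
        have "continuous_on UNIV ((\<lambda>(e, x, t). G e x t) \<circ> (\<lambda>(x, s). (e, cl x, s)))"
        proof (rule continuous_on_compose)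
          show "continuous_on UNIV (\<lambda>(x::real, s::real). (e, cl x, s))"
            unfolding split_beta
            by (intro continuous_intros continuous_on_compose2[OF cl_cont]) auto
          show "continuous_on ((\<lambda>(x, s). (e, cl x, s)) ` UNIV) (\<lambda>(e, x, t). G e x t)"
            by (rule continuous_on_subset[OF contG]) (use eE tube(1)[OF cl] in auto)
        qed
        then show ?thesis by (simp add: o_def split_beta)
      qed
      show "\<bar>G e (cl x) s - G e (cl y) s\<bar> \<le> L * \<bar>x - y\<bar>" for x y s
        using Glip[OF tube(1)[OF cl] tube(1)[OF cl], of x s y] mult_left_mono[OF cl_lip[of x y] L0] by linarith
      show "\<bar>G e (cl x) s\<bar> \<le> C" for x s using C[OF eE tube(1)[OF cl]] .
      show "G e (cl x) (s + p) = G e (cl x) s" for x s using per[OF eE tube(1)[OF cl]] .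
    qed (use e in simp)
    then obtain X \<mu> where X: "\<And>x0 t. X x0 (t + p) = X x0 t"
        "\<And>x0 t. (X x0 has_real_derivative e * (?g (X x0 t) t - \<mu> x0)) (at t)"
        "\<And>x0 t. \<bar>X x0 t - x0\<bar> \<le> 2 * p * C * e"
        "\<And>x0. ((\<lambda>s. ?g (X x0 s) s) has_integral p * \<mu> x0) {0..p}"
        "\<And>x0 y0. \<bar>\<mu> x0 - \<mu> y0\<bar> \<le> L / (1 - 2 * p * L * e) * \<bar>x0 - y0\<bar>"
      by blast
    have pe: "0 < p * e" using p e by simp
    have small: "2 * p * C * e < \<delta> / 2"
    proof -
      have "2 * (2 * p * C * e) + 4 * (p * e) + e \<le> \<delta>" using e2 by (simp add: algebra_simps)
      then show ?thesis using pe e by linarith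
    qed
    have X_in: "\<bar>X x0 t - xs\<bar> < \<delta>" if "\<bar>x0 - xs\<bar> \<le> \<delta> / 2" for x0 t
      using X(3)[of x0 t] that small by linarith
    have est: "\<bar>p * \<mu> (xs + h) - h * m\<bar> \<le> \<bar>m\<bar> * \<delta> / 4" if h: "\<bar>h\<bar> = \<delta> / 2" for h
    proof -
      have hi: "((\<lambda>t. ?g (X (xs + h) t) t - G 0 xs t - h * Gx 0 xs t) has_integral p * \<mu> (xs + h) - 0 - h * m) {0..p}"
        by (intro has_integral_diff X(4) M has_integral_mult_right m(1))
      have "\<bar>p * \<mu> (xs + h) - 0 - h * m\<bar> \<le> (r + r + q * (\<delta> / 2)) * p"
      proof (rule has_integral_abs_bound[OF hi])
        fix t
        have xh: "\<bar>(xs + h) - xs\<bar> \<le> \<delta>" using h \<delta>(1) by simp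
        have Xt: "\<bar>X (xs + h) t - xs\<bar> \<le> \<delta>" using X_in[of "xs + h" t] h by simp
        have "\<bar>G e (X (xs + h) t) t - G e (xs + h) t\<bar> \<le> L * \<bar>X (xs + h) t - (xs + h)\<bar>"
          using Glip[OF tube(1)[OF Xt] tube(1)[OF xh]] .
        also have "\<dots> \<le> L * (2 * p * C * e)" using X(3) L0 by (intro mult_left_mono)
        also have "\<dots> \<le> r"
        proof -
          have "L * (2 * p * C * e) = 2 * (p * e) * (L * C)" by simp
          also have "\<dots> \<le> 2 * (p * e) * ((L + 1) * (C + 1))" using pe L0 C0
            by (intro mult_left_mono mult_mono) auto
          finally show ?thesis using e3 by (simp add: mult_ac)
        qed
        finally have 1: "\<bar>G e (X (xs + h) t) t - G e (xs + h) t\<bar> \<le> r" .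
        have 2: "\<bar>G e (xs + h) t - G 0 (xs + h) t\<bar> \<le> r" using near0[OF eE tube(1)[OF xh] e\<eta>(2)] .
        have 3: "\<bar>G 0 (xs + h) t - G 0 xs t - Gx 0 xs t * h\<bar> \<le> q * (\<delta> / 2)"
          using secant[OF E0 _ xh, of xs t] \<eta>(1) \<delta>(1) h by simp
        show "\<bar>?g (X (xs + h) t) t - G 0 xs t - h * Gx 0 xs t\<bar> \<le> r + r + q * (\<delta> / 2)"
          using 1 2 3 unfolding cl_id[OF Xt] mult.commute[of "Gx 0 xs t" h] by linarith
      qed (use p r q \<delta> in simp_all)
      also have "(r + r + q * (\<delta> / 2)) * p \<le> \<bar>m\<bar> * \<delta> / 4"
        unfolding r_def q_def using p m \<delta> by (simp add: field_simps)
      finally show ?thesis by simp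
    qed
    have sgn: "\<mu> (xs + \<delta> / 2) * m > 0" "\<mu> (xs - \<delta> / 2) * m < 0"
    proof -
      have "\<bar>p * \<mu> (xs + \<delta> / 2) - \<delta> / 2 * m\<bar> \<le> \<bar>m\<bar> * \<delta> / 4" using est[of "\<delta> / 2"] \<delta>(1) by simp
      moreover have "\<bar>p * \<mu> (xs - \<delta> / 2) + \<delta> / 2 * m\<bar> \<le> \<bar>m\<bar> * \<delta> / 4" using est[of "- \<delta> / 2"] \<delta>(1) by simp
      moreover have "\<bar>m\<bar> * \<delta> / 4 < \<delta> / 2 * \<bar>m\<bar>" using \<delta>(1) m(2) by simp
      ultimately have "(m > 0 \<longrightarrow> p * \<mu> (xs + \<delta> / 2) > 0 \<and> p * \<mu> (xs - \<delta> / 2) < 0) \<and>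
          (m < 0 \<longrightarrow> p * \<mu> (xs + \<delta> / 2) < 0 \<and> p * \<mu> (xs - \<delta> / 2) > 0)"
        by (auto simp: abs_if split: if_splits)
      then show "\<mu> (xs + \<delta> / 2) * m > 0" "\<mu> (xs - \<delta> / 2) * m < 0"
        using m(2) p by (auto simp: zero_less_mult_iff mult_less_0_iff)
    qed
    have "continuous_on UNIV \<mu>"
      unfolding continuous_on_iff
    proof (intro ballI allI impI)
      fix x and \<epsilon> :: real assume "0 < \<epsilon>"
      define Q where "Q = \<bar>L / (1 - 2 * p * L * e)\<bar> + 1"
      have Q: "0 < Q" "L / (1 - 2 * p * L * e) \<le> Q" unfolding Q_def by linarith+
      have "dist (\<mu> x') (\<mu> x) < \<epsilon>" if "dist x' x < \<epsilon> / Q" for x'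
      proof -
        have "\<bar>\<mu> x' - \<mu> x\<bar> \<le> Q * \<bar>x' - x\<bar>"
          using X(5)[of x' x] mult_right_mono[OF Q(2), of "\<bar>x' - x\<bar>"] by linarith
        also have "\<dots> < \<epsilon>" using that Q(1) by (simp add: dist_real_def pos_less_divide_eq mult.commute)
        finally show ?thesis by (simp add: dist_real_def)
      qed
      then show "\<exists>d>0. \<forall>x'\<in>UNIV. dist x' x < d \<longrightarrow> dist (\<mu> x') (\<mu> x) < \<epsilon>"
        using \<open>0 < \<epsilon>\<close> Q(1) by (intro exI[of _ "\<epsilon> / Q"]) auto
    qed
    then have "continuous_on {xs - \<delta> / 2..xs + \<delta> / 2} (\<lambda>x. \<mu> x * m)"
      by (intro continuous_intros) (auto intro: continuous_on_subset)
    then obtain x0 where x0: "xs - \<delta> / 2 \<le> x0" "x0 \<le> xs + \<delta> / 2" "\<mu> x0 * m = 0"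
      using IVT'[of "\<lambda>x. \<mu> x * m" "xs - \<delta> / 2" 0 "xs + \<delta> / 2"] sgn \<delta>(1) by force
    then have \<mu>0: "\<mu> x0 = 0" using m(2) by simp
    have tb: "\<bar>X x0 t - xs\<bar> < \<delta>" for t 
    proof (rule X_in)
      show "\<bar>x0 - xs\<bar> \<le> \<delta> / 2" using x0(1,2) by linarith
    qed
    show "\<exists>x. (\<forall>t. x (t + p) = x t) \<and>
        (\<forall>t. (x has_real_derivative e * G e (x t) t) (at t)) \<and> (\<forall>t. \<bar>x t - xs\<bar> < \<delta>)"
    proof (intro exI[of _ "X x0"] conjI allI)
      show "(X x0 has_real_derivative e * G e (X x0 t) t) (at t)" for t
        using X(2)[of x0 t] \<mu>0 cl_id[of "X x0 t"] tb[of t] by simp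
    qed (use X(1) tb in auto)
  next
    fix e x y \<theta> \<theta>' and T :: real and k
    assume e: "0 < e" "e \<le> E'"
      and xper: "\<And>t. x (t + p) = x t" and dx: "\<And>t. (x has_real_derivative e * G e (x t) t) (at t)"
      and xt: "\<And>t. \<bar>x t - xs\<bar> < \<delta>"
      and d\<theta>: "\<And>t. (\<theta> has_real_derivative \<theta>' t) (at t)" "\<And>t. 0 < \<theta>' t"
      and dy: "\<And>t. (y has_real_derivative \<theta>' t * (e * G e (y t) (\<theta> t))) (at t)"
      and yt: "\<And>t. \<bar>y t - xs\<bar> < \<delta>" and T: "0 < T" "\<theta> T = \<theta> 0 + of_int k * p" "y T = y 0"
    have eE: "e \<in> {0..E}" and e\<eta>: "e < \<eta> / 2" using e E' \<eta>(1) by auto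
    show "\<exists>t. y t = x (\<theta> t)"
    proof (rule ccontr)
      assume "\<not> ?thesis"
      then have ne: "y t \<noteq> x (\<theta> t)" for t by blast
      have "continuous_on UNIV (\<lambda>t. Gx 0 xs t)"
      proof -
        have "continuous_on UNIV (\<lambda>t::real. (0::real, xs, t))" by (intro continuous_intros)
        moreover have "range (\<lambda>t. (0, xs, t)) \<subseteq> {0..E} \<times> {a..b} \<times> UNIV" using E0 xsab by auto
        ultimately have "continuous_on UNIV (\<lambda>t. (\<lambda>(e, x, t). Gx e x t) (0, xs, t))"
          by (rule continuous_on_compose2[OF contGx])
        then show ?thesis by simp
      qed
      then obtain A where A: "A 0 = 0" "\<And>t. (A has_real_derivative Gx 0 xs t) (at t)"
        using antiderivative_exists_real by blast
      have "((\<lambda>t. Gx 0 xs t) has_integral A p - A 0) {0..p}"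
        using p A(2) by (intro fundamental_theorem_of_calculus)
          (auto simp: has_real_derivative_iff_has_vector_derivative[symmetric] intro: has_field_derivative_at_within)
      from has_integral_unique[OF this m(1)] have Ap: "A p = m" using A(1) by simp
      define B where "B t = A t - t * m / p" for t
      have dB: "(B has_real_derivative Gx 0 xs t - m / p) (at t)" for t
        unfolding B_def[abs_def] using A(2)[of t] p by (auto intro!: derivative_eq_intros)
      have Bper: "B (t + p) = B t" for t
      proof -
        have "A (t + p) - A t = A p - A 0" by (rule antiderivative_shift[OF A(2) perx[OF E0 xsab]])
        then have "A (t + p) = A t + m" using A(1) Ap by simp
        then show ?thesis unfolding B_def using p by (simp add: field_simps)
      qed
      define u where "u t = y t - x (\<theta> t)" for t
      define \<Delta> where "\<Delta> t = G e (y t) (\<theta> t) - G e (x (\<theta> t)) (\<theta> t)" for t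
      have du: "(u has_real_derivative \<theta>' t * e * \<Delta> t) (at t)" for t
      proof -
        have "((\<lambda>t. x (\<theta> t)) has_real_derivative e * G e (x (\<theta> t)) (\<theta> t) * \<theta>' t) (at t)"
          using DERIV_chain2[OF dx d\<theta>(1)] .
        from DERIV_diff[OF dy[of t] this] show ?thesis
          unfolding u_def[abs_def] \<Delta>_def by (simp add: algebra_simps)
      qed
      \<comment> \<open>The factor \<open>exp (- 2 * e * B)\<close> is periodic and replaces \<open>Gx 0 xs\<close> in the derivative by its mean \<open>m / p\<close>.\<close>
      define V where "V t = (u t)\<^sup>2 * exp (- (2 * e * B (\<theta> t)))" for t
      define V' where "V' t = 2 * \<theta>' t * e * exp (- (2 * e * B (\<theta> t))) *
          (u t * \<Delta> t - (Gx 0 xs (\<theta> t) - m / p) * (u t)\<^sup>2)" for t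
      have dV: "(V has_real_derivative V' t) (at t)" for t
      proof -
        have "((\<lambda>t. B (\<theta> t)) has_real_derivative (Gx 0 xs (\<theta> t) - m / p) * \<theta>' t) (at t)"
          using DERIV_chain2[OF dB d\<theta>(1)] .
        note [derivative_intros] = this
        show ?thesis unfolding V_def[abs_def] V'_def
          by (auto intro!: derivative_eq_intros du simp: power2_eq_square algebra_simps)
      qed
      define \<sigma> where "\<sigma> = sgn m"
      have \<sigma>: "\<sigma> * m = \<bar>m\<bar>" "\<bar>\<sigma>\<bar> = 1" unfolding \<sigma>_def using m(2) by (auto simp: sgn_if)
      have pos: "0 < \<sigma> * V' t" for t
      proof -
        have u2: "0 < (u t)\<^sup>2" using ne[of t] unfolding u_def by simp
        have "\<bar>\<Delta> t - Gx 0 xs (\<theta> t) * u t\<bar> \<le> q * \<bar>u t\<bar>"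
          unfolding \<Delta>_def u_def using secant[OF eE e\<eta>] yt xt by (simp add: less_imp_le)
        then have "\<bar>u t\<bar> * \<bar>\<Delta> t - Gx 0 xs (\<theta> t) * u t\<bar> \<le> \<bar>u t\<bar> * (q * \<bar>u t\<bar>)" by (intro mult_left_mono) auto
        then have 1: "\<bar>u t * (\<Delta> t - Gx 0 xs (\<theta> t) * u t)\<bar> \<le> q * (u t)\<^sup>2"
          by (simp add: abs_mult power2_eq_square mult_ac)
        have "\<bar>\<sigma> * (u t * (\<Delta> t - Gx 0 xs (\<theta> t) * u t))\<bar> \<le> q * (u t)\<^sup>2"
          using 1 \<sigma>(2) by (simp add: abs_mult)
        moreover have "\<sigma> * (u t * \<Delta> t - (Gx 0 xs (\<theta> t) - m / p) * (u t)\<^sup>2) =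
            \<sigma> * (u t * (\<Delta> t - Gx 0 xs (\<theta> t) * u t)) + \<sigma> * m / p * (u t)\<^sup>2"
          by (simp add: algebra_simps power2_eq_square)
        moreover have "q * (u t)\<^sup>2 < \<sigma> * m / p * (u t)\<^sup>2"
          unfolding \<sigma>(1) q_def using u2 p m(2) by (intro mult_strict_right_mono) (simp_all add: field_simps)
        ultimately have "0 < \<sigma> * (u t * \<Delta> t - (Gx 0 xs (\<theta> t) - m / p) * (u t)\<^sup>2)" by linarith
        moreover have "0 < 2 * \<theta>' t * e * exp (- (2 * e * B (\<theta> t)))" using d\<theta>(2) e by simp
        ultimately have "0 < (2 * \<theta>' t * e * exp (- (2 * e * B (\<theta> t)))) * (\<sigma> * (u t * \<Delta> t - (Gx 0 xs (\<theta> t) - m / p) * (u t)\<^sup>2))"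
          by (rule mult_pos_pos[rotated])
        then show ?thesis unfolding V'_def by (simp add: mult_ac)
      qed
      have "\<sigma> * V 0 < \<sigma> * V T"
      proof (rule DERIV_pos_imp_increasing[OF T(1), of "\<lambda>t. \<sigma> * V t"])
        show "\<exists>y. ((\<lambda>t. \<sigma> * V t) has_real_derivative y) (at t) \<and> 0 < y" for t
          using DERIV_cmult[OF dV[of t], of \<sigma>] pos[of t] by blast
      qed
      moreover have "V T = V 0"
        unfolding V_def u_def T(2,3) using periodic_int[of x p "\<theta> 0" k] periodic_int[of B p "\<theta> 0" k] xper Bper by simp
      ultimately show False by simp
    qed
  qed
qed

section \<open>Convex polygons around the origin\<close>

definition wedge :: "real \<times> real \<Rightarrow> real \<times> real \<Rightarrow> real" where
  "wedge a b = fst a * snd b - snd a * fst b"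

text \<open>The sign is chosen such that \<open>rot\<close> of the gradient of a function is its Hamiltonian field.\<close>

definition rot :: "real \<times> real \<Rightarrow> real \<times> real" where
  "rot a = (snd a, - fst a)"

lemma inner_rot: "a \<bullet> rot b = wedge a b"
  by (simp add: rot_def wedge_def inner_prod_def)

lemma wedge_self [simp]: "wedge a a = 0" by (simp add: wedge_def)

lemma wedge_add_right: "wedge a (b + c) = wedge a b + wedge a c"
  by (simp add: wedge_def algebra_simps)

lemma wedge_scaleR_right: "wedge a (r *\<^sub>R b) = r * wedge a b"
  by (simp add: wedge_def algebra_simps)

lemma wedge_sum_right: "wedge a (\<Sum>i\<in>A. f i) = (\<Sum>i\<in>A. wedge a (f i))"
  by (simp add: wedge_def fst_sum snd_sum sum_distrib_left sum_subtractf)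

lemma wedge_rot: "wedge a (rot b) = - (a \<bullet> b)"
  by (simp add: rot_def wedge_def inner_prod_def)

lemma wedge_swap: "wedge b a = - wedge a b" by (simp add: wedge_def)

lemma inner_eq_0_of_wedge:
  assumes "wedge a b \<noteq> 0" "a \<bullet> z = 0" "b \<bullet> z = 0"
  shows "z = 0"
proof -
  have "wedge a b * fst z = snd b * (a \<bullet> z) - snd a * (b \<bullet> z)"
    "wedge a b * snd z = fst a * (b \<bullet> z) - fst b * (a \<bullet> z)"
    by (simp_all add: wedge_def inner_prod_def algebra_simps)
  then show ?thesis using assms by (simp add: prod_eq_iff)
qed

lemma mod_add_neq:
  fixes n :: nat assumes "0 < d" "d < n" shows "(j + d) mod n \<noteq> j mod n"
proof
  assume "(j + d) mod n = j mod n"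
  then have "n dvd (j + d) - j" by (metis le_add1 mod_eq_dvd_iff_nat)
  then show False using assms by (simp add: nat_dvd_not_less)
qed

text \<open>The vectors \<open>u j\<close> are the vertices of the dual polygon, in counterclockwise order: \<open>convex_pos\<close> says that \<open>u k\<close> lies
  strictly to the left of the line from \<open>u j\<close> to \<open>u (Suc j)\<close>, and \<open>turn_pos\<close> says the same of the origin. Indices are
  periodic rather than bounded, such that neighbours need no case distinction.\<close>

locale polygon =
  fixes n :: nat and u :: "nat \<Rightarrow> real \<times> real" and lam :: "nat \<Rightarrow> real"
  assumes n3: "3 \<le> n"
    and u_per: "\<And>j. u (j + n) = u j"
    and lam_per: "\<And>j. lam (j + n) = lam j"
    and lam_pos: "\<And>j. 0 < lam j"
    and center: "(\<Sum>j<n. lam j *\<^sub>R u j) = 0"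
    and turn_pos: "\<And>j. 0 < wedge (u j) (u (Suc j))"
    and convex_pos: "\<And>j k. k mod n \<noteq> j mod n \<Longrightarrow> k mod n \<noteq> Suc j mod n \<Longrightarrow>
        0 < wedge (u j) (u (Suc j)) + wedge (u (Suc j)) (u k) + wedge (u k) (u j)"
begin

definition side :: "nat \<Rightarrow> real \<times> real \<Rightarrow> real" where
  "side j z = 1 + u j \<bullet> z"

text \<open>The intersection of the lines \<open>side j = 0\<close> and \<open>side (Suc j) = 0\<close>, by Cramer's rule.\<close>

definition vertex :: "nat \<Rightarrow> real \<times> real" where
  "vertex j = (1 / wedge (u j) (u (Suc j))) *\<^sub>R rot (u j - u (Suc j))"

text \<open>The Minkowski functional of the polygon.\<close>

definition gauge :: "real \<times> real \<Rightarrow> real" where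
  "gauge z = Max ((\<lambda>j. - (u j \<bullet> z)) ` {..<n})"

definition edge_point :: "nat \<Rightarrow> real \<Rightarrow> real \<times> real" where
  "edge_point j s = vertex j + s *\<^sub>R (vertex (Suc j) - vertex j)"

definition inside :: "(real \<times> real) set" where
  "inside = {z. \<forall>j<n. 0 < side j z}"

definition boundary :: "(real \<times> real) set" where
  "boundary = {z. gauge z = 1}"

lemma n_pos: "0 < n" using n3 by simp

lemma mod_lt: "j mod n < n" using n_pos by simp

lemma u_mod [simp]: "u (j mod n) = u j"
proof -
  have "u (j + k * n) = u j" for j k
  proof (induction k)
    case (Suc k)
    then show ?case using u_per[of "j + k * n"] by (simp add: algebra_simps)
  qed simp
  from this[of "j mod n" "j div n"] show ?thesis by simp
qed

lemma lam_mod [simp]: "lam (j mod n) = lam j"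
proof -
  have "lam (j + k * n) = lam j" for j k
  proof (induction k)
    case (Suc k)
    then show ?case using lam_per[of "j + k * n"] by (simp add: algebra_simps)
  qed simp
  from this[of "j mod n" "j div n"] show ?thesis by simp
qed

lemma side_mod [simp]: "side (j mod n) = side j" by (simp add: side_def fun_eq_iff)

lemma u_cong: "j mod n = k mod n \<Longrightarrow> u j = u k" by (metis u_mod)

lemma vertex_mod [simp]: "vertex (j mod n) = vertex j"
proof -
  have "u (Suc (j mod n)) = u (Suc j)" by (rule u_cong) (simp add: mod_Suc_eq)
  then show ?thesis by (simp add: vertex_def)
qed

lemma vertex_add_n [simp]: "vertex (j + n) = vertex j"
  by (metis mod_add_self2 vertex_mod)

lemma turn_ne: "wedge (u j) (u (Suc j)) \<noteq> 0" using turn_pos[of j] by simp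

text \<open>The value at a corner is a quotient of two orientation determinants, so convexity of the dual polygon decides
  its sign.\<close>

lemma side_vertex: "side k (vertex j) =
    (wedge (u j) (u (Suc j)) + wedge (u (Suc j)) (u k) + wedge (u k) (u j)) / wedge (u j) (u (Suc j))"
  using turn_ne[of j]
  by (simp add: side_def vertex_def inner_rot field_simps) (simp add: wedge_def algebra_simps)

lemma side_vertex_0 [simp]: "side j (vertex j) = 0" "side (Suc j) (vertex j) = 0"
  by (simp_all add: side_vertex wedge_swap[of "u (Suc j)" "u j"])

lemma side_vertex_pos:
  assumes "k mod n \<noteq> j mod n" "k mod n \<noteq> Suc j mod n" shows "0 < side k (vertex j)"
  using convex_pos[OF assms] turn_pos[of j] by (simp add: side_vertex)

lemma side_vertex_nonneg: "0 \<le> side k (vertex j)"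
proof (cases "k mod n = j mod n \<or> k mod n = Suc j mod n")
  case True
  then have "side k = side j \<or> side k = side (Suc j)" using side_mod by metis
  then show ?thesis using side_vertex_0 by auto
next
  case False
  then show ?thesis using side_vertex_pos by (simp add: less_imp_le)
qed

lemma side_prev_vertex_pos: "0 < side j (vertex (Suc j))"
  using mod_add_neq[of 1 n j] mod_add_neq[of 2 n j] n3
  by (intro side_vertex_pos) auto

lemma side_next_vertex_pos: "0 < side (Suc (Suc j)) (vertex j)"
  using mod_add_neq[of 2 n j] mod_add_neq[of 1 n "Suc j"] n3
  by (intro side_vertex_pos) auto

text \<open>Two consecutive sides are affine coordinates of the plane.\<close>

lemma side_inj:
  assumes "side j z = side j w" "side (Suc j) z = side (Suc j) w"
  shows "z = w"
  using inner_eq_0_of_wedge[OF turn_ne[of j], of "z - w"] assms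
  by (simp add: side_def inner_diff_right)

lemma side_edge_point: "side k (edge_point j s) = (1 - s) * side k (vertex j) + s * side k (vertex (Suc j))"
  by (simp add: side_def edge_point_def inner_add_right inner_diff_right algebra_simps)

lemma side_edge_point_simps [simp]:
  "side (Suc j) (edge_point j s) = 0"
  "side j (edge_point j s) = s * side j (vertex (Suc j))"
  "side (Suc (Suc j)) (edge_point j s) = (1 - s) * side (Suc (Suc j)) (vertex j)"
  by (simp_all add: side_edge_point)

lemma side_edge_point_pos:
  assumes "0 < s" "s < 1" "k mod n \<noteq> Suc j mod n"
  shows "0 < side k (edge_point j s)"
proof (cases "k mod n = j mod n")
  case True
  then have "side k = side j" using side_mod by metis
  then show ?thesis using assms side_prev_vertex_pos[of j] by simp
next
  case False
  then have "0 < side k (vertex j)" using assms side_vertex_pos by simp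
  then show ?thesis unfolding side_edge_point using assms side_vertex_nonneg[of k "Suc j"]
    by (simp add: add_pos_nonneg)
qed

lemma side_edge_point_interior_pos:
  assumes "0 \<le> s" "s \<le> 1" "k mod n \<noteq> j mod n" "k mod n \<noteq> Suc j mod n" "k mod n \<noteq> Suc (Suc j) mod n"
  shows "0 < side k (edge_point j s)"
  unfolding side_edge_point
  using side_vertex_pos[of k j] side_vertex_pos[of k "Suc j"] assms
  by (cases "s = 0") (simp_all add: add_nonneg_pos)

text \<open>The edge from \<open>vertex j\<close> to \<open>vertex (Suc j)\<close> lies on the line \<open>side (Suc j) = 0\<close>. The positive factor shows that the
  Hamiltonian direction of that side points along the edge.\<close>

lemma edge_direction: "vertex (Suc j) - vertex j =
    (side j (vertex (Suc j)) / wedge (u j) (u (Suc j))) *\<^sub>R rot (u (Suc j))"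
  (is "?d = ?c *\<^sub>R _")
proof -
  have 1: "u j \<bullet> ?d = ?c * wedge (u j) (u (Suc j))"
    using side_vertex_0(1)[of j] turn_ne[of j] by (simp add: side_def inner_diff_right)
  have 2: "u (Suc j) \<bullet> ?d = 0"
    using side_vertex_0(2)[of j] side_vertex_0(1)[of "Suc j"] by (simp add: side_def inner_diff_right)
  have "?d - ?c *\<^sub>R rot (u (Suc j)) = 0"
  proof (rule inner_eq_0_of_wedge[OF turn_ne[of j]])
    show "u j \<bullet> (?d - ?c *\<^sub>R rot (u (Suc j))) = 0"
      unfolding inner_diff_right[of "u j" ?d] 1 by (simp add: inner_rot)
    show "u (Suc j) \<bullet> (?d - ?c *\<^sub>R rot (u (Suc j))) = 0"
      unfolding inner_diff_right[of "u (Suc j)" ?d] 2 by (simp add: inner_rot)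
  qed
  then show ?thesis by simp
qed

lemma edge_point_0 [simp]: "edge_point j 0 = vertex j"
  and edge_point_1 [simp]: "edge_point j 1 = vertex (Suc j)"
  by (simp_all add: edge_point_def)

lemma edge_point_inj:
  assumes "edge_point j s = edge_point j t" shows "s = t"
proof -
  have "s * side j (vertex (Suc j)) = t * side j (vertex (Suc j))"
    using side_edge_point_simps(2)[of j] assms by metis
  then show ?thesis using side_prev_vertex_pos[of j] by simp
qed

lemma gauge_ge: "- (u j \<bullet> z) \<le> gauge z"
proof -
  have "- (u (j mod n) \<bullet> z) \<le> gauge z" unfolding gauge_def using mod_lt by (intro Max_ge) blast+
  then show ?thesis by simp
qed

lemma gauge_attained: obtains j where "j < n" "gauge z = - (u j \<bullet> z)"
proof -
  have "gauge z \<in> (\<lambda>j. - (u j \<bullet> z)) ` {..<n}"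
    unfolding gauge_def using n_pos by (intro Max_in) auto
  then show ?thesis using that by auto
qed

lemma gauge_le_iff: "gauge z \<le> r \<longleftrightarrow> (\<forall>j<n. - (u j \<bullet> z) \<le> r)"
  by (metis gauge_attained gauge_ge order_trans)

lemma gauge_less_iff: "gauge z < r \<longleftrightarrow> (\<forall>j<n. - (u j \<bullet> z) < r)"
  by (metis gauge_attained gauge_ge order_le_less_trans)

lemma gauge_scaleR:
  assumes "0 \<le> r" shows "gauge (r *\<^sub>R z) = r * gauge z"
proof (rule antisym)
  obtain j where "gauge (r *\<^sub>R z) = - (u j \<bullet> (r *\<^sub>R z))" using gauge_attained by blast
  then show "gauge (r *\<^sub>R z) \<le> r * gauge z"
    using mult_left_mono[OF gauge_ge[of j z] assms] by simp
  obtain k where "gauge z = - (u k \<bullet> z)" using gauge_attained by blast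
  then show "r * gauge z \<le> gauge (r *\<^sub>R z)"
    using gauge_ge[of k "r *\<^sub>R z"] by simp
qed

lemma gauge_lipschitz: "\<exists>L. \<forall>z w. \<bar>gauge z - gauge w\<bar> \<le> L * norm (z - w)"
proof -
  define L where "L = (\<Sum>j<n. norm (u j))"
  have "gauge z - gauge w \<le> L * norm (z - w)" for z w
  proof -
    obtain j where j: "j < n" "gauge z = - (u j \<bullet> z)" using gauge_attained by blast
    have "gauge z - gauge w \<le> u j \<bullet> (w - z)"
      using gauge_ge[of j w] j by (simp add: inner_diff_right)
    also have "\<dots> \<le> norm (u j) * norm (z - w)"
      using norm_cauchy_schwarz[of "u j" "w - z"] by (simp add: norm_minus_commute)
    also have "\<dots> \<le> L * norm (z - w)"
      unfolding L_def using j by (intro mult_right_mono member_le_sum) auto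
    finally show ?thesis .
  qed
  then have "\<bar>gauge z - gauge w\<bar> \<le> L * norm (z - w)" for z w
    by (metis abs_le_iff minus_diff_eq norm_minus_commute)
  then show ?thesis by blast
qed

lemma continuous_gauge: "continuous_on A gauge"
proof -
  obtain L where L: "\<And>z w. \<bar>gauge z - gauge w\<bar> \<le> L * norm (z - w)" using gauge_lipschitz by blast
  have "L * norm (z - w) \<le> (\<bar>L\<bar> + 1) * norm (z - w)" for z w :: "real \<times> real" by (intro mult_right_mono) auto
  from order_trans[OF L this] have "(\<bar>L\<bar> + 1)-lipschitz_on A gauge"
    by (intro lipschitz_onI) (simp_all add: dist_norm)
  then show ?thesis by (rule lipschitz_on_continuous_on)
qed

text \<open>The weighted sum of these nonnegative numbers vanishes by \<open>center\<close>, hence each of them does.\<close>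

lemma inner_zero_all:
  assumes "\<And>j. j < n \<Longrightarrow> 0 \<le> u j \<bullet> z" shows "z = 0"
proof -
  have "(\<Sum>j<n. lam j * (u j \<bullet> z)) = (\<Sum>j<n. lam j *\<^sub>R u j) \<bullet> z"
    by (simp add: inner_sum_left)
  then have "(\<Sum>j<n. lam j * (u j \<bullet> z)) = 0" by (simp add: center)
  then have "\<forall>j\<in>{..<n}. lam j * (u j \<bullet> z) = 0"
    using assms lam_pos by (subst (asm) sum_nonneg_eq_0_iff) (auto simp: less_imp_le)
  then have "u j \<bullet> z = 0" if "j < n" for j
    using lam_pos[of j] that by (metis lessThan_iff less_irrefl mult_eq_0_iff)
  then have "u 0 \<bullet> z = 0" "u (Suc 0) \<bullet> z = 0" using n3 by auto
  then show ?thesis using inner_eq_0_of_wedge[OF turn_ne[of 0]] by simp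
qed

lemma gauge_pos: "z \<noteq> 0 \<Longrightarrow> 0 < gauge z"
proof (rule ccontr)
  assume "z \<noteq> 0" "\<not> 0 < gauge z"
  then have "0 \<le> u j \<bullet> z" for j using gauge_ge[of j z] by linarith
  then show False using inner_zero_all \<open>z \<noteq> 0\<close> by blast
qed

lemma gauge_0 [simp]: "gauge 0 = 0" using gauge_scaleR[of 0 0] by simp

lemma gauge_nonneg: "0 \<le> gauge z" using gauge_pos[of z] by (cases "z = 0") auto

text \<open>The gauge has a positive minimum on the unit circle.\<close>

lemma norm_le_gauge: obtains B where "0 < B" "\<And>z. norm z \<le> B * gauge z"
proof -
  have "compact (sphere (0 :: real \<times> real) 1)" "sphere (0 :: real \<times> real) 1 \<noteq> {}" by simp_all
  from continuous_attains_inf[OF this continuous_gauge]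
  obtain x where x: "norm (x :: real \<times> real) = 1" "\<And>y. norm (y :: real \<times> real) = 1 \<Longrightarrow> gauge x \<le> gauge y"
    by auto
  then have "x \<noteq> 0" by auto
  then have px: "0 < gauge x" by (rule gauge_pos)
  have "norm z \<le> (1 / gauge x) * gauge z" for z
  proof (cases "z = 0")
    case False
    have "gauge x \<le> gauge ((1 / norm z) *\<^sub>R z)" using False by (intro x(2)) simp
    also have "\<dots> = gauge z / norm z" using gauge_scaleR[of "1 / norm z" z] by simp
    finally show ?thesis using False px by (simp add: field_simps)
  qed simp
  then show ?thesis using that[of "1 / gauge x"] px by simp
qed

lemma inside_iff: "z \<in> inside \<longleftrightarrow> gauge z < 1"
  unfolding inside_def gauge_less_iff side_def by auto

lemma side_ge_gauge: "1 - gauge z \<le> side j z"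
  using gauge_ge[of j z] by (simp add: side_def)

lemma side_pos_inside: "z \<in> inside \<Longrightarrow> 0 < side j z"
  using side_ge_gauge[of z j] by (simp add: inside_iff)

lemma open_inside: "open inside"
proof -
  have "inside = gauge -` {..<1}" using inside_iff by auto
  then show ?thesis using continuous_gauge[of UNIV] by (simp add: continuous_on_open_vimage[OF open_UNIV] )
qed

lemma zero_inside: "0 \<in> inside" by (simp add: inside_iff)

text \<open>A boundary point lies on some side, where the two neighbouring sides serve as a coordinate along the edge, and
  their nonnegativity confines it to the unit interval.\<close>

lemma boundary_eq: "boundary = vertex ` {..<n} \<union> (\<Union>j<n. edge_point j ` {0<..<1})"
proof
  show "boundary \<subseteq> vertex ` {..<n} \<union> (\<Union>j<n. edge_point j ` {0<..<1})"
  proof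
    fix z assume "z \<in> boundary"
    then have g: "gauge z = 1" by (simp add: boundary_def)
    then have nn: "0 \<le> side k z" for k using side_ge_gauge[of z k] by simp
    obtain i where i: "i < n" "gauge z = - (u i \<bullet> z)" using gauge_attained .
    then have i: "i < n" "side i z = 0" using g by (simp_all add: side_def)
    \<comment> \<open>The point lies on side \<open>i\<close>, which carries the edge with the preceding index.\<close>
    define j where "j = (i + (n - 1)) mod n"
    have jn: "j < n" unfolding j_def using mod_lt .
    have "Suc j mod n = i mod n" unfolding j_def using n_pos by (simp add: mod_Suc_eq)
    then have i0: "side (Suc j) z = 0" using i(2) side_mod by metis
    define s where "s = side j z / side j (vertex (Suc j))"
    have s: "side j z = s * side j (vertex (Suc j))" "0 \<le> s"
      unfolding s_def using side_prev_vertex_pos[of j] nn[of j] by simp_all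
    have z: "z = edge_point j s" by (rule side_inj[of j]) (simp_all add: s i0)
    have "0 \<le> 1 - s" using nn[of "Suc (Suc j)"] side_next_vertex_pos[of j]
      unfolding z by (simp add: zero_le_mult_iff)
    then consider "s = 0" | "s = 1" | "0 < s" "s < 1" using s(2) by linarith
    then show "z \<in> vertex ` {..<n} \<union> (\<Union>j<n. edge_point j ` {0<..<1})"
    proof cases
      case 1
      then show ?thesis using z jn by simp
    next
      case 2
      then have "z = vertex (Suc j mod n)" using z by simp
      then show ?thesis using mod_lt by blast
    next
      case 3
      then have "z \<in> edge_point j ` {0<..<1}" using z by simp
      then show ?thesis using jn by blast
    qed
  qed
  have *: "z \<in> boundary" if "\<And>k. 0 \<le> side k z" "side i z = 0" for z i
  proof -
    have "gauge z \<le> 1"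
      unfolding gauge_le_iff
    proof (intro allI impI)
      show "- (u j \<bullet> z) \<le> 1" for j using that(1)[of j] by (simp add: side_def)
    qed
    moreover have "1 \<le> gauge z" using gauge_ge[of i z] that(2) by (simp add: side_def)
    ultimately show ?thesis by (simp add: boundary_def)
  qed
  have "vertex j \<in> boundary" for j using *[of "vertex j" j] side_vertex_nonneg by simp
  moreover have "edge_point j s \<in> boundary" if "0 < s" "s < 1" for j s
  proof (rule *[of _ "Suc j"])
    show "0 \<le> side k (edge_point j s)" for k
      unfolding side_edge_point using that side_vertex_nonneg by simp
  qed simp
  ultimately show "vertex ` {..<n} \<union> (\<Union>j<n. edge_point j ` {0<..<1}) \<subseteq> boundary" by auto
qed

text \<open>Radial projection of the circle, with the gauge as scaling factor.\<close>

lemma boundary_image_circle: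
  "\<exists>c. continuous_on (sphere (0 :: complex) 1) c \<and> c ` sphere 0 1 = boundary"
proof -
  define pr :: "complex \<Rightarrow> real \<times> real" where "pr w = (Re w, Im w)" for w
  have pr: "pr w \<noteq> 0" if "w \<noteq> 0" for w using that by (auto simp: pr_def complex_eq_iff zero_prod_def)
  define c where "c w = (1 / gauge (pr w)) *\<^sub>R pr w" for w
  have "continuous_on (sphere 0 1) c"
    unfolding c_def[abs_def]
  proof (intro continuous_intros)
    show "continuous_on (sphere 0 1) pr" unfolding pr_def[abs_def] by (intro continuous_intros)
    from continuous_on_compose2[OF continuous_gauge[of UNIV] this]
    show "continuous_on (sphere 0 1) (\<lambda>w. gauge (pr w))" by simp
    show "\<forall>w\<in>sphere 0 1. gauge (pr w) \<noteq> 0"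
    proof
      fix w :: complex assume "w \<in> sphere 0 1"
      then have "w \<noteq> 0" by auto
      from gauge_pos[OF pr[OF this]] show "gauge (pr w) \<noteq> 0" by simp
    qed
  qed
  moreover have "c ` sphere 0 1 = boundary"
  proof
    show "c ` sphere 0 1 \<subseteq> boundary"
    proof
      fix z assume "z \<in> c ` sphere 0 1"
      then obtain w where w: "norm w = 1" "z = c w" by auto
      then have "w \<noteq> 0" by auto
      from gauge_pos[OF pr[OF this]] have "0 < gauge (pr w)" .
      then show "z \<in> boundary" using w unfolding boundary_def c_def by (simp add: gauge_scaleR)
    qed
    show "boundary \<subseteq> c ` sphere 0 1"
    proof
      fix z assume "z \<in> boundary"
      then have g: "gauge z = 1" by (simp add: boundary_def)
      then have z0: "z \<noteq> 0" by auto
      define w where "w = Complex (fst z / norm z) (snd z / norm z)"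
      have prw: "pr w = (1 / norm z) *\<^sub>R z" by (simp add: pr_def w_def prod_eq_iff)
      have "norm w = norm (pr w)" by (simp add: pr_def cmod_def norm_Pair)
      also have "\<dots> = 1" unfolding prw using z0 by simp
      finally have "w \<in> sphere 0 1" by simp
      moreover have "c w = z" unfolding c_def prw using z0 g by (simp add: gauge_scaleR)
      ultimately show "z \<in> c ` sphere 0 1" by blast
    qed
  qed
  ultimately show ?thesis by blast
qed

end

section \<open>The unperturbed field and its polycycle\<close>

text \<open>The logistic curve turns the simple zeros of the field at the two ends of an edge into a speed that is
  bounded away from zero and infinity.\<close>

definition logistic :: "real \<Rightarrow> real" where "logistic t = 1 / (1 + exp (- t))"

lemma logistic_range: "0 < logistic t" "logistic t < 1"
  by (simp_all add: logistic_def add_pos_pos field_simps)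

lemma logistic_deriv: "(logistic has_real_derivative logistic t * (1 - logistic t)) (at t)"
proof -
  have "1 + exp (- t) \<noteq> 0" using exp_gt_zero[of "- t"] by linarith
  then show ?thesis
    unfolding logistic_def[abs_def]
    by (auto intro!: derivative_eq_intros simp: field_simps power2_eq_square)
qed

lemma logistic_surj:
  assumes "0 < s" "s < 1" obtains t where "logistic t = s"
proof -
  have "logistic (- ln (1 / s - 1)) = s"
    using assms by (simp add: logistic_def field_simps)
  then show ?thesis using that by blast
qed

lemma logistic_limits: "(logistic \<longlongrightarrow> 1) at_top" "(logistic \<longlongrightarrow> 0) at_bot"
proof -
  have "((\<lambda>t::real. 1 + exp (- t)) \<longlongrightarrow> 1 + 0) at_top"
    by (intro tendsto_intros filterlim_compose[OF exp_at_bot] filterlim_uminus_at_bot_at_top)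
  from tendsto_divide[OF tendsto_const this, of 1] show "(logistic \<longlongrightarrow> 1) at_top"
    by (simp add: logistic_def[abs_def])
  have "filterlim (\<lambda>t::real. exp (- t)) at_top at_bot"
    by (intro filterlim_compose[OF exp_at_top] filterlim_uminus_at_top_at_bot)
  then have "filterlim (\<lambda>t::real. 1 + exp (- t)) at_infinity at_bot"
    by (intro filterlim_at_top_imp_at_infinity filterlim_tendsto_add_at_top[OF tendsto_const])
  from tendsto_divide_0[OF tendsto_const this, of 1] show "(logistic \<longlongrightarrow> 0) at_bot"
    by (simp add: logistic_def[abs_def])
qed

lemma tendsto_reparam:
  fixes \<tau> :: "real \<Rightarrow> real"
  assumes mono: "strict_mono \<tau>" and surj: "surj \<tau>" and z: "\<And>s. \<phi> (\<tau> s) = z s"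
  shows "(z \<longlongrightarrow> p) at_top \<Longrightarrow> (\<phi> \<longlongrightarrow> p) at_top"
    and "(z \<longlongrightarrow> p) at_bot \<Longrightarrow> (\<phi> \<longlongrightarrow> p) at_bot"
proof -
  have g: "\<tau> (inv \<tau> t) = t" for t using surj by (simp add: surj_f_inv_f)
  have \<phi>: "\<phi> = (\<lambda>t. z (inv \<tau> t))" using z[of "inv \<tau> _"] g by auto
  have "filterlim (inv \<tau>) at_top at_top"
    unfolding filterlim_at_top
  proof
    fix N
    have "N \<le> inv \<tau> t" if "\<tau> N \<le> t" for t
      using that g[of t] strict_mono_less_eq[OF mono] by metis
    then show "\<forall>\<^sub>F t in at_top. N \<le> inv \<tau> t" by (rule eventually_mono[OF eventually_ge_at_top[of "\<tau> N"]])
  qed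
  then show "(z \<longlongrightarrow> p) at_top \<Longrightarrow> (\<phi> \<longlongrightarrow> p) at_top"
    unfolding \<phi> by (rule filterlim_compose[rotated])
  have "filterlim (inv \<tau>) at_bot at_bot"
    unfolding filterlim_at_bot
  proof
    fix N
    have "inv \<tau> t \<le> N" if "t \<le> \<tau> N" for t
      using that g[of t] strict_mono_less_eq[OF mono] by metis
    then show "\<forall>\<^sub>F t in at_bot. inv \<tau> t \<le> N" by (rule eventually_mono[OF eventually_le_at_bot[of "\<tau> N"]])
  qed
  then show "(z \<longlongrightarrow> p) at_bot \<Longrightarrow> (\<phi> \<longlongrightarrow> p) at_bot"
    unfolding \<phi> by (rule filterlim_compose[rotated])
qed

text \<open>An injective derivative bounds the norm of the linear part below by a multiple of the distance from \<open>p\<close>, and near \<open>p\<close>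
  the error of the linear approximation is smaller.\<close>

lemma isolated_zero_of_derivative:
  fixes X :: "real \<times> real \<Rightarrow> real \<times> real"
  assumes X: "(X has_derivative A) (at p)" "X p = 0" and inj: "\<And>h. A h = 0 \<Longrightarrow> h = 0"
  shows "p isolated_in {p. X p = 0}"
proof -
  have "linear A" using X(1) has_derivative_linear by blast
  moreover have "inj A" using \<open>linear A\<close> inj linear_injective_0 by blast
  ultimately obtain B where B: "0 < B" "\<And>h. B * norm h \<le> norm (A h)"
    using linear_inj_bounded_below_pos by blast
  have "0 < B / 2" using B by simp
  then obtain d where d: "0 < d"
      "\<And>y. norm (y - p) < d \<Longrightarrow> norm (X y - X p - A (y - p)) \<le> B / 2 * norm (y - p)"
    using X(1) unfolding has_derivative_at_alt by blast
  have "ball p d \<inter> {p. X p = 0} = {p}"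
  proof
    show "ball p d \<inter> {p. X p = 0} \<subseteq> {p}"
    proof
      fix y assume "y \<in> ball p d \<inter> {p. X p = 0}"
      then have "norm (y - p) < d" "X y = 0" by (auto simp: dist_norm norm_minus_commute)
      then have "norm (A (y - p)) \<le> B / 2 * norm (y - p)" using d(2)[of y] X(2) by simp
      then have "B * norm (y - p) \<le> B / 2 * norm (y - p)" using B(2)[of "y - p"] by linarith
      then have "norm (y - p) \<le> 0" using B(1) by simp
      then show "y \<in> {p}" by simp
    qed
  qed (use d X in auto)
  then show ?thesis unfolding isolated_in_def using X(2) d(1)
    by (auto intro!: exI[of _ "ball p d"])
qed

text \<open>Since \<open>f p = 0\<close>, the product rule leaves a single term.\<close>

lemma has_derivative_scaleR_at_zero:
  fixes f :: "'a::real_normed_vector \<Rightarrow> real" and g :: "'a \<Rightarrow> 'b::real_normed_vector"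
  assumes "(f has_derivative f') (at p)" "f p = 0" "g differentiable at p"
  shows "((\<lambda>z. f z *\<^sub>R g z) has_derivative (\<lambda>h. f' h *\<^sub>R g p)) (at p)"
proof -
  obtain g' where "(g has_derivative g') (at p)" using assms(3) unfolding differentiable_def by blast
  from has_derivative_scaleR[OF assms(1) this] show ?thesis using assms(2) by simp
qed

lemma differentiable_prod:
  fixes f :: "'i \<Rightarrow> 'a::real_normed_vector \<Rightarrow> real"
  assumes "\<And>i. i \<in> S \<Longrightarrow> f i differentiable at p"
  shows "(\<lambda>z. \<Prod>i\<in>S. f i z) differentiable at p"
  using assms
proof (induction S rule: infinite_finite_induct)
  case (insert x F)
  then show ?case by (simp add: differentiable_mult)
qed simp_all

text \<open>The factor \<open>fst z + c\<close> raises the degree of the Hamiltonian-like field by one, to \<open>n\<close>.\<close>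

locale polygon_field = polygon +
  fixes c :: real
  assumes c_pos: "\<And>z. gauge z \<le> 1 \<Longrightarrow> 0 < fst z + c"
begin

definition others :: "nat \<Rightarrow> real \<times> real \<Rightarrow> real" where
  "others i z = (\<Prod>j\<in>{..<n} - {i}. side j z)"

definition sides :: "real \<times> real \<Rightarrow> real" where
  "sides z = (\<Prod>j<n. side j z)"

text \<open>For \<open>b = 0\<close> this is \<open>(fst z + c) * sides z\<close> times the Hamiltonian field of \<open>\<Sum>j<n. lam j * ln (side j z)\<close>, written
  without denominators. The radial terms with \<open>b (Suc i)\<close> vanish on every line except \<open>side i = 0\<close>, where they are
  transversal to the line away from the corners; the term with \<open>b 0\<close> vanishes on all of them.\<close>

definition field :: "(nat \<Rightarrow> real) \<Rightarrow> vfield" where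
  "field b z = (fst z + c) *\<^sub>R (\<Sum>i<n. (lam i * others i z) *\<^sub>R rot (u i))
     + (\<Sum>i<n. b (Suc i) * others i z) *\<^sub>R z + (b 0 * sides z) *\<^sub>R (1, 0)"

abbreviation base_field :: vfield where "base_field \<equiv> field (\<lambda>_. 0)"

text \<open>Up to the factor \<open>fst z + c\<close> this is the angular momentum of the unperturbed field. The squares show that it is
  nonnegative on the closed polygon.\<close>

definition angular_weight :: "real \<times> real \<Rightarrow> real" where
  "angular_weight z = (\<Sum>i<n. lam i * (side i z - 1)\<^sup>2 * others i z)"

lemma locally_lipschitz_side: "locally_lipschitz (side j)"
  unfolding side_def[abs_def]
  by (intro locally_lipschitz_add locally_lipschitz_const locally_lipschitz_linear bounded_linear_inner_right)

lemma locally_lipschitz_field: "locally_lipschitz (field b)"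
  unfolding field_def[abs_def] others_def sides_def
  by (intro locally_lipschitz_add locally_lipschitz_scaleR locally_lipschitz_sum locally_lipschitz_mult
      locally_lipschitz_prod locally_lipschitz_const locally_lipschitz_side
      locally_lipschitz_linear[of fst] locally_lipschitz_linear[of "\<lambda>z. z"] bounded_linear_fst bounded_linear_ident)

lemma sides_others: "i < n \<Longrightarrow> sides z = side i z * others i z"
  unfolding sides_def others_def by (simp add: prod.remove)

lemma lam_side_sum: "(\<Sum>i<n. lam i * (side i z - 1)) = 0"
proof -
  have "(\<Sum>i<n. lam i * (side i z - 1)) = (\<Sum>i<n. lam i *\<^sub>R u i) \<bullet> z"
    by (simp add: side_def inner_sum_left)
  then show ?thesis by (simp add: center)
qed

text \<open>Because of \<open>center\<close> the linear terms add up to zero, which turns the sum into one with squares.\<close>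

lemma angular_weight_eq: "angular_weight z = - (\<Sum>i<n. lam i * (side i z - 1) * others i z)"
proof -
  have "(\<Sum>i<n. lam i * (side i z - 1) * others i z) + angular_weight z
      = (\<Sum>i<n. lam i * (side i z - 1) * (side i z * others i z))"
    unfolding angular_weight_def sum.distrib[symmetric] by (simp add: power2_eq_square algebra_simps)
  also have "\<dots> = (\<Sum>i<n. lam i * (side i z - 1)) * sides z"
    by (simp add: sides_others[symmetric] sum_distrib_right)
  finally show ?thesis by (simp add: lam_side_sum)
qed

text \<open>A radial field has no angular momentum.\<close>

lemma wedge_field: "wedge z (field b z) = (fst z + c) * angular_weight z - b 0 * sides z * snd z"
proof -
  have "wedge z (field b z) =
      - (fst z + c) * (\<Sum>i<n. lam i * (side i z - 1) * others i z) - b 0 * sides z * snd z"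
  proof -
    have "wedge z (1, 0) = - snd z" by (simp add: wedge_def)
    moreover have "(\<Sum>i<n. lam i * others i z * - (z \<bullet> u i)) = - (\<Sum>i<n. lam i * (side i z - 1) * others i z)"
      unfolding sum_negf[symmetric] by (rule sum.cong) (simp_all add: side_def inner_commute)
    ultimately show ?thesis
      unfolding field_def wedge_add_right wedge_scaleR_right wedge_sum_right wedge_rot wedge_self
      by (simp add: algebra_simps)
  qed
  also have "(\<Sum>i<n. lam i * (side i z - 1) * others i z) = - angular_weight z" by (simp add: angular_weight_eq)
  finally show ?thesis by (simp add: algebra_simps)
qed

lemma others_pos: "z \<in> inside \<Longrightarrow> 0 < others i z"
  unfolding others_def by (intro prod_pos) (simp add: side_pos_inside)

lemma others_nonneg:
  assumes "gauge z \<le> 1" shows "0 \<le> others i z"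
proof -
  have "0 \<le> side j z" for j using side_ge_gauge[of z j] assms by simp
  then show ?thesis unfolding others_def by (simp add: prod_nonneg)
qed

lemma angular_weight_ge:
  assumes "gauge z \<le> 1" "i < n" shows "lam i * (side i z - 1)\<^sup>2 * others i z \<le> angular_weight z"
  unfolding angular_weight_def using assms others_nonneg[OF assms(1)] lam_pos
  by (intro member_le_sum) (auto intro!: mult_nonneg_nonneg simp: less_imp_le)

lemma angular_weight_pos_inside:
  assumes "z \<in> inside" "z \<noteq> 0" shows "0 < angular_weight z"
proof -
  obtain i where i: "i < n" "gauge z = - (u i \<bullet> z)" using gauge_attained .
  then have "side i z - 1 < 0" using gauge_pos[OF assms(2)] by (simp add: side_def)
  then have "0 < lam i * (side i z - 1)\<^sup>2 * others i z" using others_pos[OF assms(1)] lam_pos by simp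
  then show ?thesis using angular_weight_ge[of z i] i assms(1) by (simp add: inside_iff)
qed

lemma others_edge_point: "others (Suc j mod n) (edge_point j s) =
   s * (1 - s) * (side j (vertex (Suc j)) * side (Suc (Suc j)) (vertex j) *
     (\<Prod>k\<in>{..<n} - {j mod n, Suc j mod n, Suc (Suc j) mod n}. side k (edge_point j s)))"
proof -
  have ne: "j mod n \<noteq> Suc j mod n" "Suc (Suc j) mod n \<noteq> Suc j mod n" "Suc (Suc j) mod n \<noteq> j mod n"
    using mod_add_neq[of 1 n j] mod_add_neq[of 2 n j] mod_add_neq[of 1 n "Suc j"] n3 by auto
  have "others (Suc j mod n) z = side (j mod n) z * (side (Suc (Suc j) mod n) z *
      (\<Prod>k\<in>{..<n} - {Suc j mod n} - {j mod n} - {Suc (Suc j) mod n}. side k z))" for z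
    unfolding others_def using ne mod_lt
    by (subst prod.remove[of _ "j mod n"]; simp) (subst prod.remove[of _ "Suc (Suc j) mod n"]; simp)
  moreover have "{..<n} - {Suc j mod n} - {j mod n} - {Suc (Suc j) mod n} =
      {..<n} - {j mod n, Suc j mod n, Suc (Suc j) mod n}" by auto
  ultimately show ?thesis by simp
qed

lemma others_edge_point_pos:
  assumes "0 < s" "s < 1" shows "0 < others (Suc j mod n) (edge_point j s)"
  unfolding others_def using assms by (intro prod_pos) (auto intro!: side_edge_point_pos)

lemma field_on_side:
  assumes "side i z = 0" "i < n"
  shows "base_field z = ((fst z + c) * lam i * others i z) *\<^sub>R rot (u i)"
proof -
  have 0: "others k z = 0" if "k \<in> {..<n} - {i}" for k
    unfolding others_def using that assms by (intro prod_zero) auto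
  have "(\<Sum>k<n. (lam k * others k z) *\<^sub>R rot (u k)) = (lam i * others i z) *\<^sub>R rot (u i)"
    using assms(2) by (subst sum.remove[of _ i]) (simp_all add: 0)
  then show ?thesis by (simp add: field_def mult.assoc zero_prod_def[symmetric])
qed

lemma edge_point_boundary: "0 < s \<Longrightarrow> s < 1 \<Longrightarrow> edge_point j s \<in> boundary"
proof -
  assume s: "0 < s" "s < 1"
  have "edge_point (j mod n) s = edge_point j s"
    unfolding edge_point_def vertex_mod by (metis mod_Suc_eq vertex_mod)
  then have "edge_point j s \<in> edge_point (j mod n) ` {0<..<1}" using s by (metis greaterThanLessThan_iff image_eqI)
  then show ?thesis unfolding boundary_eq using mod_lt[of j] by blast
qed

text \<open>On an edge only one summand of the field survives. Its two neighbouring sides vanish to first order at the two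
  ends, and the remaining factors are positive on the closed edge.\<close>

lemma edge_dynamics:
  obtains k where "continuous_on {0..1} k" "\<And>s. s \<in> {0..1} \<Longrightarrow> 0 < k s"
    "\<And>s. base_field (edge_point j s) = (s * (1 - s) * k s) *\<^sub>R (vertex (Suc j) - vertex j)"
proof -
  define A where "A = {..<n} - {j mod n, Suc j mod n, Suc (Suc j) mod n}"
  define k where "k s = (fst (edge_point j s) + c) * lam (Suc j) * wedge (u j) (u (Suc j)) *
      side (Suc (Suc j)) (vertex j) * (\<Prod>k\<in>A. side k (edge_point j s))" for s
  show ?thesis
  proof
    show "continuous_on {0..1} k"
      unfolding k_def[abs_def] side_def edge_point_def by (intro continuous_intros)
    show "0 < k s" if s: "s \<in> {0..1}" for s
    proof -
      have "edge_point j s \<in> boundary"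
      proof -
        have "edge_point j s \<in> vertex ` {..<n}" if "s = 0 \<or> s = 1"
        proof -
          have "edge_point j s = vertex (j mod n) \<or> edge_point j s = vertex (Suc j mod n)" using that by auto
          then show ?thesis using mod_lt by blast
        qed
        then show ?thesis using edge_point_boundary[of s j] s unfolding boundary_eq by force
      qed
      then have "0 < fst (edge_point j s) + c" by (intro c_pos) (simp add: boundary_def)
      moreover have "0 < (\<Prod>k\<in>A. side k (edge_point j s))"
        unfolding A_def using s by (intro prod_pos) (auto intro!: side_edge_point_interior_pos)
      ultimately show ?thesis
        unfolding k_def using lam_pos turn_pos side_next_vertex_pos by simp
    qed
    show "base_field (edge_point j s) = (s * (1 - s) * k s) *\<^sub>R (vertex (Suc j) - vertex j)" for s
    proof -
      have "side (Suc j mod n) (edge_point j s) = 0" by simp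
      from field_on_side[OF this mod_lt] show ?thesis
        unfolding others_edge_point edge_direction k_def A_def using turn_ne[of j] by simp
    qed
  qed
qed

definition edge :: "nat \<Rightarrow> (real \<times> real) set" where
  "edge j = edge_point j ` {0<..<1}"

text \<open>In the logistic parameter the required time change has density \<open>1 / k\<close>, which is bounded below.\<close>

lemma edge_solution:
  obtains \<phi> where "solves base_field UNIV \<phi>" "range \<phi> = edge j"
    "(\<phi> \<longlongrightarrow> vertex (Suc j)) at_top" "(\<phi> \<longlongrightarrow> vertex j) at_bot"
proof -
  obtain k where k: "continuous_on {0..1} k" "\<And>s. s \<in> {0..1} \<Longrightarrow> 0 < k s"
      "\<And>s. base_field (edge_point j s) = (s * (1 - s) * k s) *\<^sub>R (vertex (Suc j) - vertex j)"
    using edge_dynamics[of j] by blast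
  define z where "z t = edge_point j (logistic t)" for t
  define \<kappa> where "\<kappa> t = 1 / k (logistic t)" for t
  have lr: "logistic t \<in> {0..1}" for t using logistic_range[of t] by simp
  have clog: "continuous_on A logistic" for A
    by (rule DERIV_continuous_on, rule has_field_derivative_at_within, rule logistic_deriv)
  obtain s0 where s0: "s0 \<in> {0..1}" "\<And>s. s \<in> {0..1} \<Longrightarrow> k s \<le> k s0"
    using continuous_attains_sup[OF _ _ k(1)] by auto
  have "continuous_on UNIV (\<lambda>t. k (logistic t))"
    by (rule continuous_on_compose2[OF k(1) clog]) (use lr in auto)
  moreover have kn: "k (logistic t) \<noteq> 0" for t using k(2)[OF lr[of t]] by simp
  ultimately have 1: "continuous_on UNIV \<kappa>" unfolding \<kappa>_def[abs_def] by (intro continuous_intros) auto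
  have 2: "1 / k s0 \<le> \<kappa> t" for t
    unfolding \<kappa>_def using s0(2)[OF lr[of t]] k(2)[OF lr[of t]] by (simp add: frac_le)
  have 3: "0 < 1 / k s0" using k(2)[OF s0(1)] by simp
  have 4: "(z has_vector_derivative \<kappa> t *\<^sub>R base_field (z t)) (at t)" for t
  proof -
    have "(z has_vector_derivative (logistic t * (1 - logistic t)) *\<^sub>R (vertex (Suc j) - vertex j)) (at t)"
      unfolding z_def[abs_def] edge_point_def
      using logistic_deriv[of t] by (auto intro!: derivative_eq_intros)
    then show ?thesis unfolding z_def k(3) \<kappa>_def using kn[of t] by simp
  qed
  obtain \<phi> \<tau> where "solves base_field UNIV \<phi>" "\<tau> 0 = 0" "\<And>s. (\<tau> has_real_derivative \<kappa> s) (at s)"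
      "strict_mono \<tau>" "surj \<tau>" "\<And>s. \<phi> (\<tau> s) = z s"
    by (rule reparametrize_to_solution[OF 1 2 3 4]) (rule that)
  note \<phi> = this(1,4-)
  show ?thesis
  proof
    show "solves base_field UNIV \<phi>" by (rule \<phi>(1))
    have "range \<phi> = range z"
    proof -
      have "range \<phi> = \<phi> ` range \<tau>" using \<phi>(3) by simp
      also have "\<dots> = range z" using \<phi>(4) by (auto simp: image_image)
      finally show ?thesis .
    qed
    also have "\<dots> = edge j"
    proof
      show "range z \<subseteq> edge j" unfolding z_def edge_def using logistic_range by auto
      show "edge j \<subseteq> range z"
      proof
        fix w assume "w \<in> edge j"
        then obtain s where s: "0 < s" "s < 1" "w = edge_point j s" unfolding edge_def by auto
        obtain t where "logistic t = s" using logistic_surj[OF s(1,2)] .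
        then show "w \<in> range z" using s unfolding z_def by auto
      qed
    qed
    finally show "range \<phi> = edge j" .
    have "(z \<longlongrightarrow> edge_point j 1) at_top" "(z \<longlongrightarrow> edge_point j 0) at_bot"
      unfolding z_def[abs_def] edge_point_def
      by (intro tendsto_intros logistic_limits)+
    then show "(\<phi> \<longlongrightarrow> vertex (Suc j)) at_top" "(\<phi> \<longlongrightarrow> vertex j) at_bot"
      using tendsto_reparam[where \<phi> = \<phi> and z = z, OF \<phi>(2,3,4)] by simp_all
  qed
qed

lemma edge_add_n [simp]: "edge (j + n) = edge j"
  unfolding edge_def edge_point_def using vertex_add_n[of j] vertex_add_n[of "Suc j"] by simp

lemma base_field_vertex: "base_field (vertex j) = 0"
  using edge_dynamics[of j] edge_point_0[of j] by (metis mult_zero_left scaleR_zero_left)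

lemma base_field_edge_nonzero:
  assumes "0 < s" "s < 1" shows "base_field (edge_point j s) \<noteq> 0"
proof -
  obtain k where k: "\<And>s. s \<in> {0..1} \<Longrightarrow> 0 < k s"
      "\<And>s. base_field (edge_point j s) = (s * (1 - s) * k s) *\<^sub>R (vertex (Suc j) - vertex j)"
    using edge_dynamics[of j] by metis
  have "vertex (Suc j) \<noteq> vertex j" using edge_point_inj[of j 1 0] by auto
  then show ?thesis using k(1)[of s] assms unfolding k(2) by simp
qed

text \<open>Near a corner each summand contains one of the two sides that vanish there, or both; only the summands with
  a single one contribute.\<close>

lemma vertex_derivative:
  "(base_field has_derivative (\<lambda>h. ((fst (vertex j) + c) *
      (\<Prod>k\<in>{..<n} - {j mod n, Suc j mod n}. side k (vertex j))) *\<^sub>R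
      ((lam j * (u (Suc j) \<bullet> h)) *\<^sub>R rot (u j) + (lam (Suc j) * (u j \<bullet> h)) *\<^sub>R rot (u (Suc j))))) (at (vertex j))"
proof -
  let ?v = "vertex j"
  define i1 i2 where "i1 = j mod n" and "i2 = Suc j mod n"
  have ne: "i1 \<noteq> i2" "i1 < n" "i2 < n"
    unfolding i1_def i2_def using mod_add_neq[of 1 n j] n3 mod_lt by auto
  have si: "side i1 = side j" "side i2 = side (Suc j)" "u i1 = u j" "u i2 = u (Suc j)" "lam i1 = lam j" "lam i2 = lam (Suc j)"
    unfolding i1_def i2_def by simp_all
  define R where "R z = (\<Prod>k\<in>{..<n} - {i1, i2}. side k z)" for z
  define S where "S z = (\<Sum>i\<in>{..<n} - {i1, i2}. (lam i * (\<Prod>k\<in>{..<n} - {i1, i2} - {i}. side k z)) *\<^sub>R rot (u i))" for z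
  have o1: "others i1 z = side (Suc j) z * R z" for z
  proof -
    have "{..<n} - {i1} - {i2} = {..<n} - {i1, i2}" by auto
    then show ?thesis unfolding others_def R_def si(2)[symmetric] using ne
      by (subst prod.remove[of _ i2]) auto
  qed
  have o2: "others i2 z = side j z * R z" for z
  proof -
    have "{..<n} - {i2} - {i1} = {..<n} - {i1, i2}" by auto
    then show ?thesis unfolding others_def R_def si(1)[symmetric] using ne
      by (subst prod.remove[of _ i1]) auto
  qed
  have o3: "others i z = side j z * side (Suc j) z * (\<Prod>k\<in>{..<n} - {i1, i2} - {i}. side k z)"
    if "i \<in> {..<n} - {i1, i2}" for i z
  proof -
    have "{..<n} - {i} - {i1} - {i2} = {..<n} - {i1, i2} - {i}" by auto
    then show ?thesis unfolding others_def si(1,2)[symmetric] using ne that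
      by (subst prod.remove[of _ i1]; simp) (subst prod.remove[of _ i2]; simp)
  qed
  have dec: "base_field z = side (Suc j) z *\<^sub>R (((fst z + c) * lam j * R z) *\<^sub>R rot (u j))
      + side j z *\<^sub>R (((fst z + c) * lam (Suc j) * R z) *\<^sub>R rot (u (Suc j))
           + (side (Suc j) z * (fst z + c)) *\<^sub>R S z)" for z
  proof -
    have "(\<Sum>i<n. (lam i * others i z) *\<^sub>R rot (u i)) =
        (lam i1 * others i1 z) *\<^sub>R rot (u i1) + ((lam i2 * others i2 z) *\<^sub>R rot (u i2) +
        (\<Sum>i\<in>{..<n} - {i1, i2}. (lam i * others i z) *\<^sub>R rot (u i)))"
    proof -
      have "{..<n} - {i1} - {i2} = {..<n} - {i1, i2}" by auto
      then show ?thesis using ne by (subst sum.remove[of _ i1]; simp) (subst sum.remove[of _ i2]; simp)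
    qed
    also have "(\<Sum>i\<in>{..<n} - {i1, i2}. (lam i * others i z) *\<^sub>R rot (u i)) =
        (side j z * side (Suc j) z) *\<^sub>R S z"
      unfolding S_def scaleR_sum_right by (rule sum.cong) (simp_all add: o3)
    finally show ?thesis unfolding field_def o1 o2 si by (simp add: algebra_simps zero_prod_def[symmetric])
  qed
  have ds: "side k differentiable at z" for k z
    unfolding side_def[abs_def] by (intro differentiable_add differentiable_const) (simp add: bounded_linear_imp_differentiable bounded_linear_inner_right)
  have df: "(\<lambda>z::real\<times>real. fst z + c) differentiable at z" for z
    by (intro differentiable_add differentiable_const) (simp add: bounded_linear_imp_differentiable bounded_linear_fst)
  have dR: "R differentiable at z" for z unfolding R_def[abs_def] by (intro differentiable_prod ds)
  have dS: "S differentiable at z" for z unfolding S_def[abs_def]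
    by (intro differentiable_sum ballI differentiable_scaleR differentiable_mult differentiable_prod ds differentiable_const) auto
  have dside: "(side k has_derivative (\<lambda>h. u k \<bullet> h)) (at z)" for k z
    unfolding side_def[abs_def] by (auto intro!: derivative_eq_intros)
  have "((\<lambda>z. side (Suc j) z *\<^sub>R (((fst z + c) * lam j * R z) *\<^sub>R rot (u j))) has_derivative
      (\<lambda>h. (u (Suc j) \<bullet> h) *\<^sub>R (((fst ?v + c) * lam j * R ?v) *\<^sub>R rot (u j)))) (at ?v)"
    by (rule has_derivative_scaleR_at_zero[OF dside])
      (auto intro!: differentiable_scaleR differentiable_mult df dR)
  moreover have "((\<lambda>z. side j z *\<^sub>R (((fst z + c) * lam (Suc j) * R z) *\<^sub>R rot (u (Suc j))
           + (side (Suc j) z * (fst z + c)) *\<^sub>R S z)) has_derivative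
      (\<lambda>h. (u j \<bullet> h) *\<^sub>R (((fst ?v + c) * lam (Suc j) * R ?v) *\<^sub>R rot (u (Suc j))
           + (side (Suc j) ?v * (fst ?v + c)) *\<^sub>R S ?v))) (at ?v)"
    by (rule has_derivative_scaleR_at_zero[OF dside])
      (auto intro!: differentiable_add differentiable_scaleR differentiable_mult df dR ds dS)
  ultimately have "(base_field has_derivative (\<lambda>h. (u (Suc j) \<bullet> h) *\<^sub>R (((fst ?v + c) * lam j * R ?v) *\<^sub>R rot (u j))
      + (u j \<bullet> h) *\<^sub>R (((fst ?v + c) * lam (Suc j) * R ?v) *\<^sub>R rot (u (Suc j))
           + (side (Suc j) ?v * (fst ?v + c)) *\<^sub>R S ?v))) (at ?v)"
    unfolding dec[abs_def] by (rule has_derivative_add)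
  then show ?thesis unfolding R_def i1_def i2_def by (simp add: algebra_simps)
qed

lemma vertex_coefficient_pos:
  "0 < (fst (vertex j) + c) * (\<Prod>k\<in>{..<n} - {j mod n, Suc j mod n}. side k (vertex j))"
proof (rule mult_pos_pos)
  have "vertex (j mod n) \<in> boundary" unfolding boundary_eq using mod_lt by blast
  then show "0 < fst (vertex j) + c" by (intro c_pos) (simp add: boundary_def)
  show "0 < (\<Prod>k\<in>{..<n} - {j mod n, Suc j mod n}. side k (vertex j))"
    by (intro prod_pos) (auto intro!: side_vertex_pos)
qed

lemma rot_u_nonzero: "rot (u j) \<noteq> 0"
  using turn_ne[of j] by (auto simp: rot_def wedge_def prod_eq_iff)

lemma vertex_isolated: "vertex j isolated_in singularities base_field"
  unfolding singularities_def
proof (rule isolated_zero_of_derivative[OF vertex_derivative base_field_vertex])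
  fix h
  let ?k = "(fst (vertex j) + c) * (\<Prod>k\<in>{..<n} - {j mod n, Suc j mod n}. side k (vertex j))"
  assume "?k *\<^sub>R ((lam j * (u (Suc j) \<bullet> h)) *\<^sub>R rot (u j) + (lam (Suc j) * (u j \<bullet> h)) *\<^sub>R rot (u (Suc j))) = 0"
  then have 0: "(lam j * (u (Suc j) \<bullet> h)) *\<^sub>R rot (u j) + (lam (Suc j) * (u j \<bullet> h)) *\<^sub>R rot (u (Suc j)) = 0"
    using vertex_coefficient_pos[of j] by (metis less_irrefl scaleR_eq_0_iff)
  have "u j \<bullet> ((lam j * (u (Suc j) \<bullet> h)) *\<^sub>R rot (u j) + (lam (Suc j) * (u j \<bullet> h)) *\<^sub>R rot (u (Suc j))) = 0"
    "u (Suc j) \<bullet> ((lam j * (u (Suc j) \<bullet> h)) *\<^sub>R rot (u j) + (lam (Suc j) * (u j \<bullet> h)) *\<^sub>R rot (u (Suc j))) = 0"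
    unfolding 0 by simp_all
  then have "u j \<bullet> h = 0" "u (Suc j) \<bullet> h = 0"
    using turn_ne[of j] lam_pos[of j] lam_pos[of "Suc j"] wedge_swap[of "u (Suc j)" "u j"]
    by (simp_all add: inner_add_right inner_rot)
  then show "h = 0" by (rule inner_eq_0_of_wedge[OF turn_ne])
qed

text \<open>The eigenvectors are the directions of the two edges: the orbit arrives along the first and leaves along the second.\<close>

lemma vertex_saddle: "hyperbolic_saddle base_field (vertex j)"
proof -
  let ?k = "(fst (vertex j) + c) * (\<Prod>k\<in>{..<n} - {j mod n, Suc j mod n}. side k (vertex j))"
  let ?w = "wedge (u j) (u (Suc j))"
  have k: "0 < ?k" by (rule vertex_coefficient_pos)
  have w: "0 < ?w" by (rule turn_pos)
  let ?A = "\<lambda>h. ?k *\<^sub>R ((lam j * (u (Suc j) \<bullet> h)) *\<^sub>R rot (u j) + (lam (Suc j) * (u j \<bullet> h)) *\<^sub>R rot (u (Suc j)))"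
  have 1: "?A (rot (u j)) = (- (?k * lam j * ?w)) *\<^sub>R rot (u j)"
    by (simp add: inner_rot wedge_swap[of "u (Suc j)" "u j"])
  have 2: "?A (rot (u (Suc j))) = (?k * lam (Suc j) * ?w) *\<^sub>R rot (u (Suc j))"
    by (simp add: inner_rot)
  have "0 < ?k * lam j * ?w" "0 < ?k * lam (Suc j) * ?w"
    using k w lam_pos[of j] lam_pos[of "Suc j"] by (blast intro: mult_pos_pos)+
  then have 3: "- (?k * lam j * ?w) < 0" "0 < ?k * lam (Suc j) * ?w" by linarith+
  have 4: "vertex j \<in> singularities base_field"
    unfolding singularities_def by (simp add: base_field_vertex)
  show ?thesis
    unfolding hyperbolic_saddle_def
    by (rule conjI[OF 4], rule exI, rule exI, rule exI, rule exI, rule exI)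
      (rule conjI[OF vertex_derivative] conjI[OF 3(1)] conjI[OF 3(2)] conjI[OF rot_u_nonzero] conjI[OF 1] 2)+
qed

text \<open>The edge that ends at \<open>vertex i\<close>; adding \<open>n - 1\<close> is the predecessor modulo \<open>n\<close>.\<close>

definition incoming_edge :: "nat \<Rightarrow> (real \<times> real) set" where
  "incoming_edge i = edge (i + (n - 1))"

lemma base_field_graphic: "graphic base_field n vertex incoming_edge boundary"
  unfolding graphic_def
proof (intro conjI allI impI)
  show "1 \<le> n" using n3 by simp
  obtain cc where cc: "continuous_on (sphere (0 :: complex) 1) cc" "cc ` sphere 0 1 = boundary"
    using boundary_image_circle by blast
  then show "\<exists>c. continuous_on (sphere (0 :: complex) 1) c \<and> c ` sphere 0 1 = boundary" by blast
  show "compact boundary" using compact_continuous_image[OF cc(1)] cc(2) by simp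
  have incoming_next: "incoming_edge (Suc i) = edge i" for i
    unfolding incoming_edge_def using n_pos edge_add_n[of i] by simp
  have edge_mod: "edge (j mod n) = edge j" for j
  proof -
    have "vertex (Suc (j mod n)) = vertex (Suc j)" by (metis mod_Suc_eq vertex_mod)
    then show ?thesis unfolding edge_def edge_point_def by simp
  qed
  have incoming_mod: "incoming_edge (j mod n) = incoming_edge j" for j
    unfolding incoming_edge_def by (metis edge_mod mod_add_left_eq)
  show "boundary = vertex ` {..<n} \<union> (\<Union>i<n. incoming_edge i)"
  proof -
    have "(\<Union>i<n. incoming_edge i) = (\<Union>i<n. edge i)"
    proof
      have "incoming_edge i \<subseteq> (\<Union>i<n. edge i)" for i
        unfolding incoming_edge_def edge_mod[of "i + (n - 1)", symmetric] using mod_lt[of "i + (n - 1)"] by blast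
      then show "(\<Union>i<n. incoming_edge i) \<subseteq> (\<Union>i<n. edge i)" by blast
      have "edge i \<subseteq> (\<Union>i<n. incoming_edge i)" for i
        unfolding incoming_next[symmetric] incoming_mod[of "Suc i", symmetric] using mod_lt[of "Suc i"] by blast
      then show "(\<Union>i<n. edge i) \<subseteq> (\<Union>i<n. incoming_edge i)" by blast
    qed
    then show ?thesis unfolding boundary_eq edge_def by simp
  qed
  then have "vertex 0 \<in> boundary" using n_pos by blast
  then show "boundary \<noteq> {}" by blast
  show "invariant_set base_field boundary"
    unfolding invariant_set_def
  proof
    fix p assume "p \<in> boundary"
    then consider j where "p = vertex j" | j where "j < n" "p \<in> edge j" unfolding boundary_eq edge_def by blast
    then show "orbit base_field p \<subseteq> boundary"
    proof cases
      case 1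
      then show ?thesis
        using orbit_singularity[OF locally_lipschitz_field base_field_vertex] \<open>p \<in> boundary\<close> by simp
    next
      case 2
      obtain \<phi> where \<phi>: "solves base_field UNIV \<phi>" "range \<phi> = edge j" by (rule edge_solution)
      then obtain t where "p = \<phi> t" using 2 by auto
      then have "orbit base_field p = edge j"
        using orbit_eq_range[OF locally_lipschitz_field \<phi>(1)] \<phi>(2) by simp
      then show ?thesis using 2 unfolding boundary_eq edge_def by auto
    qed
  qed
  show "vertex i isolated_in singularities base_field" for i by (rule vertex_isolated)
  show "regular_orbit base_field (incoming_edge i)" for i
  proof -
    obtain \<phi> where \<phi>: "solves base_field UNIV \<phi>" "range \<phi> = incoming_edge i"
      unfolding incoming_edge_def by (rule edge_solution)
    have "\<phi> 0 \<in> incoming_edge i" using \<phi>(2) by auto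
    then have "base_field (\<phi> 0) \<noteq> 0" unfolding incoming_edge_def edge_def using base_field_edge_nonzero by auto
    moreover have "incoming_edge i = orbit base_field (\<phi> 0)"
      using orbit_eq_range[OF locally_lipschitz_field \<phi>(1), of 0] \<phi>(2) by simp
    ultimately show ?thesis unfolding regular_orbit_def by blast
  qed
  show "omega_limit base_field (incoming_edge i) = {vertex i}" for i
  proof -
    obtain \<phi> where \<phi>: "solves base_field UNIV \<phi>" "range \<phi> = incoming_edge i" "(\<phi> \<longlongrightarrow> vertex (Suc (i + (n - 1)))) at_top"
      unfolding incoming_edge_def by (rule edge_solution)
    moreover have "Suc (i + (n - 1)) = i + n" using n_pos by simp
    ultimately show ?thesis using omega_limit_eq[OF locally_lipschitz_field \<phi>(1), of "vertex i"] by simp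
  qed
  show "alpha_limit base_field (incoming_edge (Suc i mod n)) = {vertex i}" for i
  proof -
    obtain \<phi> where \<phi>: "solves base_field UNIV \<phi>" "range \<phi> = edge i" "(\<phi> \<longlongrightarrow> vertex i) at_bot"
      by (rule edge_solution)
    then show ?thesis using alpha_limit_eq[OF locally_lipschitz_field \<phi>(1,3)] incoming_mod incoming_next by simp
  qed
  show "inj_on incoming_edge {..<n}"
  proof (rule inj_onI)
    fix i k assume ik: "i \<in> {..<n}" "k \<in> {..<n}" "incoming_edge i = incoming_edge k"
    have "edge_point (i + (n - 1)) (1/2) \<in> incoming_edge i" unfolding incoming_edge_def edge_def by auto
    then obtain s where s: "0 < s" "s < 1" "edge_point (i + (n - 1)) (1/2) = edge_point (k + (n - 1)) s"
      unfolding ik(3) unfolding incoming_edge_def edge_def by auto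
    have "Suc (i + (n - 1)) = i + n" "Suc (k + (n - 1)) = k + n" using n_pos by simp_all
    then have "side i (edge_point (i + (n - 1)) (1/2)) = 0"
      using side_edge_point_simps(1)[of "i + (n - 1)" "1/2"] u_per[of i] by (simp add: side_def)
    then have "\<not> 0 < side i (edge_point (k + (n - 1)) s)" using s(3) by simp
    then have "i mod n = Suc (k + (n - 1)) mod n" using side_edge_point_pos[OF s(1,2)] by blast
    then show "i = k" using ik \<open>Suc (k + (n - 1)) = k + n\<close> by simp
  qed
qed

end

section \<open>Polar coordinates adapted to the polygon\<close>

definition ray :: "real \<Rightarrow> real \<times> real" where "ray t = (cos t, sin t)"

definition ray_perp :: "real \<Rightarrow> real \<times> real" where "ray_perp t = (- sin t, cos t)"

lemma norm_ray [simp]: "norm (ray t) = 1"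
  by (simp add: ray_def norm_Pair)

lemma ray_nonzero [simp]: "ray t \<noteq> 0"
  using norm_ray[of t] by (metis norm_zero zero_neq_one)

lemma ray_periodic [simp]: "ray (t + 2 * pi) = ray t"
  by (simp add: ray_def)

lemma ray_deriv: "(ray has_vector_derivative ray_perp t) (at t)"
  unfolding ray_def[abs_def] ray_perp_def
  by (auto intro!: derivative_eq_intros has_vector_derivative_Pair
      simp: has_real_derivative_iff_has_vector_derivative[symmetric])

lemma wedge_ray: "wedge (r *\<^sub>R ray t) (a *\<^sub>R ray t + b *\<^sub>R ray_perp t) = r * b"
proof -
  have "wedge (r *\<^sub>R ray t) (a *\<^sub>R ray t + b *\<^sub>R ray_perp t) = r * b * (sin t * sin t + cos t * cos t)"
    by (simp only: wedge_def ray_def ray_perp_def fst_add snd_add fst_scaleR snd_scaleR fst_conv snd_conv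
        real_scaleR_def) (simp only: algebra_simps)
  then show ?thesis using sin_cos_squared_add[of t] by (simp only: power2_eq_square)
qed

lemma polar_form: obtains t where "0 \<le> t" "t < 2 * pi" "z = norm z *\<^sub>R ray t"
proof (cases "z = 0")
  case True
  then show ?thesis using that[of 0] by simp
next
  case False
  then have nz: "norm z \<noteq> 0" by simp
  have nrm: "(norm z)\<^sup>2 = (fst z)\<^sup>2 + (snd z)\<^sup>2" by (cases z) (simp add: norm_Pair)
  then have 1: "(fst z / norm z)\<^sup>2 + (snd z / norm z)\<^sup>2 = 1"
    unfolding power_divide add_divide_distrib[symmetric] nrm[symmetric] using nz by simp
  obtain t where "0 \<le> t" "t < 2 * pi" "fst z / norm z = cos t" "snd z / norm z = sin t"
    by (rule sincos_total_2pi[OF 1])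
  then have "fst z = norm z * cos t" "snd z = norm z * sin t" using nz by (simp_all add: field_simps)
  then have "z = norm z *\<^sub>R ray t" by (intro prod_eqI) (simp_all add: ray_def)
  then show ?thesis using that[of t] \<open>0 \<le> t\<close> \<open>t < 2 * pi\<close> by blast
qed

lemma ray_eq_imp:
  assumes "ray s = ray t" obtains k where "s = t + of_int k * (2 * pi)"
proof -
  have "sin s = sin t \<and> cos s = cos t" using assms by (simp add: ray_def)
  then obtain k where "s = t + 2 * pi * real_of_int k" using sin_cos_eq_iff by metis
  then show ?thesis using that[of k] by (simp add: mult_ac)
qed

text \<open>In complex notation, \<open>\<psi>\<close> is the exponential of a primitive of its logarithmic derivative, and the imaginary part
  of this primitive is a continuous choice of the angle.\<close>

lemma angle_lift:
  fixes \<psi> \<psi>' :: "real \<Rightarrow> real \<times> real"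
  assumes d: "\<And>t. (\<psi> has_vector_derivative \<psi>' t) (at t)" and c: "continuous_on UNIV \<psi>'"
    and nz: "\<And>t. \<psi> t \<noteq> 0"
  obtains \<theta> where "\<And>t. (\<theta> has_real_derivative wedge (\<psi> t) (\<psi>' t) / (norm (\<psi> t))\<^sup>2) (at t)"
    "\<And>t. \<psi> t = norm (\<psi> t) *\<^sub>R ray (\<theta> t)"
proof -
  define C :: "real \<times> real \<Rightarrow> complex" where "C p = Complex (fst p) (snd p)" for p
  have bl: "bounded_linear C"
  proof (rule bounded_linear_intro[where K = 1])
    show "norm (C x) \<le> norm x * 1" for x
      by (cases x) (simp add: C_def cmod_def norm_Pair)
  qed (auto simp: C_def complex_eq_iff)
  have Cn: "norm (C p) = norm p" for p by (cases p) (simp add: C_def cmod_def norm_Pair)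
  define w where "w t = C (\<psi> t)" for t
  define w' where "w' t = C (\<psi>' t)" for t
  have dw: "(w has_vector_derivative w' t) (at t)" for t
    unfolding w_def[abs_def] w'_def by (rule bounded_linear.has_vector_derivative[OF bl d])
  have wn: "w t \<noteq> 0" for t using nz[of t] Cn[of "\<psi> t"] unfolding w_def by auto
  have "continuous_on UNIV w"
    by (meson continuous_at_imp_continuous_on dw has_vector_derivative_continuous)
  moreover have "continuous_on UNIV w'"
    unfolding w'_def by (rule continuous_on_compose2[OF linear_continuous_on[OF bl] c]) auto
  ultimately have "continuous_on UNIV (\<lambda>t. w' t / w t)" using wn by (intro continuous_intros) auto
  then obtain L where L: "L 0 = 0" "\<And>t. (L has_vector_derivative w' t / w t) (at t)"
    using antiderivative_exists by blast
  have "((\<lambda>t. w t * exp (- L t)) has_vector_derivative 0) (at t)" for t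
  proof -
    have "((\<lambda>t. exp (- L t)) has_vector_derivative (- (w' t / w t)) * exp (- L t)) (at t)"
      using field_vector_diff_chain_at[of "\<lambda>t. - L t" "- (w' t / w t)" t exp "exp (- L t)"] L(2)[of t]
      by (simp add: o_def has_vector_derivative_minus DERIV_exp)
    from has_vector_derivative_mult[OF dw[of t] this] show ?thesis using wn[of t] by simp
  qed
  then obtain k where k: "\<And>t. w t * exp (- L t) = k"
    using has_vector_derivative_zero_constant[of UNIV "\<lambda>t. w t * exp (- L t)"] by auto
  have w: "w t = w 0 * exp (L t)" for t
    using k[of t] k[of 0] L(1) by (simp add: exp_minus field_simps)
  define \<theta> where "\<theta> t = Arg (w 0) + Im (L t)" for t
  show ?thesis
  proof
    fix t
    have "((\<lambda>t. Im (L t)) has_vector_derivative Im (w' t / w t)) (at t)"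
      by (rule bounded_linear.has_vector_derivative[OF bounded_linear_Im L(2)])
    then have "((\<lambda>t. Im (L t)) has_real_derivative Im (w' t / w t)) (at t)"
      by (simp add: has_real_derivative_iff_has_vector_derivative)
    moreover have "Im (w' t / w t) = wedge (\<psi> t) (\<psi>' t) / (norm (\<psi> t))\<^sup>2"
      unfolding Im_divide' Cn[symmetric] w_def w'_def by (simp add: C_def wedge_def algebra_simps)
    ultimately show "(\<theta> has_real_derivative wedge (\<psi> t) (\<psi>' t) / (norm (\<psi> t))\<^sup>2) (at t)"
      unfolding \<theta>_def[abs_def] using DERIV_add[OF DERIV_const[of "Arg (w 0)"]] by fastforce
    have "w t = (of_real (norm (w 0)) * cis (Arg (w 0))) * (of_real (exp (Re (L t))) * cis (Im (L t)))"
      unfolding w[of t] exp_eq_polar[of "L t"] using rcis_cmod_Arg[of "w 0"] by (simp add: rcis_def)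
    also have "\<dots> = of_real (norm (w 0) * exp (Re (L t))) * cis (\<theta> t)"
      unfolding \<theta>_def by (simp add: cis_mult[symmetric])
    finally have w1: "w t = of_real (norm (w 0) * exp (Re (L t))) * cis (\<theta> t)" .
    then have "norm (w t) = norm (w 0) * exp (Re (L t))" by (simp add: norm_mult)
    then have "norm (w 0) * exp (Re (L t)) = norm (\<psi> t)" unfolding w_def Cn by simp
    from w1[unfolded this] have "w t = of_real (norm (\<psi> t)) * cis (\<theta> t)" .
    then have "Re (w t) = norm (\<psi> t) * cos (\<theta> t)" "Im (w t) = norm (\<psi> t) * sin (\<theta> t)" by simp_all
    then show "\<psi> t = norm (\<psi> t) *\<^sub>R ray (\<theta> t)"
      unfolding w_def by (simp add: C_def ray_def prod_eq_iff)
  qed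
qed

context polygon
begin

text \<open>The logarithm of the Darboux first integral; it is \<open>0\<close> at the origin and tends to \<open>-\<infinity>\<close> at the boundary.\<close>

definition pot :: "real \<times> real \<Rightarrow> real" where
  "pot z = (\<Sum>j<n. lam j * ln (side j z))"

definition grad :: "real \<times> real \<Rightarrow> real \<times> real" where
  "grad z = (\<Sum>j<n. (lam j / side j z) *\<^sub>R u j)"

text \<open>The rate at which \<open>pot\<close> decreases along rays, see \<open>inner_grad\<close>.\<close>

definition decay :: "real \<times> real \<Rightarrow> real" where
  "decay z = (\<Sum>j<n. lam j * (side j z - 1)\<^sup>2 / side j z)"

definition lam_total :: real where "lam_total = (\<Sum>j<n. lam j)"

lemma lam_total_pos: "0 < lam_total"
  unfolding lam_total_def using lam_pos n_pos by (intro sum_pos) auto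

lemma has_derivative_side: "(side j has_derivative (\<lambda>h. u j \<bullet> h)) (at z)"
  unfolding side_def[abs_def] by (auto intro!: derivative_eq_intros)

lemma continuous_side: "continuous_on A (side j)"
  unfolding side_def[abs_def] by (intro continuous_intros)

lemma pot_derivative:
  assumes "z \<in> inside" shows "(pot has_derivative (\<lambda>h. grad z \<bullet> h)) (at z)"
proof -
  have "(pot has_derivative (\<lambda>h. \<Sum>j<n. lam j * ((u j \<bullet> h) * inverse (side j z)))) (at z)"
    unfolding pot_def[abs_def]
  proof (intro has_derivative_sum has_derivative_mult_right)
    fix j
    show "((\<lambda>x. ln (side j x)) has_derivative (\<lambda>h. (u j \<bullet> h) * inverse (side j z))) (at z)"
      using has_derivative_ln[OF side_pos_inside[OF assms] has_derivative_side[of j z]] .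
  qed
  then show ?thesis by (simp add: grad_def inner_sum_left divide_inverse mult_ac)
qed

text \<open>The terms that are linear in \<open>side j z - 1 = u j \<bullet> z\<close> cancel by \<open>center\<close>.\<close>

lemma inner_grad:
  assumes "z \<in> inside" shows "z \<bullet> grad z = - decay z"
proof -
  have s: "side j z \<noteq> 0" for j using side_pos_inside[OF assms, of j] by simp
  have "(\<Sum>j<n. lam j * (side j z - 1)) = (\<Sum>j<n. lam j *\<^sub>R u j) \<bullet> z"
    by (simp add: side_def inner_sum_left)
  then have 0: "(\<Sum>j<n. lam j * (side j z - 1)) = 0" by (simp add: center)
  have "z \<bullet> grad z + decay z = (\<Sum>j<n. lam j * (side j z - 1))"
    unfolding grad_def decay_def inner_sum_right sum.distrib[symmetric]
  proof (rule sum.cong)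
    fix j
    have "z \<bullet> u j = side j z - 1" by (simp add: side_def inner_commute)
    then have "z \<bullet> (lam j / side j z) *\<^sub>R u j = lam j * (side j z - 1) / side j z" by simp
    then show "z \<bullet> (lam j / side j z) *\<^sub>R u j + lam j * (side j z - 1)\<^sup>2 / side j z = lam j * (side j z - 1)"
      using s[of j] by (simp add: field_simps power2_eq_square)
  qed simp
  then show ?thesis using 0 by simp
qed

lemma decay_pos:
  assumes "z \<in> inside" "z \<noteq> 0" shows "0 < decay z"
proof -
  obtain i where i: "i < n" "gauge z = - (u i \<bullet> z)" by (rule gauge_attained)
  then have "side i z - 1 < 0" using gauge_pos[OF assms(2)] by (simp add: side_def)
  then have "0 < lam i * (side i z - 1)\<^sup>2 / side i z" using side_pos_inside[OF assms(1)] lam_pos by simp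
  also have "\<dots> \<le> decay z"
    unfolding decay_def using i side_pos_inside[OF assms(1)] lam_pos
    by (intro member_le_sum) (auto simp: less_imp_le)
  finally show ?thesis .
qed

lemma pot_0 [simp]: "pot 0 = 0" by (simp add: pot_def side_def)

lemma pot_ge:
  assumes "z \<in> inside" shows "lam_total * ln (1 - gauge z) \<le> pot z"
proof -
  have g: "0 < 1 - gauge z" using assms by (simp add: inside_iff)
  have "(\<Sum>j<n. lam j * ln (1 - gauge z)) \<le> pot z"
    unfolding pot_def
  proof (intro sum_mono mult_left_mono)
    show "ln (1 - gauge z) \<le> ln (side j z)" for j
      by (rule ln_mono[OF side_ge_gauge g])
  qed (simp add: lam_pos less_imp_le)
  then show ?thesis by (simp add: lam_total_def sum_distrib_right)
qed

text \<open>Quantitative form of the statement that the ovals accumulate on the boundary.\<close>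

lemma gauge_of_pot:
  assumes "z \<in> inside" shows "1 - gauge z \<le> exp (pot z / lam_total)"
proof -
  have g: "0 < 1 - gauge z" using assms by (simp add: inside_iff)
  have "ln (1 - gauge z) \<le> pot z / lam_total" using pot_ge[OF assms] lam_total_pos by (simp add: field_simps)
  then show ?thesis using g by (metis exp_le_cancel_iff exp_ln)
qed

lemma side_upper_bound: obtains K where "1 \<le> K" "\<And>z j. gauge z \<le> 1 \<Longrightarrow> side j z \<le> K"
proof -
  obtain B where B: "0 < B" "\<And>z. norm z \<le> B * gauge z" using norm_le_gauge by blast
  define K where "K = 1 + (\<Sum>j<n. norm (u j)) * B"
  show ?thesis
  proof
    show "1 \<le> K" unfolding K_def using B(1) by (simp add: sum_nonneg)
    fix z j assume g: "gauge z \<le> 1"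
    have "norm z \<le> B" using order_trans[OF B(2)[of z] mult_left_mono[OF g, of B]] B(1) by simp
    have "u j \<bullet> z \<le> norm (u j) * norm z" by (rule norm_cauchy_schwarz)
    also have "\<dots> \<le> norm (u j) * B" using \<open>norm z \<le> B\<close> by (intro mult_left_mono) auto
    also have "norm (u j) \<le> (\<Sum>j<n. norm (u j))"
      using member_le_sum[of "j mod n" "{..<n}" "\<lambda>j. norm (u j)"] mod_lt[of j] by simp
    finally show "side j z \<le> K" unfolding side_def K_def using B(1) by (simp add: mult_right_mono)
  qed
qed

text \<open>All other sides are bounded above on the polygon. So \<open>side i\<close> is at least a multiple of \<open>exp (pot z / lam i)\<close>.\<close>

lemma pot_upper_bound:
  obtains C where "\<And>z i. z \<in> inside \<Longrightarrow> i < n \<Longrightarrow> pot z \<le> lam i * ln (side i z) + C"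
proof -
  obtain K where K: "1 \<le> K" "\<And>z j. gauge z \<le> 1 \<Longrightarrow> side j z \<le> K" by (rule side_upper_bound) (rule that)
  show ?thesis
  proof
    fix z i assume z: "z \<in> inside" and i: "i < n"
    have "pot z = lam i * ln (side i z) + (\<Sum>j\<in>{..<n} - {i}. lam j * ln (side j z))"
      unfolding pot_def using i by (subst sum.remove[of _ i]) auto
    also have "(\<Sum>j\<in>{..<n} - {i}. lam j * ln (side j z)) \<le> (\<Sum>j\<in>{..<n} - {i}. lam j * ln K)"
    proof (intro sum_mono mult_left_mono)
      fix j
      have "gauge z \<le> 1" using z by (simp add: inside_iff)
      have "0 < K" using K(1) by simp
      then show "ln (side j z) \<le> ln K" by (intro ln_mono[OF K(2)[OF \<open>gauge z \<le> 1\<close>] side_pos_inside[OF z]])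
    qed (simp add: lam_pos less_imp_le)
    also have "(\<Sum>j\<in>{..<n} - {i}. lam j * ln K) \<le> (\<Sum>j<n. lam j * ln K)"
      using K(1) lam_pos by (intro sum_mono2) (auto simp: less_imp_le)
    finally show "pot z \<le> lam i * ln (side i z) + (\<Sum>j<n. lam j * ln K)" by simp
  qed
qed

lemma ray_gauge_pos: "0 < gauge (ray t)" by (rule gauge_pos) simp

lemma polar_inside_iff: "0 \<le> r \<Longrightarrow> r *\<^sub>R ray t \<in> inside \<longleftrightarrow> r * gauge (ray t) < 1"
  by (simp add: inside_iff gauge_scaleR)

lemma pot_ray_deriv:
  assumes "r *\<^sub>R ray t \<in> inside"
  shows "((\<lambda>r. pot (r *\<^sub>R ray t)) has_real_derivative grad (r *\<^sub>R ray t) \<bullet> ray t) (at r)"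
proof -
  have "((\<lambda>r. r *\<^sub>R ray t) has_derivative (\<lambda>h. h *\<^sub>R ray t)) (at r)"
    by (auto intro!: derivative_eq_intros)
  from has_derivative_compose[OF this pot_derivative[OF assms]]
  show ?thesis unfolding has_field_derivative_def by (simp add: mult_commute_abs)
qed

lemma grad_ray:
  assumes "0 < r" "r *\<^sub>R ray t \<in> inside" shows "grad (r *\<^sub>R ray t) \<bullet> ray t = - decay (r *\<^sub>R ray t) / r"
    "grad (r *\<^sub>R ray t) \<bullet> ray t < 0"
proof -
  show 1: "grad (r *\<^sub>R ray t) \<bullet> ray t = - decay (r *\<^sub>R ray t) / r"
    using inner_grad[OF assms(2)] assms(1) by (simp add: inner_commute field_simps)
  have "0 < decay (r *\<^sub>R ray t)" using decay_pos[OF assms(2)] assms(1) by simp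
  then show "grad (r *\<^sub>R ray t) \<bullet> ray t < 0" unfolding 1 using assms(1) by simp
qed

lemma continuous_pot: "continuous_on inside pot"
  using pot_derivative has_derivative_continuous continuous_at_imp_continuous_on by blast

lemma pot_ray_decreasing:
  assumes "0 \<le> r" "r < s" "s *\<^sub>R ray t \<in> inside"
  shows "pot (s *\<^sub>R ray t) < pot (r *\<^sub>R ray t)"
proof (rule DERIV_neg_imp_decreasing_open[OF assms(2)])
  have s: "s * gauge (ray t) < 1" using assms polar_inside_iff[of s t] by simp
  have ins: "x *\<^sub>R ray t \<in> inside" if "0 \<le> x" "x \<le> s" for x
  proof -
    have "x * gauge (ray t) \<le> s * gauge (ray t)" using that ray_gauge_pos[of t] by (intro mult_right_mono) auto
    then show ?thesis using polar_inside_iff[OF that(1)] s by simp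
  qed
  show "\<exists>y. ((\<lambda>r. pot (r *\<^sub>R ray t)) has_real_derivative y) (at x) \<and> y < 0" if "r < x" "x < s" for x
    using pot_ray_deriv[OF ins[of x]] grad_ray(2)[OF _ ins[of x]] that assms by (intro exI conjI) auto
  show "continuous_on {r..s} (\<lambda>r. pot (r *\<^sub>R ray t))"
    by (rule continuous_on_compose2[OF continuous_pot])
      (use ins assms in \<open>auto intro!: continuous_intros\<close>)
qed

lemma pot_neg: "z \<in> inside \<Longrightarrow> z \<noteq> 0 \<Longrightarrow> pot z < 0"
proof -
  assume z: "z \<in> inside" "z \<noteq> 0"
  obtain t where t: "z = norm z *\<^sub>R ray t" by (rule polar_form)
  have "pot (norm z *\<^sub>R ray t) < pot (0 *\<^sub>R ray t)"
    using z t by (intro pot_ray_decreasing) auto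
  then show ?thesis using t by simp
qed

lemma radius_unique:
  assumes "0 < r" "r *\<^sub>R ray t \<in> inside" "0 < s" "s *\<^sub>R ray t \<in> inside"
    "pot (r *\<^sub>R ray t) = pot (s *\<^sub>R ray t)"
  shows "r = s"
  using pot_ray_decreasing[of r s t] pot_ray_decreasing[of s r t] assms
  by (cases r s rule: linorder_cases) auto

text \<open>Along the ray, the side that attains the gauge becomes small enough to bring \<open>pot\<close> below \<open>x\<close>.\<close>

lemma radius_exists:
  assumes "x < 0" obtains r where "0 < r" "r *\<^sub>R ray t \<in> inside" "pot (r *\<^sub>R ray t) = x"
proof -
  obtain C where C: "\<And>z i. z \<in> inside \<Longrightarrow> i < n \<Longrightarrow> pot z \<le> lam i * ln (side i z) + C"
    by (rule pot_upper_bound) (rule that)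
  obtain i where i: "i < n" "gauge (ray t) = - (u i \<bullet> ray t)" by (rule gauge_attained)
  define g where "g = gauge (ray t)"
  have g: "0 < g" unfolding g_def by (rule ray_gauge_pos)
  \<comment> \<open>On the ray, the side \<open>i\<close> takes the value \<open>a\<close> at the point \<open>s\<close> below, and \<open>pot\<close> is at most \<open>lam i * ln a + C\<close> there.\<close>
  define a where "a = min (1/2) (exp ((x - C) / lam i))"
  have a: "0 < a" "a < 1" "ln a \<le> (x - C) / lam i"
  proof -
    show "0 < a" "a < 1" unfolding a_def by auto
    have "ln a \<le> ln (exp ((x - C) / lam i))" using \<open>0 < a\<close> by (subst ln_le_cancel_iff) (auto simp: a_def)
    then show "ln a \<le> (x - C) / lam i" by simp
  qed
  define s where "s = (1 - a) / g"
  have s: "0 < s" "s * g = 1 - a" unfolding s_def using a g by simp_all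
  have ins: "r *\<^sub>R ray t \<in> inside" if "0 \<le> r" "r \<le> s" for r
  proof -
    have "r * g \<le> s * g" using that g by (intro mult_right_mono) auto
    then show ?thesis using polar_inside_iff[OF that(1)] s a unfolding g_def by simp
  qed
  have sd: "side i (s *\<^sub>R ray t) = a" using i(2) s(2) unfolding g_def side_def by simp
  have "pot (s *\<^sub>R ray t) \<le> lam i * ln a + C" using C[OF ins[of s] i(1)] s sd by simp
  also have "\<dots> \<le> x" using a(3) lam_pos[of i] by (simp add: field_simps)
  finally have 1: "pot (s *\<^sub>R ray t) \<le> x" .
  have "continuous_on {0..s} (\<lambda>r. pot (r *\<^sub>R ray t))"
    by (rule continuous_on_compose2[OF continuous_pot]) (use ins in \<open>auto intro!: continuous_intros\<close>)
  then obtain r where r: "0 \<le> r" "r \<le> s" "pot (r *\<^sub>R ray t) = x"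
    using IVT2'[of "\<lambda>r. pot (r *\<^sub>R ray t)" s x 0] 1 assms s(1) by auto
  have "r \<noteq> 0" using r(3) assms by auto
  then show ?thesis using that[of r] r ins[of r] by simp
qed

definition radius :: "real \<Rightarrow> real \<Rightarrow> real" where
  "radius x t = (THE r. 0 < r \<and> r *\<^sub>R ray t \<in> inside \<and> pot (r *\<^sub>R ray t) = x)"

definition pt :: "real \<Rightarrow> real \<Rightarrow> real \<times> real" where
  "pt x t = radius x t *\<^sub>R ray t"

lemma radius_eqI:
  assumes "0 < r" "r *\<^sub>R ray t \<in> inside" "pot (r *\<^sub>R ray t) = x" shows "radius x t = r"
  unfolding radius_def using assms radius_unique by (intro the_equality) auto

lemma radius:
  assumes "x < 0" shows "0 < radius x t" "pt x t \<in> inside" "pot (pt x t) = x"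
proof -
  obtain r where r: "0 < r" "r *\<^sub>R ray t \<in> inside" "pot (r *\<^sub>R ray t) = x"
    by (rule radius_exists[OF assms])
  from radius_eqI[OF this] show "0 < radius x t" "pt x t \<in> inside" "pot (pt x t) = x"
    using r unfolding pt_def by simp_all
qed

lemma pt_nonzero: "x < 0 \<Longrightarrow> pt x t \<noteq> 0" using radius(1)[of x t] unfolding pt_def by simp

lemma norm_pt: "x < 0 \<Longrightarrow> norm (pt x t) = radius x t"
  using radius(1)[of x t] unfolding pt_def by simp

lemma radius_periodic [simp]: "radius x (t + 2 * pi) = radius x t"
  unfolding radius_def by simp

lemma pt_periodic [simp]: "pt x (t + 2 * pi) = pt x t"
  unfolding pt_def by simp

lemma pt_of_polar:
  assumes "z \<in> inside" "z \<noteq> 0" "z = norm z *\<^sub>R ray t" shows "pt (pot z) t = z"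
  using radius_eqI[of "norm z" t "pot z"] assms unfolding pt_def by simp

text \<open>The map \<open>(r, t) \<mapsto> (pot (r *\<^sub>R ray t), t)\<close> is injective with invertible derivative, so the inverse function theorem
  applies to it.\<close>

lemma radius_derivative:
  assumes x: "x < 0"
  shows "((\<lambda>p. radius (fst p) (snd p)) has_derivative
     (\<lambda>h. (fst h - snd h * radius x t * (grad (pt x t) \<bullet> ray_perp t)) / (grad (pt x t) \<bullet> ray t))) (at (x, t))"
proof -
  define r where "r = radius x t"
  have r: "0 < r" "r *\<^sub>R ray t \<in> inside" "pot (r *\<^sub>R ray t) = x"
    using radius[OF x] unfolding r_def pt_def by blast+
  let ?f = "\<lambda>p. (pot (fst p *\<^sub>R ray (snd p)), snd p)"
  let ?g = "\<lambda>p. (radius (fst p) (snd p), snd p)"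
  let ?a = "grad (r *\<^sub>R ray t) \<bullet> ray t" and ?b = "grad (r *\<^sub>R ray t) \<bullet> ray_perp t"
  let ?f' = "\<lambda>h. (fst h * ?a + snd h * r * ?b, snd h)"
  let ?g' = "\<lambda>h. ((fst h - snd h * r * ?b) / ?a, snd h)"
  let ?S = "{p. 0 < fst p \<and> fst p *\<^sub>R ray (snd p) \<in> inside}"
  have a: "?a \<noteq> 0" using grad_ray(2)[OF r(1,2)] by simp
  have cray: "continuous_on A ray" for A unfolding ray_def[abs_def] by (intro continuous_intros)
  have cm: "continuous_on A (\<lambda>p. fst p *\<^sub>R ray (snd p))" for A
    by (intro continuous_intros continuous_on_compose2[OF cray[of UNIV]]) auto
  have oS: "open ?S"
  proof -
    have "open {p::real\<times>real. 0 < fst p}" by (intro open_Collect_less continuous_intros)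
    moreover have "open ((\<lambda>p. fst p *\<^sub>R ray (snd p)) -` inside)"
      using continuous_on_open_vimage[OF open_UNIV] cm[of UNIV] open_inside by auto
    ultimately have "open ({p. 0 < fst p} \<inter> (\<lambda>p. fst p *\<^sub>R ray (snd p)) -` inside)" by blast
    moreover have "?S = {p. 0 < fst p} \<inter> (\<lambda>p. fst p *\<^sub>R ray (snd p)) -` inside" by auto
    ultimately show ?thesis by simp
  qed
  have "(?g has_derivative ?g') (at (?f (r, t)))"
  proof (rule has_derivative_inverse_strong[where f = ?f and x = "(r, t)", OF oS])
    show "(r, t) \<in> ?S" using r by simp
    have "continuous_on ?S (\<lambda>p. pot (fst p *\<^sub>R ray (snd p)))"
      by (rule continuous_on_compose2[OF continuous_pot cm]) auto
    then show "continuous_on ?S ?f" by (intro continuous_intros)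
    show "?g (?f p) = p" if "p \<in> ?S" for p
      using radius_eqI[of "fst p" "snd p"] that by (simp add: prod_eq_iff)
    have "((\<lambda>p. ray (snd p)) has_derivative (\<lambda>h. snd h *\<^sub>R ray_perp t)) (at (r, t))"
      using has_derivative_compose[OF has_derivative_snd[OF has_derivative_ident], of ray _ "(r, t)"]
        ray_deriv[of t] unfolding has_vector_derivative_def by simp
    then have "((\<lambda>p. fst p *\<^sub>R ray (snd p)) has_derivative (\<lambda>h. r *\<^sub>R (snd h *\<^sub>R ray_perp t) + fst h *\<^sub>R ray t)) (at (r, t))"
      using has_derivative_scaleR[OF has_derivative_fst[OF has_derivative_ident]] by fastforce
    moreover have "(pot has_derivative (\<lambda>h. grad (r *\<^sub>R ray t) \<bullet> h)) (at (fst (r, t) *\<^sub>R ray (snd (r, t))))"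
      using pot_derivative[OF r(2)] by simp
    ultimately have "((\<lambda>p. pot (fst p *\<^sub>R ray (snd p))) has_derivative
        (\<lambda>h. grad (r *\<^sub>R ray t) \<bullet> (r *\<^sub>R (snd h *\<^sub>R ray_perp t) + fst h *\<^sub>R ray t))) (at (r, t))"
      by (rule has_derivative_compose)
    then have "(?f has_derivative (\<lambda>h. (grad (r *\<^sub>R ray t) \<bullet> (r *\<^sub>R (snd h *\<^sub>R ray_perp t) + fst h *\<^sub>R ray t), snd h))) (at (r, t))"
      by (intro has_derivative_Pair has_derivative_snd has_derivative_ident)
    then show "(?f has_derivative ?f') (at (r, t))"
      by (simp add: inner_add_right algebra_simps)
    show "?f' \<circ> ?g' = id" using a by (simp add: fun_eq_iff)
  qed
  then have "((\<lambda>p. fst (?g p)) has_derivative (\<lambda>h. fst (?g' h))) (at (?f (r, t)))"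
    by (rule has_derivative_fst)
  then show ?thesis using r by (simp add: r_def[symmetric] pt_def)
qed

lemma continuous_radius: "continuous_on ({..<0} \<times> UNIV) (\<lambda>p. radius (fst p) (snd p))"
proof (rule continuous_at_imp_continuous_on, rule ballI)
  fix p :: "real \<times> real" assume "p \<in> {..<0} \<times> UNIV"
  then have "fst p < 0" by auto
  from has_derivative_continuous[OF radius_derivative[OF this, of "snd p"]]
  show "isCont (\<lambda>p. radius (fst p) (snd p)) p" by simp
qed

lemma radius_deriv_x:
  assumes "x < 0"
  shows "((\<lambda>x. radius x t) has_real_derivative - radius x t / decay (pt x t)) (at x)"
proof -
  have "((\<lambda>x. (x, t)) has_derivative (\<lambda>h. (h, 0))) (at x)"
    by (auto intro!: derivative_eq_intros)
  from has_derivative_compose[OF this radius_derivative[OF assms]]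
  have "((\<lambda>x. radius x t) has_derivative (\<lambda>h. h / (grad (pt x t) \<bullet> ray t))) (at x)" by simp
  moreover have "(\<lambda>h. h / (grad (pt x t) \<bullet> ray t)) = (*) (- radius x t / decay (pt x t))"
  proof
    fix h
    have "pt x t = radius x t *\<^sub>R ray t" by (simp add: pt_def)
    then show "h / (grad (pt x t) \<bullet> ray t) = - radius x t / decay (pt x t) * h"
      using grad_ray(1)[of "radius x t" t] radius[OF assms, of t] by simp
  qed
  ultimately show ?thesis unfolding has_field_derivative_def by (simp only:)
qed

text \<open>A velocity vector is determined by its effect on \<open>pot\<close> and on the angle, because these two functionals are
  independent as long as \<open>decay\<close> is positive. So it suffices to compare \<open>\<kappa> *\<^sub>R V\<close> with the curve in these two components.\<close>

lemma pt_curve_deriv: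
  assumes x: "\<And>t. x t < 0" "(x has_real_derivative \<xi>) (at t)"
    and V: "\<kappa> * (grad (pt (x t) t) \<bullet> V) = \<xi>" "\<kappa> * wedge (pt (x t) t) V = (radius (x t) t)\<^sup>2"
  shows "((\<lambda>t. pt (x t) t) has_vector_derivative \<kappa> *\<^sub>R V) (at t)"
proof -
  define r where "r = radius (x t) t"
  define z where "z = pt (x t) t"
  have r: "0 < r" "z \<in> inside" "z = r *\<^sub>R ray t"
    unfolding r_def z_def using radius[OF x(1)] by (auto simp: pt_def)
  have a: "grad z \<bullet> ray t \<noteq> 0" using grad_ray(2)[of r t] r by auto
  define r' where "r' = (\<xi> - r * (grad z \<bullet> ray_perp t)) / (grad z \<bullet> ray t)"
  have "((\<lambda>t. (x t, t)) has_derivative (\<lambda>h. (\<xi> * h, h))) (at t)"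
    using x(2) unfolding has_field_derivative_def by (intro has_derivative_Pair has_derivative_ident)
  from has_derivative_compose[OF this radius_derivative[OF x(1)]]
  have "((\<lambda>t. radius (x t) t) has_derivative (\<lambda>h. r' * h)) (at t)"
    unfolding r'_def r_def z_def by (simp add: algebra_simps diff_divide_distrib)
  then have "((\<lambda>t. radius (x t) t) has_vector_derivative r') (at t)"
    by (simp add: has_vector_derivative_def mult.commute)
  from has_vector_derivative_scaleR[OF this[folded has_real_derivative_iff_has_vector_derivative] ray_deriv[of t]]
  have d: "((\<lambda>t. pt (x t) t) has_vector_derivative r *\<^sub>R ray_perp t + r' *\<^sub>R ray t) (at t)"
    unfolding pt_def r_def .
  have "wedge (grad z) (rot z) \<noteq> 0"
    using inner_grad[OF r(2)] decay_pos[OF r(2)] r(1,3) by (simp add: wedge_rot inner_commute)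
  moreover have "grad z \<bullet> (r *\<^sub>R ray_perp t + r' *\<^sub>R ray t - \<kappa> *\<^sub>R V) = 0"
    using V(1) a unfolding r'_def z_def[symmetric] by (simp add: inner_add_right inner_diff_right)
  moreover have "rot z \<bullet> (r *\<^sub>R ray_perp t + r' *\<^sub>R ray t - \<kappa> *\<^sub>R V) = 0"
  proof -
    have rw: "rot z \<bullet> w = - wedge z w" for w by (simp add: rot_def wedge_def inner_prod_def)
    have "wedge z (r' *\<^sub>R ray t + r *\<^sub>R ray_perp t) = r * r" unfolding r(3) by (rule wedge_ray)
    then have "wedge z (r *\<^sub>R ray_perp t + r' *\<^sub>R ray t) = r * r" by (simp add: add.commute)
    moreover have "wedge z (- (\<kappa> *\<^sub>R V)) = - (\<kappa> * wedge z V)" by (simp add: wedge_def algebra_simps)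
    ultimately show ?thesis
      using V(2) unfolding rw r_def[symmetric] z_def[symmetric] diff_conv_add_uminus wedge_add_right
      by (simp add: power2_eq_square)
  qed
  ultimately have "r *\<^sub>R ray_perp t + r' *\<^sub>R ray t - \<kappa> *\<^sub>R V = 0" by (rule inner_eq_0_of_wedge)
  then show ?thesis using d by simp
qed

text \<open>Both distances are estimated along rays.\<close>

lemma hausdorff_boundary_le:
  assumes B: "\<And>z. norm z \<le> B * gauge z" "0 \<le> \<eta>"
    and S: "S \<noteq> {}" "\<And>z. z \<in> S \<Longrightarrow> 1 - \<eta> \<le> gauge z \<and> gauge z < 1 \<and> z \<noteq> 0"
    and dirs: "\<And>w. w \<noteq> 0 \<Longrightarrow> \<exists>r>0. r *\<^sub>R w \<in> S"
  shows "hausdorff_dist S boundary \<le> B * \<eta>" "0 \<le> hausdorff_dist S boundary"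
proof -
  have "0 \<le> B * gauge (ray 0)" using B(1)[of "ray 0"] norm_ge_zero[of "ray 0"] by linarith
  then have B0: "0 \<le> B" using ray_gauge_pos[of 0] by (simp add: zero_le_mult_iff)
  have 1: "infdist z boundary \<le> B * \<eta>" if "z \<in> S" for z
  proof -
    have g: "0 < gauge z" "1 - \<eta> \<le> gauge z" "gauge z < 1" using S(2)[OF that] gauge_pos by auto
    have "(1 / gauge z) *\<^sub>R z \<in> boundary" unfolding boundary_def using g by (simp add: gauge_scaleR)
    then have "infdist z boundary \<le> dist z ((1 / gauge z) *\<^sub>R z)" by (rule infdist_le)
    also have "\<dots> = norm (((1 / gauge z) - 1) *\<^sub>R z)"
      by (simp add: dist_norm algebra_simps norm_minus_commute)
    also have "\<dots> = (1 / gauge z - 1) * norm z" using g by simp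
    also have "\<dots> \<le> (1 / gauge z - 1) * (B * gauge z)" using g B(1) by (intro mult_left_mono) simp_all
    also have "\<dots> = B * (1 - gauge z)" using g by (simp add: field_simps)
    also have "\<dots> \<le> B * \<eta>" using g B0 by (intro mult_left_mono) simp_all
    finally show ?thesis .
  qed
  have 2: "infdist w S \<le> B * \<eta>" if "w \<in> boundary" for w
  proof -
    have gw: "gauge w = 1" using that by (simp add: boundary_def)
    then have "w \<noteq> 0" by auto
    then obtain r where r: "0 < r" "r *\<^sub>R w \<in> S" using dirs by blast
    then have r1: "1 - \<eta> \<le> r" "r < 1" using S(2)[OF r(2)] gw by (simp_all add: gauge_scaleR)
    have "infdist w S \<le> dist w (r *\<^sub>R w)" using r(2) by (rule infdist_le)
    also have "\<dots> = norm ((1 - r) *\<^sub>R w)" by (simp add: dist_norm algebra_simps)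
    also have "\<dots> = (1 - r) * norm w" using r1 by simp
    also have "\<dots> \<le> \<eta> * B" using r1 B(1)[of w] gw B0 by (intro mult_mono) simp_all
    finally show ?thesis by (simp add: mult.commute)
  qed
  have "boundary \<noteq> {}"
    using gauge_scaleR[of "1 / gauge (ray 0)" "ray 0"] ray_gauge_pos[of 0] unfolding boundary_def
    by (intro ex_in_conv[THEN iffD1] exI[of _ "(1 / gauge (ray 0)) *\<^sub>R ray 0"]) simp
  then show "hausdorff_dist S boundary \<le> B * \<eta>"
    unfolding hausdorff_dist_def using 1 2 S(1) by (intro max.boundedI cSUP_least) auto
  obtain z where z: "z \<in> S" using S(1) by blast
  have "bdd_above ((\<lambda>a. infdist a boundary) ` S)" using 1 by (intro bdd_aboveI2)
  then have "infdist z boundary \<le> (SUP a\<in>S. infdist a boundary)" using z by (rule cSUP_upper2) simp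
  then show "0 \<le> hausdorff_dist S boundary"
    unfolding hausdorff_dist_def using infdist_nonneg[of z boundary] by (simp add: le_max_iff_disj)
qed

end

section \<open>Closed solutions and the first return map\<close>

lemma locally_lipschitz_continuous:
  assumes "locally_lipschitz f" shows "continuous_on A f"
proof -
  have "isCont f x" for x
  proof -
    obtain L where L: "0 \<le> L" "\<And>p q. norm p \<le> norm x + 1 \<Longrightarrow> norm q \<le> norm x + 1 \<Longrightarrow> norm (f p - f q) \<le> L * norm (p - q)"
      using locally_lipschitzE[OF assms, of "norm x + 1"] by metis
    have "L-lipschitz_on (ball x 1) f"
    proof (rule lipschitz_onI[OF _ L(1)])
      fix p q assume pq: "p \<in> ball x 1" "q \<in> ball x 1"
      have "norm y \<le> norm x + 1" if "y \<in> ball x 1" for y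
        using that norm_triangle_ineq2[of y x] by (simp add: dist_norm norm_minus_commute)
      then show "dist (f p) (f q) \<le> L * dist p q" using L(2) pq by (simp add: dist_norm)
    qed
    then have "continuous_on (ball x 1) f" by (rule lipschitz_on_continuous_on)
    then show ?thesis by (simp add: continuous_on_eq_continuous_at)
  qed
  then show ?thesis by (simp add: continuous_at_imp_continuous_on)
qed

context polygon
begin

lemma inner_grad_rot: "a \<bullet> rot a = 0" by (simp add: inner_rot)

lemma curve_dirs:
  assumes "\<And>t. x t < 0" "w \<noteq> 0"
  shows "\<exists>r>0. r *\<^sub>R w \<in> range (\<lambda>t. pt (x t) t)"
proof -
  obtain t where t: "w = norm w *\<^sub>R ray t" by (rule polar_form)
  have "(radius (x t) t / norm w) *\<^sub>R w = (radius (x t) t / norm w) *\<^sub>R (norm w *\<^sub>R ray t)" using t by simp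
  also have "\<dots> = pt (x t) t" unfolding pt_def using assms(2) by simp
  finally have "(radius (x t) t / norm w) *\<^sub>R w = pt (x t) t" .
  moreover have "0 < radius (x t) t / norm w" using radius(1)[OF assms(1)] assms(2) by simp
  ultimately show ?thesis by (intro exI[of _ "radius (x t) t / norm w"]) (simp add: rangeI)
qed

lemma hausdorff_curve:
  assumes B: "\<And>z. norm z \<le> B * gauge z" and x: "\<And>t. x t \<le> m" and m: "m < 0"
  shows "hausdorff_dist (range (\<lambda>t. pt (x t) t)) boundary \<le> B * exp (m / lam_total)"
    "0 \<le> hausdorff_dist (range (\<lambda>t. pt (x t) t)) boundary"
proof -
  have neg: "x t < 0" for t using x[of t] m by linarith
  have g: "1 - exp (m / lam_total) \<le> gauge z \<and> gauge z < 1 \<and> z \<noteq> 0"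
    if z: "z \<in> range (\<lambda>t. pt (x t) t)" for z
  proof -
    obtain t where z: "z = pt (x t) t" using z by (elim rangeE)
    have ins: "z \<in> inside" "pot z = x t" "z \<noteq> 0" using radius[OF neg] pt_nonzero[OF neg] z by auto
    have "1 - gauge z \<le> exp (x t / lam_total)" using gauge_of_pot[OF ins(1)] ins(2) by simp
    also have "\<dots> \<le> exp (m / lam_total)" using x[of t] lam_total_pos by (simp add: divide_right_mono)
    finally show ?thesis using ins by (simp add: inside_iff)
  qed
  show "hausdorff_dist (range (\<lambda>t. pt (x t) t)) boundary \<le> B * exp (m / lam_total)"
    by (rule hausdorff_boundary_le(1)[OF B _ _ g curve_dirs[OF neg]]) auto
  show "0 \<le> hausdorff_dist (range (\<lambda>t. pt (x t) t)) boundary"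
    by (rule hausdorff_boundary_le(2)[OF B _ _ g curve_dirs[OF neg]]) auto
qed

end

context polygon_field
begin

lemma sides_pos: "z \<in> inside \<Longrightarrow> 0 < sides z"
  unfolding sides_def by (intro prod_pos) (simp add: side_pos_inside)

lemma others_inside:
  assumes "z \<in> inside" "i < n" shows "others i z = sides z / side i z"
  using sides_others[OF assms(2), of z] side_pos_inside[OF assms(1), of i] by simp

lemma field_inside:
  assumes "z \<in> inside"
  shows "field b z = sides z *\<^sub>R ((fst z + c) *\<^sub>R rot (grad z) + (\<Sum>i<n. b (Suc i) / side i z) *\<^sub>R z + b 0 *\<^sub>R (1, 0))"
proof -
  have rs: "rot (\<Sum>i\<in>A. f i) = (\<Sum>i\<in>A. rot (f i))" for f :: "nat \<Rightarrow> real \<times> real" and A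
    by (simp add: rot_def prod_eq_iff fst_sum snd_sum sum_negf)
  have rr: "rot (r *\<^sub>R v) = r *\<^sub>R rot v" for r v by (simp add: rot_def)
  have 1: "(\<Sum>i<n. (lam i * others i z) *\<^sub>R rot (u i)) = sides z *\<^sub>R rot (grad z)"
    unfolding grad_def rs rr scaleR_sum_right
    by (rule sum.cong) (simp_all add: others_inside[OF assms])
  have 2: "(\<Sum>i<n. b (Suc i) * others i z) = sides z * (\<Sum>i<n. b (Suc i) / side i z)"
    unfolding sum_distrib_left by (rule sum.cong) (simp_all add: others_inside[OF assms])
  show ?thesis unfolding field_def 1 2 by (simp add: algebra_simps)
qed

lemma grad_field:
  assumes "z \<in> inside"
  shows "grad z \<bullet> field b z = sides z * (- (\<Sum>i<n. b (Suc i) / side i z) * decay z + b 0 * fst (grad z))"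
proof -
  have "(r, 0) \<bullet> grad z = r * fst (grad z)" for r by (simp add: inner_prod_def)
  then show ?thesis
    unfolding field_inside[OF assms]
    using inner_grad[OF assms] by (simp add: inner_add_right inner_grad_rot inner_commute)
qed

lemma wedge_field_inside:
  assumes "z \<in> inside"
  shows "wedge z (field b z) = sides z * ((fst z + c) * decay z - b 0 * snd z)"
proof -
  have "angular_weight z = sides z * decay z"
    unfolding angular_weight_def decay_def sum_distrib_left
    by (rule sum.cong) (simp_all add: others_inside[OF assms])
  then show ?thesis unfolding wedge_field by (simp add: algebra_simps)
qed

lemma continuous_field: "continuous_on A (field b)"
  by (rule locally_lipschitz_continuous[OF locally_lipschitz_field])

lemma wedge_base_pos:
  assumes "z \<in> inside" "z \<noteq> 0" shows "0 < wedge z (base_field z)"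
proof -
  have "0 < fst z + c" using c_pos assms(1) by (simp add: inside_iff)
  then show ?thesis unfolding wedge_field using angular_weight_pos_inside[OF assms] by simp
qed

text \<open>The condition \<open>\<xi>\<close> is the scalar equation of the field in the coordinates \<open>pot\<close> and angle; the factor
  \<open>radius\<^sup>2 / wedge\<close> is the inverse of the angular speed.\<close>

lemma closed_curve_solution:
  assumes x: "\<And>t. x t < 0" and dx: "\<And>t. (x has_real_derivative \<xi> t) (at t)" and per: "\<And>t. x (t + 2 * pi) = x t"
    and pos: "\<And>t. 0 < wedge (pt (x t) t) (field b (pt (x t) t))"
    and \<xi>: "\<And>t. (radius (x t) t)\<^sup>2 / wedge (pt (x t) t) (field b (pt (x t) t)) *
        (grad (pt (x t) t) \<bullet> field b (pt (x t) t)) = \<xi> t"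
  obtains \<phi> \<tau> T where "solves (field b) UNIV \<phi>" "strict_mono \<tau>" "surj \<tau>"
    "\<And>s. \<phi> (\<tau> s) = pt (x s) s" "0 < T" "\<And>t. \<phi> (t + T) = \<phi> t" "\<And>s. \<tau> (s + 2 * pi) = \<tau> s + T"
proof -
  define z where "z s = pt (x s) s" for s
  define \<kappa> where "\<kappa> s = (radius (x s) s)\<^sup>2 / wedge (z s) (field b (z s))" for s
  have dz: "(z has_vector_derivative \<kappa> s *\<^sub>R field b (z s)) (at s)" for s
    unfolding z_def[abs_def]
  proof (rule pt_curve_deriv[where x = x and V = "field b (pt (x s) s)", OF x dx])
    show "\<kappa> s * (grad (pt (x s) s) \<bullet> field b (pt (x s) s)) = \<xi> s" using \<xi>[of s] unfolding \<kappa>_def z_def .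
    show "\<kappa> s * wedge (pt (x s) s) (field b (pt (x s) s)) = (radius (x s) s)\<^sup>2"
      using pos[of s] unfolding \<kappa>_def z_def by simp
  qed
  have cz: "continuous_on UNIV z"
    by (meson continuous_at_imp_continuous_on dz has_vector_derivative_continuous)
  have cf: "continuous_on UNIV (\<lambda>s. field b (z s))"
    by (rule continuous_on_compose2[OF continuous_field cz]) auto
  have \<kappa>2: "\<kappa> s = (norm (z s))\<^sup>2 / wedge (z s) (field b (z s))" for s
    unfolding \<kappa>_def z_def using norm_pt[OF x] by simp
  have pos': "wedge (z s) (field b (z s)) \<noteq> 0" for s using pos[of s] unfolding z_def by simp
  have c\<kappa>: "continuous_on UNIV \<kappa>"
    unfolding \<kappa>2[abs_def] using pos' unfolding wedge_def by (intro continuous_intros cz cf) auto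
  have \<kappa>pos: "0 < \<kappa> s" for s
    unfolding \<kappa>_def z_def using pos[of s] radius(1)[OF x, of s s] by simp
  have \<kappa>per: "\<kappa> (s + 2 * pi) = \<kappa> s" for s unfolding \<kappa>_def z_def by (simp add: per)
  obtain s0 where s0: "\<And>s. s \<in> {0..2 * pi} \<Longrightarrow> \<kappa> s0 \<le> \<kappa> s"
  proof -
    have "\<exists>s0\<in>{0..2 * pi}. \<forall>s\<in>{0..2 * pi}. \<kappa> s0 \<le> \<kappa> s"
      by (rule continuous_attains_inf) (auto intro: continuous_on_subset[OF c\<kappa>])
    then show ?thesis using that by blast
  qed
  have low: "\<kappa> s0 \<le> \<kappa> s" for s
  proof -
    obtain r k where "r \<in> {0..2 * pi}" "s = r + of_int k * (2 * pi)"
      using reduce_to_period[of "2 * pi" s] by auto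
    then show ?thesis using periodic_int[of \<kappa> "2 * pi" r k] \<kappa>per s0 by simp
  qed
  obtain \<phi> \<tau> where \<phi>: "solves (field b) UNIV \<phi>" "\<tau> 0 = 0" "\<And>s. (\<tau> has_real_derivative \<kappa> s) (at s)"
      "strict_mono \<tau>" "surj \<tau>" "\<And>s. \<phi> (\<tau> s) = z s"
    by (rule reparametrize_to_solution[OF c\<kappa> low \<kappa>pos dz]) (rule that)
  define T where "T = \<tau> (2 * pi)"
  have \<tau>p: "\<tau> (s + 2 * pi) = \<tau> s + T" for s
    using antiderivative_shift[OF \<phi>(3) \<kappa>per, of s] \<phi>(2) unfolding T_def by simp
  show ?thesis
  proof
    show "0 < T" unfolding T_def using strict_monoD[OF \<phi>(4), of 0 "2 * pi"] \<phi>(2) by simp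
    show "\<phi> (t + T) = \<phi> t" for t
    proof -
      obtain s where "t = \<tau> s" using \<phi>(5) by (metis surjD)
      then show ?thesis using \<phi>(6)[of "s + 2 * pi"] \<phi>(6)[of s] \<tau>p[of s] unfolding z_def by (simp add: per)
    qed
  qed (use \<phi> \<tau>p z_def in auto)
qed

text \<open>The ovals of the first integral are closed orbits of the unperturbed field.\<close>

lemma level_curve_solution:
  assumes "x < 0"
  obtains \<phi> \<tau> T where "solves base_field UNIV \<phi>" "strict_mono \<tau>" "surj \<tau>"
    "\<And>s. \<phi> (\<tau> s) = pt x s" "0 < T" "\<And>t. \<phi> (t + T) = \<phi> t" "\<And>s. \<tau> (s + 2 * pi) = \<tau> s + T"
proof (rule closed_curve_solution[of "\<lambda>_. x" "\<lambda>_. 0" "\<lambda>_. 0"])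
  show "0 < wedge (pt x t) (base_field (pt x t))" for t
    using wedge_base_pos radius[OF assms] pt_nonzero[OF assms] by blast
  show "(radius x t)\<^sup>2 / wedge (pt x t) (base_field (pt x t)) * (grad (pt x t) \<bullet> base_field (pt x t)) = 0" for t
    using grad_field[OF radius(2)[OF assms], of t "\<lambda>_. 0"] by simp
qed (use assms that in auto)

text \<open>The transversal is a segment from the midpoint of an edge towards the origin. The orbits inside are ovals that meet every
  ray once per turn, so the first return map is the identity.\<close>

lemma base_field_first_return: "has_first_return_map base_field boundary"
proof -
  obtain B where B: "0 < B" "\<And>z. norm z \<le> B * gauge z" using norm_le_gauge by metis
  obtain C where C: "\<And>z i. z \<in> inside \<Longrightarrow> i < n \<Longrightarrow> pot z \<le> lam i * ln (side i z) + C"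
    by (rule pot_upper_bound) (rule that)
  define q where "q = edge_point 0 (1/2)"
  have qb: "gauge q = 1" using edge_point_boundary[of "1/2" 0] unfolding q_def boundary_def by simp
  then have q0: "q \<noteq> 0" by auto
  have side1: "side 1 q = 0" unfolding q_def using side_edge_point_simps(1)[of 0 "1/2"] by simp
  obtain t0 where t0: "q = norm q *\<^sub>R ray t0" by (rule polar_form)
  have seg: "q + s *\<^sub>R (- q) = (1 - s) *\<^sub>R q" for s by (simp add: algebra_simps)
  have wq: "0 < wedge q (base_field q)"
  proof -
    have "Suc 0 mod n = 1" using n3 by simp
    then have "0 < others 1 q" using others_edge_point_pos[of "1/2" 0] unfolding q_def by simp
    then have "0 < lam 1 * (side 1 q - 1)\<^sup>2 * others 1 q" using lam_pos[of 1] unfolding side1 by simp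
    also have "\<dots> \<le> angular_weight q" by (rule angular_weight_ge) (use qb n3 in simp_all)
    finally have "0 < angular_weight q" .
    moreover have "0 < fst q + c" using c_pos qb by simp
    ultimately show ?thesis unfolding wedge_field by simp
  qed
  have ins: "(1 - s) *\<^sub>R q \<in> inside" "(1 - s) *\<^sub>R q \<noteq> 0" if "0 < s" "s < 1" for s
    using that qb q0 by (simp_all add: inside_iff gauge_scaleR)
  define x0 where "x0 s = pot ((1 - s) *\<^sub>R q)" for s
  have x0: "x0 s < 0" if "0 < s" "s < 1" for s
    unfolding x0_def using pot_neg[OF ins[OF that]] .
  have ptx0: "pt (x0 s) t0 = (1 - s) *\<^sub>R q" if "0 < s" "s < 1" for s
  proof -
    have "(1 - s) *\<^sub>R q = (1 - s) *\<^sub>R (norm q *\<^sub>R ray t0)" using t0 by simp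
    also have "\<dots> = norm ((1 - s) *\<^sub>R q) *\<^sub>R ray t0" using that by simp
    finally show ?thesis unfolding x0_def using pt_of_polar[OF ins[OF that]] by blast
  qed
  have "\<exists>\<phi> T. 0 < T \<and> solves base_field {0..T} \<phi> \<and> \<phi> 0 = (1 - s) *\<^sub>R q \<and> \<phi> T = (1 - s) *\<^sub>R q \<and>
      (\<forall>t\<in>{0<..<T}. \<forall>r<1. \<phi> t \<noteq> (1 - r) *\<^sub>R q) \<and> \<phi> ` {0..T} = range (\<lambda>t. pt (x0 s) t)"
    if s: "0 < s" "s < 1" for s
  proof -
    obtain \<phi> \<tau> T where \<phi>: "solves base_field UNIV \<phi>" "strict_mono \<tau>" "surj \<tau>"
        "\<And>r. \<phi> (\<tau> r) = pt (x0 s) r" "0 < T" "\<And>t. \<phi> (t + T) = \<phi> t" "\<And>r. \<tau> (r + 2 * pi) = \<tau> r + T"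
      by (rule level_curve_solution[OF x0[OF s]]) (rule that)
    define \<psi> where "\<psi> t = \<phi> (t + \<tau> t0)" for t
    have between: "\<exists>r. t0 \<le> r \<and> r \<le> t0 + 2 * pi \<and> t + \<tau> t0 = \<tau> r \<and> (0 < t \<longrightarrow> t0 < r) \<and> (t < T \<longrightarrow> r < t0 + 2 * pi)"
      if "0 \<le> t" "t \<le> T" for t
    proof -
      obtain r where r: "t + \<tau> t0 = \<tau> r" using \<phi>(3) by (metis surjD)
      have "\<tau> t0 \<le> \<tau> r" "\<tau> r \<le> \<tau> (t0 + 2 * pi)" "0 < t \<longrightarrow> \<tau> t0 < \<tau> r" "t < T \<longrightarrow> \<tau> r < \<tau> (t0 + 2 * pi)"
        using r that \<phi>(7)[of t0] by auto
      then show ?thesis using r strict_mono_less_eq[OF \<phi>(2)] strict_mono_less[OF \<phi>(2)] by blast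
    qed
    have "solves base_field {0..T} \<psi>"
      unfolding \<psi>_def[abs_def] using solves_subset[OF solves_shift[OF \<phi>(1)]] by simp
    moreover have "\<psi> 0 = (1 - s) *\<^sub>R q" unfolding \<psi>_def using \<phi>(4) ptx0[OF s] by simp
    moreover have "\<psi> T = (1 - s) *\<^sub>R q"
      unfolding \<psi>_def using \<phi>(4) ptx0[OF s] \<phi>(6)[of "\<tau> t0"] by (simp add: add.commute)
    moreover have "\<psi> t \<noteq> (1 - r) *\<^sub>R q" if t: "t \<in> {0<..<T}" and r: "r < 1" for t r
    proof
      assume eq: "\<psi> t = (1 - r) *\<^sub>R q"
      obtain a where a: "t0 < a" "a < t0 + 2 * pi" "t + \<tau> t0 = \<tau> a"
        using between[of t] t by auto
      have "\<psi> t = radius (x0 s) a *\<^sub>R ray a" unfolding \<psi>_def a(3) \<phi>(4) pt_def ..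
      also have "radius (x0 s) a = norm (\<psi> t)"
        unfolding \<psi>_def a(3) \<phi>(4) using norm_pt[OF x0[OF s]] by simp
      finally have "norm (\<psi> t) *\<^sub>R ray a = (1 - r) *\<^sub>R (norm q *\<^sub>R ray t0)" using eq t0 by metis
      also have "\<dots> = norm (\<psi> t) *\<^sub>R ray t0" unfolding eq using r by simp
      finally have "ray a = ray t0" unfolding eq using r q0 by simp
      then obtain k where k: "a = t0 + of_int k * (2 * pi)" by (rule ray_eq_imp)
      then have "0 < of_int k * (2 * pi)" "of_int k * (2 * pi) < 1 * (2 * pi)" using a by simp_all
      then have "0 < (of_int k :: real)" "(of_int k :: real) < 1"
        by (simp_all only: zero_less_mult_iff mult_less_cancel_right) (use pi_gt_zero in auto)
      then show False by simp
    qed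
    moreover have "\<psi> ` {0..T} = range (\<lambda>t. pt (x0 s) t)"
    proof
      show "\<psi> ` {0..T} \<subseteq> range (\<lambda>t. pt (x0 s) t)"
      proof
        fix w assume "w \<in> \<psi> ` {0..T}"
        then obtain t where "w = \<psi> t" by auto
        moreover obtain r where "t + \<tau> t0 = \<tau> r" using \<phi>(3) by (metis surjD)
        ultimately show "w \<in> range (\<lambda>t. pt (x0 s) t)" unfolding \<psi>_def by (simp add: \<phi>(4))
      qed
      show "range (\<lambda>t. pt (x0 s) t) \<subseteq> \<psi> ` {0..T}"
      proof
        fix w assume "w \<in> range (\<lambda>t. pt (x0 s) t)"
        then obtain t where w: "w = pt (x0 s) t" by auto
        obtain r k where r: "r \<in> {0..2 * pi}" "t - t0 = r + of_int k * (2 * pi)"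
          using reduce_to_period[of "2 * pi" "t - t0"] by auto
        have "t = (t0 + r) + of_int k * (2 * pi)" using r(2) by simp
        then have "w = pt (x0 s) (t0 + r)"
          unfolding w using periodic_int[of "pt (x0 s)" "2 * pi" "t0 + r" k] by simp
        also have "\<dots> = \<psi> (\<tau> (t0 + r) - \<tau> t0)" unfolding \<psi>_def by (simp add: \<phi>(4))
        finally have "w = \<psi> (\<tau> (t0 + r) - \<tau> t0)" .
        moreover have "\<tau> t0 \<le> \<tau> (t0 + r)" "\<tau> (t0 + r) \<le> \<tau> (t0 + 2 * pi)"
          using r(1) strict_mono_less_eq[OF \<phi>(2)] by simp_all
        ultimately show "w \<in> \<psi> ` {0..T}" using \<phi>(7)[of t0] by auto
      qed
    qed
    ultimately show ?thesis using \<phi>(5) by blast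
  qed
  then obtain \<phi> T where \<phi>T: "\<And>s. 0 < s \<Longrightarrow> s < 1 \<Longrightarrow> 0 < T s \<and> solves base_field {0..T s} (\<phi> s) \<and>
      \<phi> s 0 = (1 - s) *\<^sub>R q \<and> \<phi> s (T s) = (1 - s) *\<^sub>R q \<and>
      (\<forall>t\<in>{0<..<T s}. \<forall>r<1. \<phi> s t \<noteq> (1 - r) *\<^sub>R q) \<and> \<phi> s ` {0..T s} = range (\<lambda>t. pt (x0 s) t)"
    by metis
  have haus: "((\<lambda>s. hausdorff_dist (\<phi> s ` {0..T s}) boundary) \<longlongrightarrow> 0) (at_right 0)"
  proof (rule tendsto_sandwich[OF _ _ tendsto_const])
    have ev: "\<forall>\<^sub>F s :: real in at_right 0. 0 < s \<and> s < 1"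
      using eventually_at_right_real[of 0 1] by simp
    show "\<forall>\<^sub>F s in at_right 0. 0 \<le> hausdorff_dist (\<phi> s ` {0..T s}) boundary"
      using ev
    proof eventually_elim
      case (elim s)
      then show ?case using \<phi>T[of s] hausdorff_curve(2)[OF B(2), of "\<lambda>_. x0 s" "x0 s"] x0[of s] by simp
    qed
    show "\<forall>\<^sub>F s in at_right 0. hausdorff_dist (\<phi> s ` {0..T s}) boundary \<le>
        B * exp ((lam 1 * ln s + C) / lam_total)"
      using ev
    proof eventually_elim
      case (elim s)
      have "hausdorff_dist (\<phi> s ` {0..T s}) boundary \<le> B * exp (x0 s / lam_total)"
        using elim \<phi>T[of s] hausdorff_curve(1)[OF B(2), of "\<lambda>_. x0 s" "x0 s"] x0[of s] by simp
      also have "\<dots> \<le> B * exp ((lam 1 * ln s + C) / lam_total)"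
      proof -
        have sd: "side 1 ((1 - s) *\<^sub>R q) = s"
        proof -
          have "u 1 \<bullet> q = - 1" using side1 by (simp add: side_def)
          then show ?thesis by (simp add: side_def)
        qed
        have "x0 s \<le> lam 1 * ln s + C"
          using C[OF ins(1)[of s], of 1] elim n3 unfolding x0_def sd by simp
        then have "x0 s / lam_total \<le> (lam 1 * ln s + C) / lam_total"
          using lam_total_pos by (simp add: divide_right_mono)
        then show ?thesis using B(1) by simp
      qed
      finally show ?case .
    qed
    have "filterlim (\<lambda>s. lam 1 * ln s) at_bot (at_right 0)"
      by (rule filterlim_tendsto_pos_mult_at_bot[OF tendsto_const lam_pos ln_at_0])
    then have "filterlim (\<lambda>s. - (lam 1 * ln s)) at_top (at_right 0)"
      by (simp add: filterlim_uminus_at_bot)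
    then have "filterlim (\<lambda>s. - C + - (lam 1 * ln s)) at_top (at_right 0)"
      by (rule filterlim_tendsto_add_at_top[OF tendsto_const])
    then have "filterlim (\<lambda>s. - (C + lam 1 * ln s)) at_top (at_right 0)" by simp
    then have "filterlim (\<lambda>s. C + lam 1 * ln s) at_bot (at_right 0)"
      by (subst filterlim_uminus_at_bot)
    then have "filterlim (\<lambda>s. (1 / lam_total) * (C + lam 1 * ln s)) at_bot (at_right 0)"
      using lam_total_pos by (intro filterlim_tendsto_pos_mult_at_bot[OF tendsto_const]) auto
    then have "((\<lambda>s. exp ((1 / lam_total) * (C + lam 1 * ln s))) \<longlongrightarrow> 0) (at_right 0)"
      by (rule filterlim_compose[OF exp_at_bot])
    from tendsto_mult_right_zero[OF this, of B]
    show "((\<lambda>s. B * exp ((lam 1 * ln s + C) / lam_total)) \<longlongrightarrow> 0) (at_right 0)"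
      by (simp add: add.commute)
  qed
  show ?thesis
    unfolding has_first_return_map_def
  proof (rule exI[of _ q], rule exI[of _ "- q"], rule exI[of _ "1/2"], rule exI[of _ "1/2"],
      rule exI[of _ "\<lambda>s. s"], rule exI[of _ T], rule exI[of _ \<phi>], unfold seg, intro conjI ballI)
    show "q \<in> boundary" using qb by (simp add: boundary_def)
    show "base_field q \<noteq> 0" using wq by (auto simp: wedge_def)
    show "- q \<noteq> 0" using q0 by simp
    show "base_field ((1 - s) *\<^sub>R q) \<notin> span {- q}" if "s \<in> {0..<1/2}" for s
    proof
      assume "base_field ((1 - s) *\<^sub>R q) \<in> span {- q}"
      then obtain k where k: "base_field ((1 - s) *\<^sub>R q) = k *\<^sub>R (- q)" by (auto simp: span_singleton)
      have "wedge ((1 - s) *\<^sub>R q) (base_field ((1 - s) *\<^sub>R q)) = 0" unfolding k by (simp add: wedge_def)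
      moreover have "0 < wedge ((1 - s) *\<^sub>R q) (base_field ((1 - s) *\<^sub>R q))"
      proof (cases "s = 0")
        case True
        then show ?thesis using wq by simp
      next
        case False
        then have "0 < s" "s < 1" using that by auto
        then show ?thesis using wedge_base_pos[OF ins] by blast
      qed
      ultimately show False by simp
    qed
    show "(1 - s) *\<^sub>R q \<notin> boundary" if "s \<in> {0<..<1/2}" for s
      using that qb by (simp add: boundary_def gauge_scaleR)
    fix s :: real assume "s \<in> {0<..<1/2}"
    then have s: "0 < s" "s < 1" "s < 1/2" by auto
    show "0 < T s" "solves base_field {0..T s} (\<phi> s)" "\<phi> s 0 = (1 - s) *\<^sub>R q" "\<phi> s (T s) = (1 - s) *\<^sub>R q"
      using \<phi>T[OF s(1,2)] by blast+
    show "s \<in> {0<..<1/2}" using s by simp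
    fix t assume t: "t \<in> {0<..<T s}"
    show "\<phi> s t \<notin> (\<lambda>r. (1 - r) *\<^sub>R q) ` {0<..<1/2}"
    proof
      assume "\<phi> s t \<in> (\<lambda>r. (1 - r) *\<^sub>R q) ` {0<..<1/2}"
      then obtain r where "r < 1/2" "\<phi> s t = (1 - r) *\<^sub>R q" by auto
      moreover from this have "r < 1" by simp
      ultimately show False using \<phi>T[OF s(1,2)] t by blast
    qed
  qed (use haus in \<open>auto intro: tendsto_intros\<close>)
qed

lemma base_field_hyperbolic_polycycle: "hyperbolic_polycycle base_field n boundary"
  unfolding hyperbolic_polycycle_def polycycle_def
  using base_field_graphic base_field_first_return vertex_saddle by blast

end

section \<open>Limit cycles from simple zeros of the averaged equation\<close>

text \<open>Continuity of the function and of its partial derivative in \<open>x\<close>, jointly in the perturbation parameter \<open>e\<close>, in \<open>x\<close> and in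
  the angle. This is the regularity that \<open>periodic_averaging\<close> asks for.\<close>

definition C1_strip :: "real \<Rightarrow> real \<Rightarrow> real \<Rightarrow> (real \<Rightarrow> real \<Rightarrow> real \<Rightarrow> real) \<Rightarrow> (real \<Rightarrow> real \<Rightarrow> real \<Rightarrow> real) \<Rightarrow> bool" where
  "C1_strip E a b f f' \<longleftrightarrow>
     continuous_on ({0..E} \<times> {a..b} \<times> UNIV) (\<lambda>(e, x, t). f e x t) \<and>
     continuous_on ({0..E} \<times> {a..b} \<times> UNIV) (\<lambda>(e, x, t). f' e x t) \<and>
     (\<forall>e\<in>{0..E}. \<forall>x\<in>{a..b}. \<forall>t.
        ((\<lambda>x. f e x t) has_real_derivative f' e x t) (at x within {a..b}) \<and>
        f e x (t + 2 * pi) = f e x t \<and> f' e x (t + 2 * pi) = f' e x t)"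

lemma C1_strip_const:
  assumes "continuous_on UNIV (\<lambda>(e, t). g e t)" "\<And>e t. g e (t + 2 * pi) = g e t"
  shows "C1_strip E a b (\<lambda>e x t. g e t) (\<lambda>e x t. 0)"
proof -
  have "continuous_on S (\<lambda>p. (\<lambda>(e, t). g e t) (fst p, snd (snd p)))" for S :: "(real \<times> real \<times> real) set"
    by (rule continuous_on_compose2[OF assms(1)]) (auto intro!: continuous_intros)
  then show ?thesis unfolding C1_strip_def using assms(2) by (auto simp: split_beta)
qed

lemma C1_strip_add:
  assumes "C1_strip E a b f f'" "C1_strip E a b g g'"
  shows "C1_strip E a b (\<lambda>e x t. f e x t + g e x t) (\<lambda>e x t. f' e x t + g' e x t)"
  using assms unfolding C1_strip_def split_beta
  by (auto intro!: continuous_intros DERIV_add)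

lemma C1_strip_mult:
  assumes "C1_strip E a b f f'" "C1_strip E a b g g'"
  shows "C1_strip E a b (\<lambda>e x t. f e x t * g e x t) (\<lambda>e x t. f' e x t * g e x t + g' e x t * f e x t)"
  using assms unfolding C1_strip_def split_beta
  by (auto intro!: continuous_intros DERIV_mult)

lemma C1_strip_inverse:
  assumes "C1_strip E a b f f'"
    and "\<And>e x t. e \<in> {0..E} \<Longrightarrow> x \<in> {a..b} \<Longrightarrow> f e x t \<noteq> 0"
  shows "C1_strip E a b (\<lambda>e x t. inverse (f e x t)) (\<lambda>e x t. - (inverse (f e x t) * f' e x t * inverse (f e x t)))"
  using assms unfolding C1_strip_def split_beta
  by (auto intro!: continuous_intros DERIV_inverse')

lemma C1_strip_sum:
  assumes "finite I" "\<And>i. i \<in> I \<Longrightarrow> C1_strip E a b (f i) (f' i)"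
  shows "C1_strip E a b (\<lambda>e x t. \<Sum>i\<in>I. f i e x t) (\<lambda>e x t. \<Sum>i\<in>I. f' i e x t)"
  using assms
proof (induction I rule: finite_induct)
  case empty
  then show ?case using C1_strip_const[of "\<lambda>_ _. 0" E a b] by simp
next
  case (insert i I)
  then show ?case using C1_strip_add[of E a b "f i" "f' i"] by simp
qed

text \<open>The existential form has closure rules that compute no derivative.\<close>

definition C1 :: "real \<Rightarrow> real \<Rightarrow> real \<Rightarrow> (real \<Rightarrow> real \<Rightarrow> real \<Rightarrow> real) \<Rightarrow> bool" where
  "C1 E a b f \<longleftrightarrow> (\<exists>f'. C1_strip E a b f f')"

lemma C1_const: "C1 E a b (\<lambda>e x t. k)"
  and C1_e: "C1 E a b (\<lambda>e x t. e)"
  and C1_cos: "C1 E a b (\<lambda>e x t. cos t)"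
  and C1_sin: "C1 E a b (\<lambda>e x t. sin t)"
proof -
  have c: "C1 E a b (\<lambda>e x t. g e t)"
    if "continuous_on UNIV (\<lambda>p. g (fst p) (snd p))" "\<And>e t. g e (t + 2 * pi) = g e t" for g
    using C1_strip_const[of g E a b] that unfolding C1_def split_beta by blast
  show "C1 E a b (\<lambda>e x t. k)" "C1 E a b (\<lambda>e x t. e)" "C1 E a b (\<lambda>e x t. cos t)" "C1 E a b (\<lambda>e x t. sin t)"
    by (rule c; auto intro!: continuous_intros)+
qed

lemma C1_add: "C1 E a b f \<Longrightarrow> C1 E a b g \<Longrightarrow> C1 E a b (\<lambda>e x t. f e x t + g e x t)"
  unfolding C1_def using C1_strip_add by blast

lemma C1_mult: "C1 E a b f \<Longrightarrow> C1 E a b g \<Longrightarrow> C1 E a b (\<lambda>e x t. f e x t * g e x t)"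
  unfolding C1_def using C1_strip_mult by blast

lemma C1_minus: "C1 E a b f \<Longrightarrow> C1 E a b (\<lambda>e x t. - f e x t)"
  using C1_mult[OF C1_const[of E a b "-1"], of f] by simp

lemma C1_diff: "C1 E a b f \<Longrightarrow> C1 E a b g \<Longrightarrow> C1 E a b (\<lambda>e x t. f e x t - g e x t)"
  using C1_add[OF _ C1_minus, of E a b f g] by simp

lemma C1_power2: "C1 E a b f \<Longrightarrow> C1 E a b (\<lambda>e x t. (f e x t)\<^sup>2)"
  unfolding power2_eq_square by (rule C1_mult)

lemma C1_divide:
  assumes "C1 E a b f" "C1 E a b g" "\<And>e x t. e \<in> {0..E} \<Longrightarrow> x \<in> {a..b} \<Longrightarrow> g e x t \<noteq> 0"
  shows "C1 E a b (\<lambda>e x t. f e x t / g e x t)"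
proof -
  have "C1 E a b (\<lambda>e x t. inverse (g e x t))"
    using assms(2,3) C1_strip_inverse unfolding C1_def by blast
  from C1_mult[OF assms(1) this] show ?thesis by (simp add: divide_inverse)
qed

lemma C1_sum:
  assumes "finite I" "\<And>i. i \<in> I \<Longrightarrow> C1 E a b (f i)"
  shows "C1 E a b (\<lambda>e x t. \<Sum>i\<in>I. f i e x t)"
proof -
  have "\<forall>i\<in>I. \<exists>f'. C1_strip E a b (f i) f'" using assms(2) unfolding C1_def by blast
  then obtain f' where f': "\<forall>i\<in>I. C1_strip E a b (f i) (f' i)" by (rule bchoice[THEN exE])
  have "C1_strip E a b (\<lambda>e x t. \<Sum>i\<in>I. f i e x t) (\<lambda>e x t. \<Sum>i\<in>I. f' i e x t)"
    by (rule C1_strip_sum[OF assms(1)]) (use f' in blast)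
  then show ?thesis unfolding C1_def by blast
qed

context polygon
begin

lemma C1_radius:
  assumes b: "b < 0" shows "C1_strip E a b (\<lambda>e x t. radius x t) (\<lambda>e x t. - radius x t / decay (pt x t))"
proof -
  let ?S = "{0..E} \<times> {a..b} \<times> (UNIV :: real set)"
  have cr: "continuous_on ?S (\<lambda>(e, x, t). radius x t)"
  proof -
    have "continuous_on ?S (\<lambda>p. (\<lambda>q. radius (fst q) (snd q)) (snd p))"
      by (rule continuous_on_compose2[OF continuous_radius]) (use b in \<open>auto intro!: continuous_intros\<close>)
    then show ?thesis by (simp add: split_beta)
  qed
  have cp: "continuous_on ?S (\<lambda>p. pt (fst (snd p)) (snd (snd p)))"
    unfolding pt_def ray_def using cr unfolding split_beta by (intro continuous_intros)
  have neg: "fst (snd p) < 0" if "p \<in> ?S" for p using that b by auto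
  have cs: "continuous_on ?S (\<lambda>p. side j (pt (fst (snd p)) (snd (snd p))))" for j
    by (rule continuous_on_compose2[OF continuous_side[of UNIV] cp]) auto
  have snz: "side j (pt (fst (snd p)) (snd (snd p))) \<noteq> 0" if "p \<in> ?S" for j p
    using side_pos_inside[OF radius(2)[OF neg[OF that]], of j "snd (snd p)"] by simp
  have cd: "continuous_on ?S (\<lambda>p. decay (pt (fst (snd p)) (snd (snd p))))"
    unfolding decay_def by (intro continuous_intros cs) (use snz in blast)
  have dnz: "decay (pt (fst (snd p)) (snd (snd p))) \<noteq> 0" if "p \<in> ?S" for p
    using decay_pos[OF radius(2)[OF neg[OF that]] pt_nonzero[OF neg[OF that]], of "snd (snd p)"] by simp
  have cr': "continuous_on ?S (\<lambda>p. radius (fst (snd p)) (snd (snd p)))" using cr by (simp add: split_beta)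
  have cd': "continuous_on ?S (\<lambda>p. - radius (fst (snd p)) (snd (snd p)) / decay (pt (fst (snd p)) (snd (snd p))))"
    by (intro continuous_intros cr' cd) (use dnz in blast)
  show ?thesis
    unfolding C1_strip_def
  proof (intro conjI ballI allI)
    show "continuous_on ?S (\<lambda>(e, x, t). - radius x t / decay (pt x t))" using cd' by (simp add: split_beta)
    fix x t assume "x \<in> {a..b}"
    then have "x < 0" using b by simp
    from has_field_derivative_at_within[OF radius_deriv_x[OF this]]
    show "((\<lambda>x. radius x t) has_real_derivative - radius x t / decay (pt x t)) (at x within {a..b})" .
  qed (use cr in auto)
qed

lemma C1_pt:
  assumes "b < 0"
  shows "C1 E a b (\<lambda>e x t. radius x t)" "C1 E a b (\<lambda>e x t. fst (pt x t))" "C1 E a b (\<lambda>e x t. snd (pt x t))"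
    "C1 E a b (\<lambda>e x t. side j (pt x t))" "C1 E a b (\<lambda>e x t. decay (pt x t))" "C1 E a b (\<lambda>e x t. fst (grad (pt x t)))"
proof -
  show 1: "C1 E a b (\<lambda>e x t. radius x t)" using C1_radius[OF assms] unfolding C1_def by blast
  show 2: "C1 E a b (\<lambda>e x t. fst (pt x t))" unfolding pt_def ray_def by (simp add: C1_mult[OF 1 C1_cos])
  show 3: "C1 E a b (\<lambda>e x t. snd (pt x t))" unfolding pt_def ray_def by (simp add: C1_mult[OF 1 C1_sin])
  have 4: "C1 E a b (\<lambda>e x t. side j (pt x t))" for j
    unfolding side_def inner_prod_def inner_real_def by (intro C1_add C1_mult C1_const 2 3)
  then show "C1 E a b (\<lambda>e x t. side j (pt x t))" .
  have nz: "side j (pt x t) \<noteq> 0" if "x \<in> {a..b}" for j x t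
  proof -
    have "x < 0" using that assms by simp
    from side_pos_inside[OF radius(2)[OF this], of j t] show ?thesis by simp
  qed
  show "C1 E a b (\<lambda>e x t. decay (pt x t))"
    unfolding decay_def by (intro C1_sum C1_divide C1_mult C1_power2 C1_diff C1_const 4) (use nz in auto)
  have "C1 E a b (\<lambda>e x t. \<Sum>j<n. lam j / side j (pt x t) * fst (u j))"
    by (intro C1_sum C1_divide C1_mult C1_const 4) (use nz in auto)
  then show "C1 E a b (\<lambda>e x t. fst (grad (pt x t)))"
    unfolding grad_def by (simp add: fst_sum)
qed

text \<open>One term of the sum, that of the side which attains the gauge, is already large enough.\<close>

lemma decay_lower: assumes "0 < r0" obtains e0 where "0 < e0" "\<And>z. z \<in> inside \<Longrightarrow> r0 \<le> norm z \<Longrightarrow> e0 \<le> decay z"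
proof -
  obtain B where B: "0 < B" "\<And>z. norm z \<le> B * gauge z" using norm_le_gauge by metis
  define lm where "lm = Min (lam ` {..<n})"
  have lm: "0 < lm" "\<And>i. i < n \<Longrightarrow> lm \<le> lam i"
    unfolding lm_def using n_pos lam_pos by (auto intro!: Min_le simp: lessThan_empty_iff)
  show ?thesis
  proof
    show "0 < lm * (r0 / B)\<^sup>2" using lm B assms by simp
    fix z assume z: "z \<in> inside" "r0 \<le> norm z"
    obtain i where i: "i < n" "gauge z = - (u i \<bullet> z)" by (rule gauge_attained)
    have s: "side i z - 1 = - gauge z" "0 < side i z" "side i z \<le> 1"
      using i side_pos_inside[OF z(1)] gauge_nonneg[of z] by (auto simp: side_def)
    have "r0 / B \<le> gauge z" using z(2) B(2)[of z] B(1) by (simp add: field_simps)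
    then have "(r0 / B)\<^sup>2 \<le> (gauge z)\<^sup>2" using assms B(1) by (intro power_mono) auto
    then have "lm * (r0 / B)\<^sup>2 \<le> lam i * (gauge z)\<^sup>2" using lm i(1) lam_pos[of i] by (intro mult_mono) (auto simp: less_imp_le)
    also have "\<dots> \<le> lam i * (gauge z)\<^sup>2 / side i z"
      using s(2,3) lam_pos[of i] mult_right_mono[OF s(3), of "lam i * (gauge z)\<^sup>2"] by (simp add: field_simps)
    also have "\<dots> = lam i * (side i z - 1)\<^sup>2 / side i z" unfolding s(1) by simp
    also have "\<dots> \<le> decay z"
      unfolding decay_def using i side_pos_inside[OF z(1)] lam_pos
      by (intro member_le_sum) (auto simp: less_imp_le)
    finally show "lm * (r0 / B)\<^sup>2 \<le> decay z" .
  qed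
qed

text \<open>By \<open>center\<close> the gradient is a sum of terms of size \<open>\<bar>side j z - 1\<bar> / side j z\<close>, and each of them is bounded by the
  corresponding term of \<open>decay z\<close> where the side is small, and by a constant elsewhere.\<close>

lemma grad_le_decay:
  assumes e0: "0 < e0"
  obtains L where "0 < L" "\<And>z. z \<in> inside \<Longrightarrow> e0 \<le> decay z \<Longrightarrow> norm (grad z) \<le> L * decay z"
proof -
  define U where "U = (\<Sum>j<n. norm (u j)) + 1"
  have U: "0 < U" "\<And>j. j < n \<Longrightarrow> norm (u j) \<le> U"
  proof -
    show "0 < U" unfolding U_def by (simp add: sum_nonneg add_nonneg_pos)
    have "norm (u j) \<le> (\<Sum>j<n. norm (u j))" if "j < n" for j
      using that by (intro member_le_sum) auto
    then show "norm (u j) \<le> U" if "j < n" for j unfolding U_def using that by fastforce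
  qed
  show ?thesis
  proof
    show "0 < U * (2 + lam_total / e0)" using U lam_total_pos e0 by (simp add: add_pos_pos)
    fix z assume z: "z \<in> inside" "e0 \<le> decay z"
    have g: "grad z = (\<Sum>j<n. (lam j * (1 - side j z) / side j z) *\<^sub>R u j)"
    proof -
      have "(\<Sum>j<n. (lam j * (1 - side j z) / side j z) *\<^sub>R u j) = grad z - (\<Sum>j<n. lam j *\<^sub>R u j)"
        unfolding grad_def sum_subtractf[symmetric]
      proof (rule sum.cong)
        fix j
        show "(lam j * (1 - side j z) / side j z) *\<^sub>R u j = (lam j / side j z) *\<^sub>R u j - lam j *\<^sub>R u j"
          using side_pos_inside[OF z(1), of j] by (simp add: scaleR_diff_left[symmetric] field_simps)
      qed simp
      then show ?thesis by (simp add: center)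
    qed
    have "norm (grad z) \<le> (\<Sum>j<n. norm ((lam j * (1 - side j z) / side j z) *\<^sub>R u j))"
      unfolding g by (rule norm_sum)
    also have "\<dots> \<le> (\<Sum>j<n. (2 * (lam j * (side j z - 1)\<^sup>2 / side j z) + lam j) * U)"
    proof (rule sum_mono)
      fix j assume j: "j \<in> {..<n}"
      define s where "s = side j z"
      have s: "0 < s" unfolding s_def by (rule side_pos_inside[OF z(1)])
      have "\<bar>1 - s\<bar> \<le> 2 * (s - 1)\<^sup>2 + s"
      proof (cases "\<bar>1 - s\<bar> \<le> s")
        case False
        then have "1 / 2 \<le> \<bar>1 - s\<bar>" using s by (auto simp: abs_if split: if_splits)
        then have "\<bar>1 - s\<bar> * 1 \<le> \<bar>1 - s\<bar> * (2 * \<bar>1 - s\<bar>)" by (intro mult_left_mono) auto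
        also have "\<dots> = 2 * (s - 1)\<^sup>2" by (simp add: power2_eq_square abs_if algebra_simps)
        finally show ?thesis using s by simp
      qed (simp add: add_increasing)
      then have "\<bar>1 - s\<bar> / s \<le> 2 * (s - 1)\<^sup>2 / s + 1" using s by (simp add: field_simps)
      then have "lam j * (\<bar>1 - s\<bar> / s) \<le> lam j * (2 * (s - 1)\<^sup>2 / s + 1)" using lam_pos[of j] by (intro mult_left_mono) auto
      moreover have "norm (u j) \<le> U" using U(2) j by simp
      moreover have "0 \<le> lam j * (2 * (s - 1)\<^sup>2 / s + 1)" using s lam_pos[of j] by simp
      ultimately have "lam j * (\<bar>1 - s\<bar> / s) * norm (u j) \<le> lam j * (2 * (s - 1)\<^sup>2 / s + 1) * U"
        by (rule mult_mono) simp
      then show "norm ((lam j * (1 - side j z) / side j z) *\<^sub>R u j) \<le> (2 * (lam j * (side j z - 1)\<^sup>2 / side j z) + lam j) * U"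
      proof -
        have "norm ((lam j * (1 - s) / s) *\<^sub>R u j) = lam j * (\<bar>1 - s\<bar> / s) * norm (u j)"
          using s lam_pos[of j] by (simp add: abs_mult)
        moreover have "lam j * (2 * (s - 1)\<^sup>2 / s + 1) = 2 * (lam j * (s - 1)\<^sup>2 / s) + lam j"
          by (simp add: distrib_left)
        ultimately show ?thesis unfolding s_def[symmetric]
          using \<open>lam j * (\<bar>1 - s\<bar> / s) * norm (u j) \<le> lam j * (2 * (s - 1)\<^sup>2 / s + 1) * U\<close> by simp
      qed
    qed
    also have "\<dots> = (2 * decay z + lam_total) * U"
      unfolding decay_def lam_total_def
      by (simp only: sum_distrib_right[symmetric] sum.distrib sum_distrib_left[symmetric])
    also have "\<dots> \<le> (2 * decay z + lam_total / e0 * decay z) * U"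
    proof -
      have "lam_total / e0 * e0 \<le> lam_total / e0 * decay z"
        using z(2) lam_total_pos e0 by (intro mult_left_mono) auto
      then show ?thesis using U(1) e0 by (intro mult_right_mono) auto
    qed
    finally show "norm (grad z) \<le> U * (2 + lam_total / e0) * decay z" by (simp add: algebra_simps)
  qed
qed

lemma radius_lower: obtains r0 where "0 < r0" "\<And>x t. x \<le> - 1 \<Longrightarrow> r0 \<le> radius x t"
proof -
  have "isCont pot 0"
    using pot_derivative[OF zero_inside] has_derivative_continuous by blast
  then obtain d where d: "0 < d" "\<And>z. norm z < d \<Longrightarrow> \<bar>pot z\<bar> < 1"
    unfolding continuous_at_eps_delta by (metis dist_0_norm dist_commute dist_real_def diff_zero pot_0 zero_less_one)
  show ?thesis
  proof
    fix x t :: real assume x: "x \<le> - 1"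
    then have "x < 0" by simp
    from norm_pt[OF this, of t] radius(3)[OF this, of t] d(2)[of "pt x t"] x
    show "d \<le> radius x t" by (metis abs_minus_cancel abs_of_nonneg neg_le_iff_le not_less order_trans verit_minus_simplify(4) zero_le_one)
  qed (rule d(1))
qed

end

text \<open>The constants depend on the polygon only. The number \<open>c\<close> is chosen last, so large that the Melnikov function of the
  term with \<open>b 0\<close> is dominated by the area enclosed by the ovals, see \<open>melnikov_0_bounds\<close>.\<close>

locale polygon_melnikov = polygon_field +
  fixes B r0 e0 L :: real
  assumes B: "0 < B" "\<And>z. norm z \<le> B * gauge z"
    and r0: "0 < r0" "\<And>x t. x \<le> - 1 \<Longrightarrow> r0 \<le> radius x t"
    and e0: "0 < e0" "\<And>z. z \<in> inside \<Longrightarrow> r0 \<le> norm z \<Longrightarrow> e0 \<le> decay z"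
    and L: "0 < L" "\<And>z. z \<in> inside \<Longrightarrow> e0 \<le> decay z \<Longrightarrow> norm (grad z) \<le> L * decay z"
    and c_large: "B + 1 + 4 * B ^ 4 * L / r0\<^sup>2 \<le> c"
begin

lemma c_B: "B + 1 \<le> c"
proof -
  have "0 \<le> 4 * B ^ 4 * L / r0\<^sup>2" using B(1) L(1) by simp
  then show ?thesis using c_large by linarith
qed

lemma norm_inside: "z \<in> inside \<Longrightarrow> norm z \<le> B"
  using order_trans[OF B(2)[of z] mult_left_mono[of "gauge z" 1 B]] B(1) by (simp add: inside_iff)

lemma abs_coords: "\<bar>fst z\<bar> \<le> norm z" "\<bar>snd z\<bar> \<le> norm (z :: real \<times> real)"
  using norm_fst_le[of "fst z" "snd z"] norm_snd_le[where x = "fst z" and y = "snd z"] by simp_all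

lemma D_bounds: assumes "z \<in> inside" shows "c - B \<le> fst z + c" "1 \<le> fst z + c" "fst z + c \<le> c + B"
  using abs_coords(1)[of z] norm_inside[OF assms] c_B by linarith+

lemma decay_pt: "x \<le> - 1 \<Longrightarrow> e0 \<le> decay (pt x t)"
  using e0(2)[OF radius(2), of x t] r0(2)[of x t] norm_pt[of x t] by simp

text \<open>The perturbed field with parameters \<open>e * b k\<close> satisfies \<open>dx / dt = e * G b e x t\<close>, where \<open>x\<close> is the value of \<open>pot\<close> and \<open>t\<close>
  the angle; the common factor \<open>sides\<close> has cancelled.\<close>

definition G :: "(nat \<Rightarrow> real) \<Rightarrow> real \<Rightarrow> real \<Rightarrow> real \<Rightarrow> real" where
  "G b e x t = (radius x t)\<^sup>2 *
     (- (\<Sum>i<n. b (Suc i) / side i (pt x t)) * decay (pt x t) + b 0 * fst (grad (pt x t))) /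
     ((fst (pt x t) + c) * decay (pt x t) - e * b 0 * snd (pt x t))"

text \<open>Up to this size of the perturbation, the angular speed stays positive on \<open>pot \<le> - 1\<close>.\<close>

definition e_max :: "(nat \<Rightarrow> real) \<Rightarrow> real" where
  "e_max b = e0 / (2 * (\<bar>b 0\<bar> * B + 1))"

lemma e_max_pos: "0 < e_max b"
  unfolding e_max_def using e0(1) B(1) by (simp add: add_nonneg_pos)

lemma denom_pos:
  assumes z: "z \<in> inside" "r0 \<le> norm z" and e: "0 \<le> e" "e \<le> e_max b"
  shows "0 < (fst z + c) * decay z - e * b 0 * snd z"
proof -
  have "e * (\<bar>b 0\<bar> * B + 1) \<le> e0 / 2"
  proof -
    have p: "0 < \<bar>b 0\<bar> * B + 1" using B(1) by (simp add: add_nonneg_pos)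
    have "e * (\<bar>b 0\<bar> * B + 1) \<le> e_max b * (\<bar>b 0\<bar> * B + 1)" using e(2) p by (intro mult_right_mono) auto
    also have "\<dots> = e0 / 2"
    proof -
      have "e0 / (2 * K) * K = e0 / 2" if "0 < K" for K using that by simp
      from this[OF p] show ?thesis unfolding e_max_def .
    qed
    finally show ?thesis .
  qed
  moreover have "\<bar>e * b 0 * snd z\<bar> \<le> e * (\<bar>b 0\<bar> * B + 1)"
  proof -
    have "\<bar>e * b 0 * snd z\<bar> = e * (\<bar>b 0\<bar> * \<bar>snd z\<bar>)" using e(1) by (simp add: abs_mult)
    also have "\<bar>b 0\<bar> * \<bar>snd z\<bar> \<le> \<bar>b 0\<bar> * B"
      using abs_coords(2)[of z] norm_inside[OF z(1)] by (intro mult_left_mono) auto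
    then have "e * (\<bar>b 0\<bar> * \<bar>snd z\<bar>) \<le> e * (\<bar>b 0\<bar> * B + 1)" using e(1) by (intro mult_left_mono) auto
    finally show ?thesis .
  qed
  moreover have "1 * e0 \<le> (fst z + c) * decay z"
    using D_bounds(2)[OF z(1)] e0(2)[OF z] e0(1) by (intro mult_mono) auto
  ultimately show ?thesis using e0(1) by linarith
qed

lemma C1_G:
  assumes "b' \<le> - 1" shows "C1 (e_max b) a b' (G b)"
proof -
  have b: "b' < 0" using assms by simp
  show ?thesis
    unfolding G_def[abs_def]
  proof (intro C1_divide C1_mult C1_power2 C1_add C1_minus C1_diff C1_sum C1_const C1_e C1_pt[OF b])
    fix x t and i :: nat assume x: "x \<in> {a..b'}"
    then have neg: "x < 0" using b by simp
    show "side i (pt x t) \<noteq> 0" using side_pos_inside[OF radius(2)[OF neg], of i t] by simp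
    fix e assume "e \<in> {0..e_max b}"
    then show "(fst (pt x t) + c) * decay (pt x t) - e * b 0 * snd (pt x t) \<noteq> 0"
      using denom_pos[OF radius(2)[OF neg], of t e b] norm_pt[OF neg] r0(2)[of x t] x assms by auto
  qed auto
qed

lemma G_field:
  assumes z: "z \<in> inside" "z \<noteq> 0" "pt (pot z) t = z"
  shows "(norm z)\<^sup>2 / wedge z (field (\<lambda>k. e * b k) z) * (grad z \<bullet> field (\<lambda>k. e * b k) z) = e * G b e (pot z) t"
proof -
  have neg: "pot z < 0" using pot_neg[OF z(1,2)] .
  have R: "radius (pot z) t = norm z" using norm_pt[OF neg, of t] z(3) by simp
  have s: "sides z \<noteq> 0" using sides_pos[OF z(1)] by simp
  have 1: "grad z \<bullet> field (\<lambda>k. e * b k) z =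
      sides z * (e * (- (\<Sum>i<n. b (Suc i) / side i z) * decay z + b 0 * fst (grad z)))"
    unfolding grad_field[OF z(1)] by (simp add: sum_distrib_left algebra_simps)
  have 2: "wedge z (field (\<lambda>k. e * b k) z) = sides z * ((fst z + c) * decay z - e * b 0 * snd z)"
    unfolding wedge_field_inside[OF z(1)] ..
  have cancel: "N / (sides z * p) * (sides z * (e * q)) = e * (N * q / p)" for N p q :: real
    using s by simp
  show ?thesis unfolding 1 2 G_def z(3) R cancel ..
qed

text \<open>The averaging lemma works in the coordinates \<open>pot\<close> and angle. Its periodic solution is a closed orbit of the planar field.
  Conversely, a periodic orbit in the tube \<open>\<bar>pot z - xs\<bar> < \<delta>\<close> has a lifted angle and therefore meets that solution, so the two
  orbits coincide.\<close>

lemma limit_cycle_near: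
  assumes ab: "b' \<le> - 1" "a < xs" "xs < b'" and \<delta>0: "0 < \<delta>0"
    and M: "((\<lambda>t. G b 0 xs t) has_integral 0) {0..2 * pi}"
    and Gx: "C1_strip (e_max b) a b' (G b) Gx"
    and m: "((\<lambda>t. Gx 0 xs t) has_integral m) {0..2 * pi}" "m \<noteq> 0"
  obtains \<delta> E' where "0 < \<delta>" "\<delta> \<le> \<delta>0" "0 < E'"
    "\<And>e. 0 < e \<Longrightarrow> e \<le> E' \<Longrightarrow> \<exists>x. (\<forall>t. \<bar>x t - xs\<bar> < \<delta> \<and> x t < b') \<and>
        limit_cycle (field (\<lambda>k. e * b k)) (range (\<lambda>t. pt (x t) t))"
proof -
  have per: "\<And>e x t. e \<in> {0..e_max b} \<Longrightarrow> x \<in> {a..b'} \<Longrightarrow> G b e x (t + 2 * pi) = G b e x t"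
    "\<And>e x t. e \<in> {0..e_max b} \<Longrightarrow> x \<in> {a..b'} \<Longrightarrow> Gx e x (t + 2 * pi) = Gx e x t"
    and der: "\<And>e x t. e \<in> {0..e_max b} \<Longrightarrow> x \<in> {a..b'} \<Longrightarrow>
        ((\<lambda>x. G b e x t) has_real_derivative Gx e x t) (at x within {a..b'})"
    and cont: "continuous_on ({0..e_max b} \<times> {a..b'} \<times> UNIV) (\<lambda>(e, x, t). G b e x t)"
      "continuous_on ({0..e_max b} \<times> {a..b'} \<times> UNIV) (\<lambda>(e, x, t). Gx e x t)"
    using Gx unfolding C1_strip_def by blast+
  have pi2: "0 < 2 * pi" by simp
  show ?thesis
  proof (rule periodic_averaging[OF pi2 e_max_pos cont _ _ _ ab(2,3) M m \<delta>0])
    fix \<delta> E'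
    assume \<delta>: "0 < \<delta>" "\<delta> \<le> \<delta>0" "a < xs - \<delta>" "xs + \<delta> < b'" "0 < E'" "E' \<le> e_max b"
    and ex: "\<And>e. 0 < e \<Longrightarrow> e \<le> E' \<Longrightarrow> \<exists>x. (\<forall>t. x (t + 2 * pi) = x t) \<and>
        (\<forall>t. (x has_real_derivative e * G b e (x t) t) (at t)) \<and> (\<forall>t. \<bar>x t - xs\<bar> < \<delta>)"
    and uniq: "\<And>e x y \<theta> \<theta>' T k. 0 < e \<Longrightarrow> e \<le> E' \<Longrightarrow> (\<And>t. x (t + 2 * pi) = x t) \<Longrightarrow>
        (\<And>t. (x has_real_derivative e * G b e (x t) t) (at t)) \<Longrightarrow> (\<And>t. \<bar>x t - xs\<bar> < \<delta>) \<Longrightarrow>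
        (\<And>t. (\<theta> has_real_derivative \<theta>' t) (at t)) \<Longrightarrow> (\<And>t. 0 < \<theta>' t) \<Longrightarrow>
        (\<And>t. (y has_real_derivative \<theta>' t * (e * G b e (y t) (\<theta> t))) (at t)) \<Longrightarrow>
        (\<And>t. \<bar>y t - xs\<bar> < \<delta>) \<Longrightarrow> 0 < T \<Longrightarrow> \<theta> T = \<theta> 0 + of_int k * (2 * pi) \<Longrightarrow> y T = y 0 \<Longrightarrow>
        \<exists>t. y t = x (\<theta> t)"
    show ?thesis
    proof (rule that[OF \<delta>(1,2,5)])
      fix e assume e: "0 < e" "e \<le> E'"
      then have ee: "0 \<le> e" "e \<le> e_max b" using \<delta>(6) by simp_all
      let ?Y = "field (\<lambda>k. e * b k)"
      obtain x where x: "\<And>t. x (t + 2 * pi) = x t"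
          "\<And>t. (x has_real_derivative e * G b e (x t) t) (at t)" "\<And>t. \<bar>x t - xs\<bar> < \<delta>"
        using ex[OF e] by blast
      have xb: "x t < b'" "x t \<le> - 1" "x t < 0" for t
      proof -
        show "x t < b'" using x(3)[of t] \<delta>(4) by linarith
        then show "x t \<le> - 1" "x t < 0" using ab(1) by simp_all
      qed
      have wpos: "0 < wedge z (?Y z)" if "z \<in> inside" "r0 \<le> norm z" for z
        unfolding wedge_field_inside[OF that(1)] using sides_pos[OF that(1)] denom_pos[OF that ee] by simp
      have rn: "r0 \<le> norm (pt (x t) t)" for t using norm_pt[OF xb(3)] r0(2)[OF xb(2)] by simp
      obtain \<phi> \<tau> T where \<phi>: "solves ?Y UNIV \<phi>" "strict_mono \<tau>" "surj \<tau>"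
          "\<And>s. \<phi> (\<tau> s) = pt (x s) s" "0 < T" "\<And>t. \<phi> (t + T) = \<phi> t" "\<And>s. \<tau> (s + 2 * pi) = \<tau> s + T"
      proof (rule closed_curve_solution[of x "\<lambda>t. e * G b e (x t) t" "\<lambda>k. e * b k"])
        show "0 < wedge (pt (x t) t) (?Y (pt (x t) t))" for t by (rule wpos[OF radius(2)[OF xb(3)] rn])
        show "(radius (x t) t)\<^sup>2 / wedge (pt (x t) t) (?Y (pt (x t) t)) * (grad (pt (x t) t) \<bullet> ?Y (pt (x t) t)) = e * G b e (x t) t" for t
          using G_field[of "pt (x t) t" t e b] radius[OF xb(3)] pt_nonzero[OF xb(3)] norm_pt[OF xb(3)] by simp
      qed (use x xb that in blast)+
      define \<gamma> where "\<gamma> = range (\<lambda>t. pt (x t) t)"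
      have \<gamma>: "range \<phi> = \<gamma>"
      proof -
        have "range \<phi> = \<phi> ` range \<tau>" using \<phi>(3) by simp
        also have "\<dots> = \<gamma>" unfolding \<gamma>_def by (simp add: image_image \<phi>(4))
        finally show ?thesis .
      qed
      define U where "U = {z \<in> inside. \<bar>pot z - xs\<bar> < \<delta>}"
      have Uprop: "z \<in> inside" "pot z < b'" "pot z \<le> -1" "z \<noteq> 0" "\<bar>pot z - xs\<bar> < \<delta>" if "z \<in> U" for z
      proof -
        show "z \<in> inside" "\<bar>pot z - xs\<bar> < \<delta>" using that unfolding U_def by auto
        then show "pot z < b'" using \<delta>(4) by linarith
        then show "pot z \<le> -1" using ab(1) by linarith
        then show "z \<noteq> 0" by auto
      qed
      have "open U"
      proof -
        have "continuous_on inside (\<lambda>z. \<bar>pot z - xs\<bar>)" by (intro continuous_intros continuous_pot)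
        then have "open ((\<lambda>z. \<bar>pot z - xs\<bar>) -` {..<\<delta>} \<inter> inside)"
          using continuous_on_open_vimage[OF open_inside, of "\<lambda>z. \<bar>pot z - xs\<bar>"] open_lessThan[of \<delta>] by simp
        moreover have "U = (\<lambda>z. \<bar>pot z - xs\<bar>) -` {..<\<delta>} \<inter> inside" unfolding U_def by auto
        ultimately show ?thesis by simp
      qed
      have \<gamma>U: "\<gamma> \<subseteq> U"
        unfolding \<gamma>_def U_def using radius(2,3)[OF xb(3)] x(3) by auto
      have "limit_cycle ?Y \<gamma>"
        unfolding limit_cycle_def
      proof (intro conjI exI[of _ U] allI impI)
        show "periodic_orbit ?Y \<gamma>"
          unfolding periodic_orbit_def
        proof (intro exI[of _ \<phi>] exI[of _ T] conjI allI)
          have "\<phi> 0 \<in> \<gamma>" using \<gamma> by auto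
          then obtain t where t: "\<phi> 0 = pt (x t) t" unfolding \<gamma>_def by auto
          have "0 < wedge (\<phi> 0) (?Y (\<phi> 0))" unfolding t by (rule wpos[OF radius(2)[OF xb(3)] rn])
          then show "?Y (\<phi> 0) \<noteq> 0" by (auto simp: wedge_def)
        qed (use \<phi> \<gamma> in auto)
        show "open U" by fact
        show "\<gamma> \<subseteq> U" by fact
        fix \<gamma>' assume "periodic_orbit ?Y \<gamma>' \<and> \<gamma>' \<subseteq> U"
        then obtain \<psi> S where \<psi>: "0 < S" "solves ?Y UNIV \<psi>" "\<And>t. \<psi> (t + S) = \<psi> t" "\<gamma>' = range \<psi>" "range \<psi> \<subseteq> U"
          unfolding periodic_orbit_def by auto
        have \<psi>U: "\<psi> t \<in> U" for t using \<psi>(5) by auto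
        have d\<psi>: "(\<psi> has_vector_derivative ?Y (\<psi> t)) (at t)" for t using \<psi>(2) unfolding solves_def by simp
        have c\<psi>: "continuous_on UNIV \<psi>"
          by (meson continuous_at_imp_continuous_on d\<psi> has_vector_derivative_continuous)
        have cY: "continuous_on UNIV (\<lambda>t. ?Y (\<psi> t))" by (rule continuous_on_compose2[OF continuous_field c\<psi>]) auto
        obtain \<theta> where \<theta>: "\<And>t. (\<theta> has_real_derivative wedge (\<psi> t) (?Y (\<psi> t)) / (norm (\<psi> t))\<^sup>2) (at t)"
            "\<And>t. \<psi> t = norm (\<psi> t) *\<^sub>R ray (\<theta> t)"
          by (rule angle_lift[OF d\<psi> cY Uprop(4)[OF \<psi>U]]) (rule that)
        define y where "y t = pot (\<psi> t)" for t
        have pty: "pt (y t) (\<theta> t) = \<psi> t" for t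
          unfolding y_def by (rule pt_of_polar[OF Uprop(1)[OF \<psi>U] Uprop(4)[OF \<psi>U] \<theta>(2)])
        have yneg: "y t < 0" "y t \<le> - 1" for t using Uprop(3)[OF \<psi>U, of t] unfolding y_def by simp_all
        have rn\<psi>: "r0 \<le> norm (\<psi> t)" for t
          using norm_pt[OF yneg(1), of t "\<theta> t"] r0(2)[OF yneg(2), of t "\<theta> t"] pty by simp
        have w: "0 < wedge (\<psi> t) (?Y (\<psi> t))" for t by (rule wpos[OF Uprop(1)[OF \<psi>U] rn\<psi>])
        have nz: "0 < (norm (\<psi> t))\<^sup>2" for t using Uprop(4)[OF \<psi>U, of t] by simp
        have dy: "(y has_real_derivative wedge (\<psi> t) (?Y (\<psi> t)) / (norm (\<psi> t))\<^sup>2 * (e * G b e (y t) (\<theta> t))) (at t)" for t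
        proof -
          have "(y has_derivative (\<lambda>h. grad (\<psi> t) \<bullet> (h *\<^sub>R ?Y (\<psi> t)))) (at t)"
            unfolding y_def[abs_def]
            by (rule has_derivative_compose[OF d\<psi>[of t, unfolded has_vector_derivative_def] pot_derivative[OF Uprop(1)[OF \<psi>U]]])
          then have "(y has_real_derivative grad (\<psi> t) \<bullet> ?Y (\<psi> t)) (at t)"
            unfolding has_field_derivative_def by (simp add: mult_commute_abs)
          moreover have "e * G b e (y t) (\<theta> t) = (norm (\<psi> t))\<^sup>2 / wedge (\<psi> t) (?Y (\<psi> t)) * (grad (\<psi> t) \<bullet> ?Y (\<psi> t))"
            using G_field[OF Uprop(1)[OF \<psi>U] Uprop(4)[OF \<psi>U], of t "\<theta> t" e b] pty[of t] unfolding y_def by simp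
          ultimately show ?thesis using w[of t] nz[of t] by (simp add: field_simps)
        qed
        have \<psi>S: "\<psi> S = \<psi> 0" using \<psi>(3)[of 0] by simp
        then have "norm (\<psi> 0) *\<^sub>R ray (\<theta> S) = norm (\<psi> 0) *\<^sub>R ray (\<theta> 0)" using \<theta>(2)[of S] \<theta>(2)[of 0] by metis
        then have "ray (\<theta> S) = ray (\<theta> 0)" using Uprop(4)[OF \<psi>U, of 0] by simp
        then obtain k where k: "\<theta> S = \<theta> 0 + of_int k * (2 * pi)" by (rule ray_eq_imp)
        have "\<exists>t. y t = x (\<theta> t)"
        proof (rule uniq[OF e x \<theta>(1) _ dy _ \<psi>(1) k])
          show "0 < wedge (\<psi> t) (?Y (\<psi> t)) / (norm (\<psi> t))\<^sup>2" for t using w[of t] nz[of t] by simp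
          show "\<bar>y t - xs\<bar> < \<delta>" for t unfolding y_def by (rule Uprop(5)[OF \<psi>U])
          show "y S = y 0" unfolding y_def \<psi>S ..
        qed
        then obtain t where "y t = x (\<theta> t)" by blast
        then have "\<psi> t = \<phi> (\<tau> (\<theta> t))" using pty[of t] \<phi>(4)[of "\<theta> t"] by simp
        then have "range \<psi> = range \<phi>"
          using orbit_eq_range[OF locally_lipschitz_field \<psi>(2), of t] orbit_eq_range[OF locally_lipschitz_field \<phi>(1), of "\<tau> (\<theta> t)"] by simp
        then show "\<gamma>' = \<gamma>" using \<psi>(4) \<gamma> by simp
      qed
      then show "\<exists>x. (\<forall>t. \<bar>x t - xs\<bar> < \<delta> \<and> x t < b') \<and> limit_cycle ?Y (range (\<lambda>t. pt (x t) t))"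
        unfolding \<gamma>_def using x(3) xb(1) by blast
    qed
  qed (erule (1) der per)+
qed

end

section \<open>Melnikov functions near the polygon\<close>

text \<open>At \<open>s = t ^ (2 m + 2)\<close> and with coefficients of size \<open>t ^ (- k\<^sup>2 - 2 k)\<close>, the \<open>k\<close>-th term has size
  \<open>t ^ (m\<^sup>2 - (k - m)\<^sup>2)\<close>. So the term \<open>k = m\<close> dominates each other term by a factor of at least \<open>t\<close>, up to
  the constants in the bounds.\<close>

lemma alternating_combination:
  fixes f :: "nat \<Rightarrow> real \<Rightarrow> real"
  assumes f: "\<And>k. k \<le> n \<Longrightarrow> \<exists>c C. 0 < c \<and> (\<forall>s\<ge>1. c * s ^ k \<le> f k s \<and> f k s \<le> C * s ^ k)"
  obtains a p where "\<And>m. S < p m" "strict_mono p"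
    "\<And>m. m \<le> n \<Longrightarrow> 0 < (- 1) ^ m * (\<Sum>k\<le>n. a k * f k (p m))"
proof -
  obtain c C where cC: "\<And>k. k \<le> n \<Longrightarrow> 0 < c k"
      "\<And>k s. k \<le> n \<Longrightarrow> 1 \<le> s \<Longrightarrow> c k * s ^ k \<le> f k s \<and> f k s \<le> C k * s ^ k"
    using f by metis
  define c0 where "c0 = Min (c ` {..n})"
  define C0 where "C0 = (\<Sum>k\<le>n. \<bar>C k\<bar>)"
  have c0: "0 < c0" "\<And>k. k \<le> n \<Longrightarrow> c0 \<le> c k" unfolding c0_def using cC(1) by auto
  have C0: "0 \<le> C0" "\<And>k. k \<le> n \<Longrightarrow> C k \<le> C0"
  proof -
    show "0 \<le> C0" unfolding C0_def by (simp add: sum_nonneg)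
    fix k assume "k \<le> n"
    then have "\<bar>C k\<bar> \<le> C0" unfolding C0_def by (intro member_le_sum) auto
    then show "C k \<le> C0" by simp
  qed
  \<comment> \<open>The last summand makes \<open>t * c0\<close> larger than \<open>n + 1\<close> times \<open>C0\<close>, which outweighs all remaining terms together.\<close>
  define t where "t = 2 + \<bar>S\<bar> + (real n + 1) * C0 / c0"
  have q0: "0 \<le> (real n + 1) * C0 / c0" using c0 C0 by simp
  have t: "1 < t" "S < t" "(real n + 1) * C0 < t * c0"
  proof -
    show "1 < t" "S < t" using q0 unfolding t_def by linarith+
    have "(real n + 1) * C0 / c0 < t" unfolding t_def by linarith
    then show "(real n + 1) * C0 < t * c0" using c0(1) by (simp add: pos_divide_less_eq)
  qed
  have tp: "0 < t ^ j" for j using t by simp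
  define p where "p m = t ^ (2 * m + 2)" for m :: nat
  define a where "a k = (- 1) ^ k / t ^ (k * k + 2 * k)" for k :: nat
  have p1: "1 \<le> p m" for m unfolding p_def by (rule one_le_power) (use t in simp)
  have pk: "p m ^ k / t ^ (k * k + 2 * k) = t ^ (2 * m * k) / t ^ (k * k)" for m k
  proof -
    have "p m ^ k = t ^ (2 * m * k) * t ^ (2 * k)" unfolding p_def by (simp add: power_mult[symmetric] power_add[symmetric] algebra_simps)
    moreover have "t ^ (k * k + 2 * k) = t ^ (k * k) * t ^ (2 * k)" by (simp add: power_add)
    ultimately show ?thesis using tp[of "2 * k"] by simp
  qed
  show ?thesis
  proof
    show "S < p m" for m
    proof -
      have "t ^ 1 \<le> p m" unfolding p_def using t by (intro power_increasing) auto
      then show ?thesis using t by simp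
    qed
    show "strict_mono p" unfolding p_def strict_mono_def using t by (auto intro!: power_strict_increasing)
    fix m assume m: "m \<le> n"
    have upper: "\<bar>a k * f k (p m)\<bar> \<le> C0 * t ^ (m * m) / t" if k: "k \<le> n" "k \<noteq> m" for k
    proof -
      have "0 < f k (p m)" using cC(2)[OF k(1) p1[of m]] cC(1)[OF k(1)] p1[of m]
        by (smt (verit) mult_pos_pos zero_less_power)
      then have "\<bar>a k * f k (p m)\<bar> = f k (p m) / t ^ (k * k + 2 * k)"
        unfolding a_def using t by (simp add: abs_mult power_abs)
      also have "\<dots> \<le> C0 * p m ^ k / t ^ (k * k + 2 * k)"
      proof (rule divide_right_mono)
        have "f k (p m) \<le> C k * p m ^ k" using cC(2)[OF k(1) p1[of m]] by simp
        also have "\<dots> \<le> C0 * p m ^ k" using C0(2)[OF k(1)] p1[of m] by (intro mult_right_mono) auto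
        finally show "f k (p m) \<le> C0 * p m ^ k" .
      qed (use tp in \<open>simp add: less_imp_le\<close>)
      also have "\<dots> = C0 * (t ^ (2 * m * k) / t ^ (k * k))" by (simp only: pk[symmetric] times_divide_eq_right)
      also have "\<dots> \<le> C0 * (t ^ (m * m) / t)"
      proof (intro mult_left_mono C0(1))
        have "2 * m * k + 1 \<le> m * m + k * k"
        proof (cases "k < m")
          case True
          then obtain d where "m = k + Suc d" using less_iff_Suc_add by auto
          then show ?thesis by (simp add: algebra_simps)
        next
          case False
          then have "m < k" using k by simp
          then obtain d where "k = m + Suc d" using less_iff_Suc_add by auto
          then show ?thesis by (simp add: algebra_simps)
        qed
        then have "t ^ (2 * m * k + 1) \<le> t ^ (m * m + k * k)" using t by (intro power_increasing) auto
        then have "t ^ (2 * m * k) * t \<le> t ^ (m * m) * t ^ (k * k)" by (simp add: power_add mult.commute)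
        then show "t ^ (2 * m * k) / t ^ (k * k) \<le> t ^ (m * m) / t" using tp[of "k * k"] t by (simp add: field_simps)
      qed
      finally show ?thesis by simp
    qed
    have main: "c0 * t ^ (m * m) \<le> (- 1) ^ m * (a m * f m (p m))"
    proof -
      have "(- 1) ^ m * (a m * f m (p m)) = f m (p m) / t ^ (m * m + 2 * m)"
      proof -
        have "(- 1 :: real) ^ m * (- 1) ^ m = 1" by (simp add: power_add[symmetric] mult_2[symmetric])
        then show ?thesis unfolding a_def by (simp add: mult.assoc[symmetric])
      qed
      moreover have "c0 * p m ^ m / t ^ (m * m + 2 * m) \<le> f m (p m) / t ^ (m * m + 2 * m)"
      proof (rule divide_right_mono)
        have "c0 * p m ^ m \<le> c m * p m ^ m" using c0(2)[OF m] p1[of m] by (intro mult_right_mono) auto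
        then show "c0 * p m ^ m \<le> f m (p m)" using cC(2)[OF m p1[of m]] by linarith
      qed (use tp in \<open>simp add: less_imp_le\<close>)
      moreover have "c0 * p m ^ m / t ^ (m * m + 2 * m) = c0 * t ^ (m * m)"
      proof -
        have "t ^ (2 * m * m) = t ^ (m * m) * t ^ (m * m)" by (simp add: power_add[symmetric] mult_2[symmetric] algebra_simps)
        then have "p m ^ m / t ^ (m * m + 2 * m) = t ^ (m * m)" unfolding pk using tp[of "m * m"] by simp
        then show ?thesis by (simp only: times_divide_eq_right[symmetric])
      qed
      ultimately show ?thesis by simp
    qed
    have "(\<Sum>k\<le>n. a k * f k (p m)) = a m * f m (p m) + (\<Sum>k\<in>{..n} - {m}. a k * f k (p m))"
      using m by (subst sum.remove[of _ m]) auto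
    then have "(- 1) ^ m * (\<Sum>k\<le>n. a k * f k (p m)) =
        (- 1) ^ m * (a m * f m (p m)) + (- 1) ^ m * (\<Sum>k\<in>{..n} - {m}. a k * f k (p m))"
      by (simp add: algebra_simps)
    moreover have "\<bar>(- 1) ^ m * (\<Sum>k\<in>{..n} - {m}. a k * f k (p m))\<bar> < c0 * t ^ (m * m)"
    proof -
      have "\<bar>(- 1) ^ m * (\<Sum>k\<in>{..n} - {m}. a k * f k (p m))\<bar> = \<bar>\<Sum>k\<in>{..n} - {m}. a k * f k (p m)\<bar>"
        by (simp add: abs_mult power_abs)
      also have "\<dots> \<le> (\<Sum>k\<in>{..n} - {m}. \<bar>a k * f k (p m)\<bar>)" by (rule sum_abs)
      also have "\<dots> \<le> (\<Sum>k\<in>{..n} - {m}. C0 * t ^ (m * m) / t)" by (intro sum_mono upper) auto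
      also have "\<dots> \<le> (real n + 1) * (C0 * t ^ (m * m) / t)"
      proof -
        have "real n * y \<le> (real n + 1) * y" if "0 \<le> y" for y :: real using that by (simp add: mult_right_mono)
        from this[of "C0 * t ^ (m * m) / t"]
        have "real n * (C0 * t ^ (m * m) / t) \<le> (real n + 1) * (C0 * t ^ (m * m) / t)" using C0(1) t by simp
        moreover have "card ({..n} - {m}) = n" using m by simp
        ultimately show ?thesis by (simp only: sum_constant)
      qed
      also have "\<dots> = (real n + 1) * C0 * (t ^ (m * m) / t)" by simp
      also have "\<dots> < t * c0 * (t ^ (m * m) / t)" using t tp[of "m * m"] by (intro mult_strict_right_mono) auto
      also have "\<dots> = c0 * t ^ (m * m)" using t by simp
      finally show ?thesis .
    qed
    ultimately show "0 < (- 1) ^ m * (\<Sum>k\<le>n. a k * f k (p m))" using main by linarith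
  qed
qed

text \<open>Sard's theorem in dimension one.\<close>

lemma regular_value_exists:
  fixes f f' :: "real \<Rightarrow> real"
  assumes f: "\<And>x. x \<in> S \<Longrightarrow> (f has_real_derivative f' x) (at x within S)" and "0 < \<eta>"
  obtains c where "0 < c" "c < \<eta>" "\<And>x. x \<in> S \<Longrightarrow> f x = c \<Longrightarrow> f' x \<noteq> 0"
proof (rule ccontr)
  note found = that
  assume nt: "\<not> thesis"
  have crit: "\<exists>x\<in>S. f x = c \<and> f' x = 0" if c: "0 < c" "c < \<eta>" for c
  proof (rule ccontr)
    assume "\<not> ?thesis"
    then have "\<And>x. x \<in> S \<Longrightarrow> f x = c \<Longrightarrow> f' x \<noteq> 0" by blast
    from found[OF c this] have thesis .
    with nt show False by contradiction
  qed
  let ?F = "\<lambda>v::real^1. vec (f (v $ 1)) :: real^1"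
  define Z :: "(real^1) set" where "Z = {v. v $ 1 \<in> S \<and> f' (v $ 1) = 0}"
  have "negligible (?F ` Z)"
  proof (rule baby_Sard[where f' = "\<lambda>_ _. 0"])
    fix v assume v: "v \<in> Z"
    have "((\<lambda>v. v $ 1) has_derivative (\<lambda>h. h $ 1)) (at v within Z)"
      by (rule bounded_linear_imp_has_derivative) (rule bounded_linear_vec_nth)
    moreover have "(f has_derivative (\<lambda>h. 0)) (at (v $ 1) within (\<lambda>v. v $ 1) ` Z)"
    proof -
      have "v $ 1 \<in> S" using v unfolding Z_def by simp
      then have "(f has_real_derivative f' (v $ 1)) (at (v $ 1) within S)" by (rule f)
      then have "(f has_derivative (\<lambda>h. f' (v $ 1) * h)) (at (v $ 1) within (\<lambda>v. v $ 1) ` Z)"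
        unfolding has_field_derivative_def by (rule has_derivative_subset) (auto simp: Z_def)
      then show ?thesis using v unfolding Z_def by simp
    qed
    ultimately have "((\<lambda>v. f (v $ 1)) has_derivative (\<lambda>h. 0)) (at v within Z)"
      using has_derivative_in_compose[of "\<lambda>v. v $ 1" _ v Z f "\<lambda>_. 0"] by simp
    moreover have "bounded_linear (vec :: real \<Rightarrow> real^1)"
      by (rule bounded_linear_intro[where K = 1]) (simp_all add: vec_eq_iff norm_vec_def L2_set_def)
    ultimately show "(?F has_derivative (\<lambda>_. 0)) (at v within Z)"
      using bounded_linear.has_derivative[of "vec :: real \<Rightarrow> real^1" "\<lambda>v. f (v $ 1)" "\<lambda>h. 0"] by simp
    show "rank (matrix (\<lambda>_::real^1. 0 :: real^1)) < CARD(1)"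
      by (simp add: matrix_def rank_0 flip: zero_vec_def)
  qed simp
  moreover have "box (vec 0) (vec \<eta>) \<subseteq> ?F ` Z"
  proof
    fix y :: "real^1" assume "y \<in> box (vec 0) (vec \<eta>)"
    then have "0 < y $ 1" "y $ 1 < \<eta>" by (auto simp: mem_box_cart)
    then obtain x where "x \<in> S" "f x = y $ 1" "f' x = 0" using crit by blast
    then show "y \<in> ?F ` Z" unfolding Z_def by (intro image_eqI[of _ _ "vec x"]) (auto simp: vec_eq_iff)
  qed
  ultimately have "negligible (box (vec 0) (vec \<eta>) :: (real^1) set)" using negligible_subset by blast
  moreover have "(box (vec 0) (vec \<eta>) :: (real^1) set) \<noteq> {}"
    using \<open>0 < \<eta>\<close> by (simp add: interval_ne_empty_cart)
  ultimately show False using open_not_negligible open_box by blast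
qed

lemma C1_strip_integral:
  assumes f: "C1_strip E a b f f'" and E: "0 \<le> E" and x: "x \<in> {a..b}"
  shows "((\<lambda>x. integral {0..2 * pi} (f 0 x)) has_real_derivative integral {0..2 * pi} (f' 0 x)) (at x within {a..b})"
    and "f 0 x integrable_on {0..2 * pi}" and "f' 0 x integrable_on {0..2 * pi}"
proof -
  have E0: "0 \<in> {0..E}" using E by simp
  have c: "continuous_on ({a..b} \<times> UNIV) (\<lambda>(x, t). g 0 x t)"
    if "continuous_on ({0..E} \<times> {a..b} \<times> UNIV) (\<lambda>(e, x, t). g e x t)" for g :: "real \<Rightarrow> real \<Rightarrow> real \<Rightarrow> real"
  proof -
    have "continuous_on ({a..b} \<times> UNIV) (\<lambda>p. (\<lambda>(e, x, t). g e x t) (0, fst p, snd p))"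
      by (rule continuous_on_compose2[OF that]) (use E in \<open>auto intro!: continuous_intros\<close>)
    then show ?thesis by (simp add: split_beta)
  qed
  have cf: "continuous_on ({a..b} \<times> UNIV) (\<lambda>(x, t). f 0 x t)" "continuous_on ({a..b} \<times> UNIV) (\<lambda>(x, t). f' 0 x t)"
    using f c[of f] c[of f'] unfolding C1_strip_def by blast+
  have int: "g 0 x integrable_on {0..2 * pi}"
    if "continuous_on ({a..b} \<times> UNIV) (\<lambda>(x, t). g 0 x t)" "x \<in> {a..b}" for g :: "real \<Rightarrow> real \<Rightarrow> real \<Rightarrow> real" and x
  proof (rule integrable_continuous_real)
    have "continuous_on {0..2 * pi} (\<lambda>t. (\<lambda>(x, t). g 0 x t) (x, t))"
      by (rule continuous_on_compose2[OF that(1)]) (use that(2) in \<open>auto intro!: continuous_intros\<close>)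
    then show "continuous_on {0..2 * pi} (g 0 x)" by simp
  qed
  show "f 0 x integrable_on {0..2 * pi}" "f' 0 x integrable_on {0..2 * pi}" using int cf x by blast+
  have "((\<lambda>x. integral (cbox 0 (2 * pi)) (f 0 x)) has_real_derivative integral (cbox 0 (2 * pi)) (f' 0 x)) (at x within {a..b})"
  proof (rule leibniz_rule_field_derivative)
    show "((\<lambda>x. f 0 x t) has_real_derivative f' 0 x t) (at x within {a..b})" if "x \<in> {a..b}" for x t
      using f that E0 unfolding C1_strip_def by blast
    show "f 0 x integrable_on cbox 0 (2 * pi)" if "x \<in> {a..b}" for x using int cf that by simp
    show "continuous_on ({a..b} \<times> cbox 0 (2 * pi)) (\<lambda>(x, t). f' 0 x t)"
      by (rule continuous_on_subset[OF cf(2)]) auto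
  qed (use x in auto)
  then show "((\<lambda>x. integral {0..2 * pi} (f 0 x)) has_real_derivative integral {0..2 * pi} (f' 0 x)) (at x within {a..b})"
    by simp
qed

text \<open>These weights make the orders of growth of the Melnikov functions consecutive powers of \<open>exp (- x)\<close>.\<close>

locale polygon_exponents = polygon_melnikov +
  assumes lam_val: "\<And>j. j < n \<Longrightarrow> lam j = 1 / (real j + 1)"
begin

text \<open>The coefficients of the linear form \<open>b \<mapsto> G b 0 x t\<close>.\<close>

definition melnikov_kernel :: "nat \<Rightarrow> real \<Rightarrow> real \<Rightarrow> real" where
  "melnikov_kernel k x t = (if k = 0 then (radius x t)\<^sup>2 * fst (grad (pt x t)) / ((fst (pt x t) + c) * decay (pt x t))
     else - ((radius x t)\<^sup>2 / ((fst (pt x t) + c) * side (k - 1) (pt x t))))"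

definition melnikov :: "nat \<Rightarrow> real \<Rightarrow> real" where
  "melnikov k x = integral {0..2 * pi} (melnikov_kernel k x)"

lemma C1_melnikov_kernel:
  assumes "b' < 0" shows "C1 E a b' (\<lambda>e x t. melnikov_kernel k x t)"
proof -
  have nz: "side j (pt x t) \<noteq> 0" "fst (pt x t) + c \<noteq> 0" "decay (pt x t) \<noteq> 0" if "x \<in> {a..b'}" for j x t
  proof -
    have x: "x < 0" using that assms by simp
    show "side j (pt x t) \<noteq> 0" using side_pos_inside[OF radius(2)[OF x], of j t] by simp
    show "fst (pt x t) + c \<noteq> 0" using D_bounds(2)[OF radius(2)[OF x], of t] by simp
    show "decay (pt x t) \<noteq> 0" using decay_pos[OF radius(2)[OF x] pt_nonzero[OF x], of t] by simp
  qed
  show ?thesis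
  proof (cases "k = 0")
    case True
    then show ?thesis unfolding melnikov_kernel_def
      by (simp only: True simp_thms if_True) (intro C1_divide C1_mult C1_power2 C1_add C1_const C1_pt[OF assms]; simp add: nz)
  next
    case False
    then show ?thesis unfolding melnikov_kernel_def
      by (simp only: False simp_thms if_False) (intro C1_minus C1_divide C1_mult C1_power2 C1_add C1_const C1_pt[OF assms]; simp add: nz)
  qed
qed

lemma melnikov_props:
  assumes "b' < 0" "x \<in> {a..b'}"
  shows "\<exists>d. (melnikov k has_real_derivative d) (at x within {a..b'})" "melnikov_kernel k x integrable_on {0..2 * pi}"
proof -
  obtain f' where "C1_strip 0 a b' (\<lambda>e x t. melnikov_kernel k x t) f'" using C1_melnikov_kernel[OF assms(1)] unfolding C1_def by blast
  from C1_strip_integral[OF this _ assms(2)]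
  show "\<exists>d. (melnikov k has_real_derivative d) (at x within {a..b'})" "melnikov_kernel k x integrable_on {0..2 * pi}"
    unfolding melnikov_def[abs_def] by auto
qed

lemma melnikov_kernel_integrable: "x < 0 \<Longrightarrow> melnikov_kernel k x integrable_on {0..2 * pi}"
  using melnikov_props(2)[of x x x k] by simp

lemma G_melnikov_kernel:
  assumes "x < 0" shows "G b 0 x t = (\<Sum>k\<le>n. b k * melnikov_kernel k x t)"
proof -
  define D d r where "D = fst (pt x t) + c" and "d = decay (pt x t)" and "r = radius x t"
  have D: "D \<noteq> 0" unfolding D_def using D_bounds(2)[OF radius(2)[OF assms], of t] by simp
  have d: "d \<noteq> 0" unfolding d_def using decay_pos[OF radius(2)[OF assms] pt_nonzero[OF assms], of t] by simp
  have "(\<Sum>k\<le>n. b k * melnikov_kernel k x t) = b 0 * melnikov_kernel 0 x t + (\<Sum>i<n. b (Suc i) * melnikov_kernel (Suc i) x t)"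
    unfolding lessThan_Suc_atMost[symmetric] by (subst sum.lessThan_Suc_shift) simp
  also have "(\<Sum>i<n. b (Suc i) * melnikov_kernel (Suc i) x t) = - (r\<^sup>2 / D) * (\<Sum>i<n. b (Suc i) / side i (pt x t))"
    unfolding sum_distrib_left by (rule sum.cong) (simp_all add: melnikov_kernel_def D_def r_def)
  also have "b 0 * melnikov_kernel 0 x t + - (r\<^sup>2 / D) * (\<Sum>i<n. b (Suc i) / side i (pt x t)) = G b 0 x t"
    unfolding G_def melnikov_kernel_def D_def[symmetric] d_def[symmetric] r_def[symmetric] using D d
    by (simp add: field_simps)
  finally show ?thesis by simp
qed

lemma G_has_integral:
  assumes "x < 0" shows "(G b 0 x has_integral (\<Sum>k\<le>n. b k * melnikov k x)) {0..2 * pi}"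
proof -
  have "((\<lambda>t. \<Sum>k\<le>n. b k * melnikov_kernel k x t) has_integral (\<Sum>k\<le>n. b k * melnikov k x)) {0..2 * pi}"
    unfolding melnikov_def
    by (intro has_integral_sum has_integral_mult_right integrable_integral melnikov_kernel_integrable assms) simp
  moreover have "G b 0 x = (\<lambda>t. \<Sum>k\<le>n. b k * melnikov_kernel k x t)" using G_melnikov_kernel[OF assms] by auto
  ultimately show ?thesis by simp
qed

lemma radius_le_B: "x < 0 \<Longrightarrow> radius x t \<le> B"
  using norm_inside[OF radius(2), of x t] norm_pt[of x t] by simp

lemma lam_inverse: "i < n \<Longrightarrow> y / lam i = (real i + 1) * y" by (simp add: lam_val)

text \<open>The upper bound holds because the side is at least of order \<open>exp (x / lam i)\<close> on the whole oval. For the lower bound, in a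
  sector of directions that hit the interior of the edge on side \<open>i\<close>, all other sides stay away from zero, so that side is
  also at most of this order.\<close>

lemma melnikov_Suc_bounds:
  assumes i: "i < n"
  shows "\<exists>k K. 0 < k \<and> (\<forall>x\<le>-1. k * exp (- (real i + 1) * x) \<le> - melnikov (Suc i) x \<and>
      - melnikov (Suc i) x \<le> K * exp (- (real i + 1) * x))"
proof -
  obtain C where C: "\<And>z i. z \<in> inside \<Longrightarrow> i < n \<Longrightarrow> pot z \<le> lam i * ln (side i z) + C"
    by (rule pot_upper_bound) (rule that)
  define h where "h x t = (radius x t)\<^sup>2 / ((fst (pt x t) + c) * side i (pt x t))" for x t
  have hint: "(h x has_integral - melnikov (Suc i) x) {0..2 * pi}" if "x < 0" for x
  proof -
    have "h x = (\<lambda>t. - melnikov_kernel (Suc i) x t)" unfolding h_def melnikov_kernel_def by auto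
    moreover have "((\<lambda>t. - melnikov_kernel (Suc i) x t) has_integral - melnikov (Suc i) x) {0..2 * pi}"
      unfolding melnikov_def by (intro has_integral_neg integrable_integral melnikov_kernel_integrable that)
    ultimately show ?thesis by simp
  qed
  have hpos: "0 \<le> h x t" if "x < 0" for x t
    unfolding h_def using side_pos_inside[OF radius(2)[OF that], of i t] D_bounds(2)[OF radius(2)[OF that], of t] by simp
  have upper: "h x t \<le> B\<^sup>2 * exp ((real i + 1) * C) * exp (- (real i + 1) * x)" if x: "x \<le> - 1" for x t
  proof -
    have neg: "x < 0" using x by simp
    define z where "z = pt x t"
    have z: "z \<in> inside" "pot z = x" unfolding z_def using radius[OF neg] by auto
    have s: "0 < side i z" by (rule side_pos_inside[OF z(1)])
    have "x - C \<le> lam i * ln (side i z)" using C[OF z(1) i] z(2) by simp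
    then have "(x - C) / lam i \<le> ln (side i z)" using lam_pos[of i] by (simp add: field_simps)
    then have "- ln (side i z) \<le> (real i + 1) * C + - (real i + 1) * x"
      unfolding lam_inverse[OF i] by (simp add: algebra_simps)
    then have "exp (- ln (side i z)) \<le> exp ((real i + 1) * C) * exp (- (real i + 1) * x)"
      unfolding exp_add[symmetric] by simp
    then have s': "1 / side i z \<le> exp ((real i + 1) * C) * exp (- (real i + 1) * x)"
      using s by (simp add: exp_minus inverse_eq_divide)
    have "h x t = (radius x t)\<^sup>2 * (1 / (fst z + c)) * (1 / side i z)" unfolding h_def z_def by simp
    also have "\<dots> \<le> B\<^sup>2 * 1 * (exp ((real i + 1) * C) * exp (- (real i + 1) * x))"
      using radius_le_B[OF neg, of t] radius(1)[OF neg, of t] D_bounds(2)[OF z(1)] s s'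
      by (intro mult_mono power_mono) auto
    finally show ?thesis by simp
  qed
  obtain t0 where t0: "0 \<le> t0" "t0 < 2 * pi" and dir: "\<And>k. k < n \<Longrightarrow> k \<noteq> i \<Longrightarrow> - (u k \<bullet> ray t0) < - (u i \<bullet> ray t0)"
  proof -
    define w where "w = edge_point (i + (n - 1)) (1/2)"
    have Si: "Suc (i + (n - 1)) = i + n" using n_pos by simp
    have wi: "u i \<bullet> w = - 1"
      using side_edge_point_simps(1)[of "i + (n - 1)" "1/2"] u_per[of i] unfolding Si w_def[symmetric] side_def by simp
    have wk: "- 1 < u k \<bullet> w" if "k < n" "k \<noteq> i" for k
    proof -
      have "k mod n \<noteq> Suc (i + (n - 1)) mod n" unfolding Si using that i by simp
      then show ?thesis using side_edge_point_pos[of "1/2" k "i + (n - 1)"] unfolding w_def[symmetric] side_def by simp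
    qed
    obtain t0 where t: "0 \<le> t0" "t0 < 2 * pi" "w = norm w *\<^sub>R ray t0" by (rule polar_form)
    have "w \<noteq> 0" using wi by auto
    have "- (u k \<bullet> ray t0) < - (u i \<bullet> ray t0)" if k: "k < n" "k \<noteq> i" for k
    proof -
      have "u i \<bullet> w < u k \<bullet> w" using wi wk[OF k] by simp
      then have "norm w * (u i \<bullet> ray t0) < norm w * (u k \<bullet> ray t0)" using t(3) by (metis inner_scaleR_right)
      then show ?thesis using \<open>w \<noteq> 0\<close> by simp
    qed
    then show ?thesis using that t by blast
  qed
  have ray_cont: "continuous_on A (\<lambda>t. u k \<bullet> ray t)" for A k
    unfolding ray_def by (intro continuous_intros)
  have pos0: "0 < - (u i \<bullet> ray t0)"
  proof -
    obtain j where j: "j < n" "gauge (ray t0) = - (u j \<bullet> ray t0)" by (rule gauge_attained)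
    then show ?thesis using ray_gauge_pos[of t0] dir[of j] by (cases "j = i") auto
  qed
  have "\<forall>\<^sub>F m in at_right 0. \<forall>k\<in>{..<n} - {i}. - (u k \<bullet> ray t0) < (1 - m) * - (u i \<bullet> ray t0)"
  proof (intro eventually_ball_finite ballI)
    fix k assume k: "k \<in> {..<n} - {i}"
    have "((\<lambda>m. (1 - m) * - (u i \<bullet> ray t0)) \<longlongrightarrow> (1 - 0) * - (u i \<bullet> ray t0)) (at_right 0)" by (intro tendsto_intros)
    then show "\<forall>\<^sub>F m in at_right 0. - (u k \<bullet> ray t0) < (1 - m) * - (u i \<bullet> ray t0)"
      using dir[of k] k by (intro order_tendstoD) auto
  qed simp
  moreover have "\<forall>\<^sub>F m :: real in at_right 0. 0 < m \<and> m < 1" using eventually_at_right_real[of 0 1] by simp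
  ultimately have "\<forall>\<^sub>F m in at_right 0. (0 < m \<and> m < 1) \<and> (\<forall>k\<in>{..<n} - {i}. - (u k \<bullet> ray t0) < (1 - m) * - (u i \<bullet> ray t0))"
    by (simp add: eventually_conj_iff)
  then have "\<exists>m. (0 < m \<and> m < 1) \<and> (\<forall>k\<in>{..<n} - {i}. - (u k \<bullet> ray t0) < (1 - m) * - (u i \<bullet> ray t0))"
    by (rule eventually_happens'[OF trivial_limit_at_right_real])
  then obtain m :: real where m: "0 < m" "m < 1" "\<forall>k\<in>{..<n} - {i}. - (u k \<bullet> ray t0) < (1 - m) * - (u i \<bullet> ray t0)"
    by blast
  have "\<forall>\<^sub>F t in at_right t0. (\<forall>k\<in>{..<n} - {i}. - (u k \<bullet> ray t) < (1 - m) * - (u i \<bullet> ray t))"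
  proof (intro eventually_ball_finite ballI)
    fix k assume k: "k \<in> {..<n} - {i}"
    have cc: "((\<lambda>t. u j \<bullet> ray t) \<longlongrightarrow> u j \<bullet> ray t0) (at_right t0)" for j
    proof (rule tendsto_mono[OF at_le[OF subset_UNIV]])
      show "((\<lambda>t. u j \<bullet> ray t) \<longlongrightarrow> u j \<bullet> ray t0) (at t0)"
        using ray_cont[of UNIV j] by (simp add: continuous_on_def)
    qed
    have "((\<lambda>t. (1 - m) * - (u i \<bullet> ray t) - - (u k \<bullet> ray t)) \<longlongrightarrow> (1 - m) * - (u i \<bullet> ray t0) - - (u k \<bullet> ray t0)) (at_right t0)"
      by (intro tendsto_intros cc)
    then have "\<forall>\<^sub>F t in at_right t0. 0 < (1 - m) * - (u i \<bullet> ray t) - - (u k \<bullet> ray t)"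
      using m(3) k by (intro order_tendstoD) auto
    then show "\<forall>\<^sub>F t in at_right t0. - (u k \<bullet> ray t) < (1 - m) * - (u i \<bullet> ray t)" by eventually_elim simp
  qed simp
  then obtain \<eta> where \<eta>: "t0 < \<eta>" "\<And>t k. t0 < t \<Longrightarrow> t < \<eta> \<Longrightarrow> k \<in> {..<n} - {i} \<Longrightarrow> - (u k \<bullet> ray t) < (1 - m) * - (u i \<bullet> ray t)"
    unfolding eventually_at_right_field by blast
  \<comment> \<open>A closed subinterval of the sector that starts at \<open>t0\<close> and of \<open>{0..2 * pi}\<close>.\<close>
  define t1 where "t1 = (2 * t0 + min \<eta> (2 * pi)) / 3"
  define t2 where "t2 = (t0 + 2 * min \<eta> (2 * pi)) / 3"
  have t12: "t0 < t1" "t1 < t2" "t2 < \<eta>" "t2 < 2 * pi" "0 \<le> t1"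
    using \<eta>(1) t0 unfolding t1_def t2_def by (auto simp: min_def)
  have lower: "r0\<^sup>2 / (c + B) * exp ((real i + 1) * (lam_total * ln m)) * exp (- (real i + 1) * x) \<le> h x t"
    if x: "x \<le> - 1" and t: "t \<in> {t1..t2}" for x t
  proof -
    have neg: "x < 0" using x by simp
    define z where "z = pt x t"
    have z: "z \<in> inside" "pot z = x" unfolding z_def using radius[OF neg] by auto
    have s: "0 < side j z" for j by (rule side_pos_inside[OF z(1)])
    have big: "m \<le> side k z" if k: "k \<in> {..<n} - {i}" for k
    proof -
      have r: "0 < radius x t" by (rule radius(1)[OF neg])
      have uz: "u j \<bullet> z = radius x t * (u j \<bullet> ray t)" for j unfolding z_def pt_def by simp
      have "- (u k \<bullet> ray t) < (1 - m) * - (u i \<bullet> ray t)" using \<eta>(2)[of t k] t t12 k by auto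
      from mult_strict_left_mono[OF this r]
      have "- (u k \<bullet> z) < (1 - m) * - (u i \<bullet> z)" unfolding uz by (simp add: algebra_simps)
      also have "\<dots> \<le> (1 - m) * 1" using s[of i] m(2) by (intro mult_left_mono) (auto simp: side_def)
      finally show ?thesis by (simp add: side_def)
    qed
    have "x = lam i * ln (side i z) + (\<Sum>k\<in>{..<n} - {i}. lam k * ln (side k z))"
      unfolding z(2)[symmetric] pot_def using i by (subst sum.remove[of _ i]) auto
    moreover have "(\<Sum>k\<in>{..<n} - {i}. lam k * ln m) \<le> (\<Sum>k\<in>{..<n} - {i}. lam k * ln (side k z))"
      using big m(1) lam_pos by (intro sum_mono mult_left_mono ln_mono) (auto simp: less_imp_le)
    moreover have "lam_total * ln m \<le> (\<Sum>k\<in>{..<n} - {i}. lam k * ln m)"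
    proof -
      have "(\<Sum>k\<in>{..<n} - {i}. lam k) \<le> lam_total"
        unfolding lam_total_def using lam_pos by (intro sum_mono2) (auto simp: less_imp_le)
      moreover have "ln m \<le> 0" using m by simp
      ultimately have "lam_total * ln m \<le> (\<Sum>k\<in>{..<n} - {i}. lam k) * ln m" by (intro mult_right_mono_neg)
      then show ?thesis by (simp add: sum_distrib_right)
    qed
    ultimately have "lam i * ln (side i z) \<le> x - lam_total * ln m" by linarith
    then have "ln (side i z) \<le> (x - lam_total * ln m) / lam i" using lam_pos[of i] by (simp add: field_simps)
    then have "(real i + 1) * (lam_total * ln m) + - (real i + 1) * x \<le> - ln (side i z)"
      unfolding lam_inverse[OF i] by (simp add: algebra_simps)
    then have "exp ((real i + 1) * (lam_total * ln m)) * exp (- (real i + 1) * x) \<le> exp (- ln (side i z))"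
      unfolding exp_add[symmetric] by simp
    then have s': "exp ((real i + 1) * (lam_total * ln m)) * exp (- (real i + 1) * x) \<le> 1 / side i z"
      using s[of i] by (simp add: exp_minus inverse_eq_divide)
    have D: "0 < fst z + c" "fst z + c \<le> c + B" using D_bounds[OF z(1)] by auto
    have "r0\<^sup>2 * (1 / (c + B)) * (exp ((real i + 1) * (lam_total * ln m)) * exp (- (real i + 1) * x)) \<le>
        (radius x t)\<^sup>2 * (1 / (fst z + c)) * (1 / side i z)"
      using r0(1) r0(2)[OF x, of t] D s' by (intro mult_mono power_mono frac_le) auto
    then show ?thesis unfolding h_def z_def by simp
  qed
  define kk where "kk = (t2 - t1) * (r0\<^sup>2 / (c + B) * exp ((real i + 1) * (lam_total * ln m)))"
  have cB: "0 < c + B" using c_B B(1) by simp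
  show ?thesis
  proof (intro exI conjI allI impI)
    show "0 < kk" unfolding kk_def using t12 r0(1) cB by simp
    fix x :: real assume x: "x \<le> - 1"
    then have neg: "x < 0" by simp
    let ?l = "r0\<^sup>2 / (c + B) * exp ((real i + 1) * (lam_total * ln m)) * exp (- (real i + 1) * x)"
    have sub: "{t1..t2} \<subseteq> {0..2 * pi}" using t12 by auto
    have hi: "h x integrable_on {0..2 * pi}" using hint[OF neg] by blast
    then have hi2: "h x integrable_on {t1..t2}" using integrable_on_subinterval sub by blast
    have "?l * (t2 - t1) \<le> integral {t1..t2} (h x)"
    proof (rule has_integral_le)
      show "((\<lambda>_. ?l) has_integral ?l * (t2 - t1)) {t1..t2}"
        using has_integral_const_real[of ?l t1 t2] t12 by (simp add: mult.commute)
      show "(h x has_integral integral {t1..t2} (h x)) {t1..t2}" using hi2 by (rule integrable_integral)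
    qed (rule lower[OF x])
    also have "\<dots> \<le> integral {0..2 * pi} (h x)"
      by (rule integral_subset_le[OF sub hi2 hi]) (use hpos[OF neg] in blast)
    also have "\<dots> = - melnikov (Suc i) x" using hint[OF neg] by (rule integral_unique)
    finally show "kk * exp (- (real i + 1) * x) \<le> - melnikov (Suc i) x" unfolding kk_def by (simp add: mult_ac)
    let ?u = "B\<^sup>2 * exp ((real i + 1) * C) * exp (- (real i + 1) * x)"
    have "- melnikov (Suc i) x \<le> ?u * (2 * pi)"
    proof (rule has_integral_le[OF hint[OF neg]])
      show "((\<lambda>_. ?u) has_integral ?u * (2 * pi)) {0..2 * pi}"
        using has_integral_const_real[of ?u 0 "2 * pi"] by (simp add: mult.commute)
    qed (rule upper[OF x])
    then show "- melnikov (Suc i) x \<le> (B\<^sup>2 * exp ((real i + 1) * C) * (2 * pi)) * exp (- (real i + 1) * x)"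
      by (simp add: mult_ac)
  qed
qed

text \<open>With \<open>(X, Y)\<close> running through the oval, the integral is \<open>- \<integral> Y' / (X + c)\<close>. Expanding \<open>1 / (X + c)\<close> in powers of \<open>1 / c\<close>, the
  first term integrates to zero, the second one gives the enclosed area divided by \<open>c\<^sup>2\<close>, and the remainder is smaller by the
  choice of \<open>c\<close>.\<close>

lemma melnikov_0_bounds:
  assumes x: "x \<le> - 1"
  shows "pi * r0\<^sup>2 / (2 * c\<^sup>2) \<le> melnikov 0 x" "melnikov 0 x \<le> 2 * pi * (B\<^sup>2 * L)"
proof -
  have neg: "x < 0" using x by simp
  define Z where "Z t = pt x t" for t
  have Z: "Z t \<in> inside" "Z t \<noteq> 0" "norm (Z t) = radius x t" for t
    unfolding Z_def using radius(2)[OF neg] pt_nonzero[OF neg] norm_pt[OF neg] by auto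
  define \<kappa> where "\<kappa> t = (radius x t)\<^sup>2 / decay (Z t)" for t
  have dec: "e0 \<le> decay (Z t)" "0 < decay (Z t)" for t
    using decay_pt[OF x, of t] e0(1) unfolding Z_def by auto
  have dZ: "(Z has_vector_derivative \<kappa> t *\<^sub>R rot (grad (Z t))) (at t)" for t
    unfolding Z_def[abs_def]
  proof (rule pt_curve_deriv[where x = "\<lambda>_. x" and \<xi> = 0])
    show "\<kappa> t * (grad (pt x t) \<bullet> rot (grad (pt x t))) = 0" by (simp add: inner_rot)
    show "\<kappa> t * wedge (pt x t) (rot (grad (pt x t))) = (radius x t)\<^sup>2"
      using inner_grad[OF Z(1)[of t]] dec(2)[of t] unfolding \<kappa>_def Z_def by (simp add: wedge_rot)
  qed (use neg in auto)
  define X Y X' Y' where "X t = fst (Z t)" and "Y t = snd (Z t)"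
    and "X' t = \<kappa> t * snd (grad (Z t))" and "Y' t = - (\<kappa> t * fst (grad (Z t)))" for t
  have dX: "(X has_real_derivative X' t) (at t)" and dY: "(Y has_real_derivative Y' t) (at t)" for t
    unfolding X_def[abs_def] Y_def[abs_def] X'_def Y'_def has_real_derivative_iff_has_vector_derivative
    using bounded_linear.has_vector_derivative[OF bounded_linear_fst dZ[of t]]
      bounded_linear.has_vector_derivative[OF bounded_linear_snd dZ[of t]]
    by (simp_all add: rot_def)
  have area: "X t * Y' t - Y t * X' t = (radius x t)\<^sup>2" for t
  proof -
    have "X t * Y' t - Y t * X' t = - \<kappa> t * (Z t \<bullet> grad (Z t))"
      unfolding X_def Y_def X'_def Y'_def by (simp add: inner_prod_def algebra_simps)
    then show ?thesis using inner_grad[OF Z(1)[of t]] dec(2)[of t] unfolding \<kappa>_def by simp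
  qed
  have Y'b: "\<bar>Y' t\<bar> \<le> B\<^sup>2 * L" for t
  proof -
    have "\<bar>fst (grad (Z t))\<bar> \<le> L * decay (Z t)"
      using abs_coords(1)[of "grad (Z t)"] L(2)[OF Z(1) dec(1), of t] by linarith
    then have "\<bar>fst (grad (Z t))\<bar> / decay (Z t) \<le> L" using dec(2)[of t] by (simp add: field_simps)
    moreover have "(radius x t)\<^sup>2 \<le> B\<^sup>2" using radius_le_B[OF neg, of t] radius(1)[OF neg, of t] by (intro power_mono) auto
    ultimately have "(radius x t)\<^sup>2 * (\<bar>fst (grad (Z t))\<bar> / decay (Z t)) \<le> B\<^sup>2 * L"
      using dec(2)[of t] by (intro mult_mono) auto
    then show ?thesis unfolding Y'_def \<kappa>_def using dec(2)[of t] by (simp add: abs_mult)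
  qed
  have Xb: "\<bar>X t\<bar> \<le> B" for t using abs_coords(1)[of "Z t"] norm_inside[OF Z(1), of t] unfolding X_def by linarith
  have D: "c - B \<le> X t + c" "1 \<le> X t + c" for t using D_bounds[OF Z(1), of t] unfolding X_def by auto
  have cpos: "0 < c" "0 < c - B" using c_B B(1) by auto
  have melnikov_kernel: "melnikov_kernel 0 x t = - Y' t / (X t + c)" for t
    unfolding melnikov_kernel_def Y'_def \<kappa>_def X_def Z_def by simp
  \<comment> \<open>The exact part of the integrand: it collects \<open>- Y' / c\<close> and the symmetric part of \<open>X * Y' / c\<^sup>2\<close>, whose antisymmetric part
    is the area form.\<close>
  define H where "H t = - Y t / c + X t * Y t / (2 * c\<^sup>2)" for t
  define H' where "H' t = - Y' t / c + (X' t * Y t + Y' t * X t) / (2 * c\<^sup>2)" for t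
  have dH: "(H has_real_derivative H' t) (at t)" for t
  proof -
    have "((\<lambda>t. - (1 / c) * Y t + 1 / (2 * c\<^sup>2) * (X t * Y t)) has_real_derivative
        - (1 / c) * Y' t + 1 / (2 * c\<^sup>2) * (X' t * Y t + Y' t * X t)) (at t)"
      by (intro DERIV_add DERIV_cmult DERIV_mult dX dY)
    then show ?thesis unfolding H_def[abs_def] H'_def by simp
  qed
  have per: "H (2 * pi) = H 0"
    using pt_periodic[of x 0] unfolding H_def X_def Y_def Z_def by simp
  have H0: "(H' has_integral 0) {0..2 * pi}"
  proof -
    have "(H' has_integral H (2 * pi) - H 0) {0..2 * pi}"
      by (intro fundamental_theorem_of_calculus)
        (auto simp: has_real_derivative_iff_has_vector_derivative[symmetric] intro: has_field_derivative_at_within dH)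
    then show ?thesis using per by simp
  qed
  have lower: "H' t + r0\<^sup>2 / (4 * c\<^sup>2) \<le> melnikov_kernel 0 x t" for t
  proof -
    have e: "melnikov_kernel 0 x t = H' t + (radius x t)\<^sup>2 / (2 * c\<^sup>2) - (X t)\<^sup>2 * Y' t / (c\<^sup>2 * (X t + c))"
    proof -
      have "- Y' t / (X t + c) = - Y' t / c + X t * Y' t / c\<^sup>2 - (X t)\<^sup>2 * Y' t / (c\<^sup>2 * (X t + c))"
      proof -
        define w where "w = X t + c"
        have w: "w \<noteq> 0" unfolding w_def using D(2)[of t] by simp
        have "c\<^sup>2 = (c - X t) * w + (X t)\<^sup>2" unfolding w_def by (simp add: power2_eq_square algebra_simps)
        from arg_cong[OF this, of "\<lambda>y. y / (c\<^sup>2 * w)"]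
        have "1 / w = ((c - X t) * w + (X t)\<^sup>2) / (c\<^sup>2 * w)" using cpos(1) by simp
        then have "1 / w = (c - X t) / c\<^sup>2 + (X t)\<^sup>2 / (c\<^sup>2 * w)" using w by (simp add: add_divide_distrib)
        also have "(c - X t) / c\<^sup>2 = 1 / c - X t / c\<^sup>2" by (simp add: diff_divide_distrib power2_eq_square)
        finally have "- Y' t * (1 / w) = - Y' t * (1 / c - X t / c\<^sup>2 + (X t)\<^sup>2 / (c\<^sup>2 * w))" by simp
        then show ?thesis unfolding w_def[symmetric] by (simp add: algebra_simps)
      qed
      moreover have "X t * Y' t / c\<^sup>2 = (X' t * Y t + Y' t * X t) / (2 * c\<^sup>2) + (radius x t)\<^sup>2 / (2 * c\<^sup>2)"
        unfolding area[symmetric] using cpos(1) by (simp add: field_simps)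
      ultimately show ?thesis unfolding melnikov_kernel H'_def by simp
    qed
    have "(X t)\<^sup>2 * Y' t / (c\<^sup>2 * (X t + c)) \<le> r0\<^sup>2 / (4 * c\<^sup>2)"
    proof -
      have "(X t)\<^sup>2 * Y' t \<le> B\<^sup>2 * (B\<^sup>2 * L)"
      proof -
        have "(X t)\<^sup>2 \<le> B\<^sup>2" using Xb[of t] by (simp add: abs_le_square_iff[symmetric])
        then have "(X t)\<^sup>2 * \<bar>Y' t\<bar> \<le> B\<^sup>2 * (B\<^sup>2 * L)" using Y'b[of t] by (intro mult_mono) auto
        moreover have "(X t)\<^sup>2 * Y' t \<le> (X t)\<^sup>2 * \<bar>Y' t\<bar>" by (intro mult_left_mono) auto
        ultimately show ?thesis by linarith
      qed
      also have "\<dots> \<le> r0\<^sup>2 / 4 * (X t + c)"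
      proof -
        have "4 * B ^ 4 * L / r0\<^sup>2 \<le> X t + c" using c_large D(1)[of t] by linarith
        then have "4 * B ^ 4 * L \<le> (X t + c) * r0\<^sup>2" using r0(1) by (simp add: pos_divide_le_eq)
        moreover have "B\<^sup>2 * (B\<^sup>2 * L) = B ^ 4 * L" by (simp add: power2_eq_square power4_eq_xxxx)
        moreover have "r0\<^sup>2 / 4 * (X t + c) = (X t + c) * r0\<^sup>2 / 4" by simp
        ultimately show ?thesis by linarith
      qed
      finally have "(X t)\<^sup>2 * Y' t / (X t + c) \<le> r0\<^sup>2 / 4" using D(2)[of t] by (simp add: pos_divide_le_eq)
      then have "(X t)\<^sup>2 * Y' t / (X t + c) / c\<^sup>2 \<le> r0\<^sup>2 / 4 / c\<^sup>2" by (rule divide_right_mono) simp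
      then show ?thesis by (simp add: mult.commute)
    qed
    moreover have "r0\<^sup>2 / (2 * c\<^sup>2) \<le> (radius x t)\<^sup>2 / (2 * c\<^sup>2)"
      using r0(1) r0(2)[OF x, of t] by (intro divide_right_mono power_mono) auto
    moreover have "r0\<^sup>2 / (2 * c\<^sup>2) = r0\<^sup>2 / (4 * c\<^sup>2) + r0\<^sup>2 / (4 * c\<^sup>2)" by simp
    ultimately show ?thesis unfolding e by linarith
  qed
  have mi: "(melnikov_kernel 0 x has_integral melnikov 0 x) {0..2 * pi}"
    unfolding melnikov_def by (rule integrable_integral[OF melnikov_kernel_integrable[OF neg]])
  have "0 + r0\<^sup>2 / (4 * c\<^sup>2) * (2 * pi) \<le> melnikov 0 x"
  proof (rule has_integral_le[OF has_integral_add[OF H0] mi])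
    show "((\<lambda>t. r0\<^sup>2 / (4 * c\<^sup>2)) has_integral r0\<^sup>2 / (4 * c\<^sup>2) * (2 * pi)) {0..2 * pi}"
      using has_integral_const_real[of "r0\<^sup>2 / (4 * c\<^sup>2)" 0 "2 * pi"] by (simp add: mult.commute)
  qed (rule lower)
  then show "pi * r0\<^sup>2 / (2 * c\<^sup>2) \<le> melnikov 0 x" by (simp add: field_simps)
  have "melnikov 0 x \<le> (B\<^sup>2 * L) * (2 * pi)"
  proof (rule has_integral_le[OF mi])
    show "((\<lambda>_. B\<^sup>2 * L) has_integral (B\<^sup>2 * L) * (2 * pi)) {0..2 * pi}"
      using has_integral_const_real[of "B\<^sup>2 * L" 0 "2 * pi"] by (simp add: mult.commute)
    fix t
    have "- Y' t / (X t + c) \<le> \<bar>Y' t\<bar> / (X t + c)" using D(2)[of t] by (intro divide_right_mono) auto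
    also have "\<dots> \<le> \<bar>Y' t\<bar> / 1" using D(2)[of t] by (intro divide_left_mono) auto
    finally show "melnikov_kernel 0 x t \<le> B\<^sup>2 * L" unfolding melnikov_kernel using Y'b[of t] by simp
  qed
  then show "melnikov 0 x \<le> 2 * pi * (B\<^sup>2 * L)" by (simp add: mult.commute)
qed

text \<open>The level \<open>m0\<close> is taken so low that all ovals below it are within \<open>\<epsilon>\<close> of the polygon. The \<open>n\<close> simple zeros of the
  averaged function lie in disjoint intervals of levels below \<open>m0\<close>, and the perturbation parameter respects the \<open>n\<close>
  bounds from \<open>limit_cycle_near\<close> and the bound that keeps all coefficients below \<open>\<epsilon>\<close>.\<close>

lemma many_limit_cycles:
  assumes \<epsilon>: "0 < \<epsilon>"
  shows "\<exists>b. (\<forall>k\<le>n. \<bar>b k\<bar> \<le> \<epsilon>) \<and> (\<exists>C. finite C \<and> card C = n \<and>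
      (\<forall>\<gamma>\<in>C. limit_cycle (field b) \<gamma> \<and> hausdorff_dist \<gamma> boundary < \<epsilon>))"
proof -
  \<comment> \<open>By \<open>hausdorff_curve\<close>, curves below this level are within \<open>B * exp (m0 / lam_total)\<close> of the polygon.\<close>
  define m0 where "m0 = min (- 1) (lam_total * (ln (\<epsilon> / B) - 1))"
  have m0: "m0 \<le> - 1" "B * exp (m0 / lam_total) < \<epsilon>"
  proof -
    show "m0 \<le> - 1" unfolding m0_def by simp
    have "m0 \<le> lam_total * (ln (\<epsilon> / B) - 1)" unfolding m0_def by simp
    then have "m0 / lam_total \<le> ln (\<epsilon> / B) - 1" using lam_total_pos by (simp add: pos_divide_le_eq mult.commute)
    also have "\<dots> < ln (\<epsilon> / B)" by simp
    finally have "exp (m0 / lam_total) < exp (ln (\<epsilon> / B))" by simp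
    then have "exp (m0 / lam_total) < \<epsilon> / B" using \<epsilon> B(1) by simp
    then show "B * exp (m0 / lam_total) < \<epsilon>" using B(1) by (simp add: pos_less_divide_eq mult.commute)
  qed
  \<comment> \<open>The level is shifted by one such that \<open>s \<ge> 1\<close> corresponds to levels at most \<open>- 1\<close>.\<close>
  define f where "f k s = (if k = 0 then melnikov 0 (- 1 - ln s) else - melnikov k (- 1 - ln s))" for k s
  have fb: "\<exists>c C. 0 < c \<and> (\<forall>s\<ge>1. c * s ^ k \<le> f k s \<and> f k s \<le> C * s ^ k)" if k: "k \<le> n" for k
  proof (cases k)
    case 0
    have "0 < pi * r0\<^sup>2 / (2 * c\<^sup>2)" using r0(1) c_B B(1) by simp
    moreover have "- 1 - ln s \<le> - 1" if "1 \<le> s" for s :: real using that by simp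
    ultimately show ?thesis
      using melnikov_0_bounds unfolding 0 f_def
      by (intro exI[of _ "pi * r0\<^sup>2 / (2 * c\<^sup>2)"] exI[of _ "2 * pi * (B\<^sup>2 * L)"]) auto
  next
    case (Suc i)
    then have i: "i < n" using k by simp
    obtain a A where a: "0 < a" "\<And>x. x \<le> - 1 \<Longrightarrow> a * exp (- (real i + 1) * x) \<le> - melnikov (Suc i) x \<and>
        - melnikov (Suc i) x \<le> A * exp (- (real i + 1) * x)"
      using melnikov_Suc_bounds[OF i] by blast
    define q where "q = exp (real i + 1)"
    have e: "exp (- (real i + 1) * (- 1 - ln s)) = q * s ^ k" if "1 \<le> s" for s :: real
    proof -
      have "- (real i + 1) * (- 1 - ln s) = (real i + 1) + real k * ln s" unfolding Suc by (simp add: algebra_simps)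
      then have "exp (- (real i + 1) * (- 1 - ln s)) = q * exp (real k * ln s)" unfolding q_def by (simp only: exp_add)
      also have "exp (real k * ln s) = s ^ k" using that by (simp add: exp_of_nat_mult)
      finally show ?thesis .
    qed
    have "(a * q) * s ^ k \<le> f k s \<and> f k s \<le> (A * q) * s ^ k" if "1 \<le> s" for s
      using a(2)[of "- 1 - ln s"] that unfolding e[OF that] f_def Suc by (simp add: mult_ac)
    moreover have "0 < a * q" unfolding q_def using a(1) by simp
    ultimately show ?thesis by blast
  qed
  obtain a p where p: "\<And>m. max 1 (exp (- 1 - m0)) < p m" "strict_mono p"
      and alt: "\<And>m. m \<le> n \<Longrightarrow> 0 < (- 1) ^ m * (\<Sum>k\<le>n. a k * f k (p m))"
    by (rule alternating_combination[where f = f and n = n and S = "max 1 (exp (- 1 - m0))"]) (erule fb, rule that)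
  define x where "x m = - 1 - ln (p m)" for m
  have p1: "1 < p m" "exp (- 1 - m0) < p m" for m using p(1)[of m] by simp_all
  have x: "x m < m0" "x m < - 1" for m
  proof -
    have "ln (exp (- 1 - m0)) < ln (p m)" using p1[of m] by (subst ln_less_cancel_iff) auto
    then show "x m < m0" unfolding x_def by simp
    show "x m < - 1" unfolding x_def using p1(1)[of m] by simp
  qed
  have xdec: "x m < x k" if "k < m" for k m
    unfolding x_def using strict_monoD[OF p(2) that] p1(1)[of k] by simp
  \<comment> \<open>The Melnikov functions with positive index are negative.\<close>
  define b0 where "b0 k = (if k = 0 then a 0 else - a k)" for k
  define M where "M b y = (\<Sum>k\<le>n. b k * melnikov k y)" for b y
  have Malt: "0 < (- 1) ^ m * M b0 (x m)" if "m \<le> n" for m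
  proof -
    have "M b0 (x m) = (\<Sum>k\<le>n. a k * f k (p m))"
      unfolding M_def by (rule sum.cong) (simp_all add: b0_def f_def x_def)
    then show ?thesis using alt[OF that] by simp
  qed
  define lo where "lo = x n - 1"
  have xin: "x m \<in> {lo..m0}" if "m \<le> n" for m
  proof -
    have "x n \<le> x m" using xdec[of m n] that by (cases "m = n") auto
    then show ?thesis using x(1)[of m] unfolding lo_def by simp
  qed
  have mel_d: "\<exists>d. (melnikov k has_real_derivative d) (at y within {lo..m0})" if "y \<in> {lo..m0}" for k y
    using melnikov_props(1)[OF _ that] m0(1) by simp
  define melnikov' where "melnikov' k y = (SOME d. (melnikov k has_real_derivative d) (at y within {lo..m0}))" for k y
  have dmel: "(melnikov k has_real_derivative melnikov' k y) (at y within {lo..m0})" if "y \<in> {lo..m0}" for k y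
    unfolding melnikov'_def using someI_ex[OF mel_d[OF that]] .
  have mel0: "0 < melnikov 0 y" if "y \<in> {lo..m0}" for y
  proof -
    have "0 < pi * r0\<^sup>2 / (2 * c\<^sup>2)" using r0(1) c_B B(1) by simp
    then show ?thesis using melnikov_0_bounds(1)[of y] that m0(1) by auto
  qed
  define M' where "M' b y = (\<Sum>k\<le>n. b k * melnikov' k y)" for b y
  have dM: "(M b has_real_derivative M' b y) (at y within {lo..m0})" if "y \<in> {lo..m0}" for b y
    unfolding M_def[abs_def] M'_def using dmel[OF that] by (intro DERIV_sum DERIV_cmult)
  define h where "h y = M b0 y / melnikov 0 y" for y
  define h' where "h' y = (M' b0 y * melnikov 0 y - M b0 y * melnikov' 0 y) / (melnikov 0 y * melnikov 0 y)" for y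
  have dh: "(h has_real_derivative h' y) (at y within {lo..m0})" if "y \<in> {lo..m0}" for y
    unfolding h_def[abs_def] h'_def using mel0[OF that]
    by (intro DERIV_divide dM[OF that] dmel[OF that]) simp
  define \<eta> where "\<eta> = Min ((\<lambda>m. (- 1) ^ m * h (x m)) ` {..n})"
  have halt: "0 < (- 1) ^ m * h (x m)" if "m \<le> n" for m
    using Malt[OF that] mel0[OF xin[OF that]] unfolding h_def by simp
  have \<eta>: "0 < \<eta>" "\<And>m. m \<le> n \<Longrightarrow> \<eta> \<le> (- 1) ^ m * h (x m)"
    unfolding \<eta>_def using halt by auto
  obtain r where r: "0 < r" "r < \<eta>" "\<And>y. y \<in> {lo..m0} \<Longrightarrow> h y = r \<Longrightarrow> h' y \<noteq> 0"
    by (rule regular_value_exists[OF dh \<eta>(1)]) (assumption, rule that)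
  have ralt: "0 < (- 1) ^ m * (h (x m) - r)" if "m \<le> n" for m
    using \<eta>(2)[OF that] r(1,2) by (cases "even m") auto
  \<comment> \<open>The new averaged function is \<open>melnikov 0\<close> times \<open>h - r\<close>, and \<open>r\<close> is a regular value of \<open>h\<close>.\<close>
  define b where "b k = (if k = 0 then b0 0 - r else b0 k)" for k
  have Mb: "M b y = M b0 y - r * melnikov 0 y" for y
  proof -
    have "b k * melnikov k y = b0 k * melnikov k y - (if k = 0 then r * melnikov 0 y else 0)" for k
      unfolding b_def by (simp add: algebra_simps)
    then show ?thesis unfolding M_def by (simp add: sum_subtractf)
  qed
  have Mb': "M' b y = M' b0 y - r * melnikov' 0 y" for y
  proof -
    have "b k * melnikov' k y = b0 k * melnikov' k y - (if k = 0 then r * melnikov' 0 y else 0)" for k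
      unfolding b_def by (simp add: algebra_simps)
    then show ?thesis unfolding M'_def by (simp add: sum_subtractf)
  qed
  have "\<exists>y. x (Suc k) < y \<and> y < x k \<and> h y = r" if k: "k < n" for k
  proof -
    have kk: "k \<le> n" "Suc k \<le> n" using k by simp_all
    have sub: "{x (Suc k)..x k} \<subseteq> {lo..m0}" using xin[OF kk(1)] xin[OF kk(2)] by auto
    have "continuous_on {lo..m0} h" by (rule DERIV_continuous_on[OF dh])
    then have ch: "continuous_on {x (Suc k)..x k} (\<lambda>y. (- 1) ^ k * h y)"
      using sub by (intro continuous_intros) (rule continuous_on_subset)
    have s1: "(- 1) ^ k * h (x (Suc k)) < (- 1) ^ k * r" using ralt[OF kk(2)] by (simp add: algebra_simps)
    have s2: "(- 1) ^ k * r < (- 1) ^ k * h (x k)" using ralt[OF kk(1)] by (simp add: algebra_simps)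
    obtain y where y: "x (Suc k) \<le> y" "y \<le> x k" "(- 1) ^ k * h y = (- 1) ^ k * r"
      using IVT'[OF less_imp_le[OF s1] less_imp_le[OF s2] less_imp_le[OF xdec[of k "Suc k"]] ch] by auto
    then have "h y = r" by simp
    moreover have "y \<noteq> x (Suc k)" "y \<noteq> x k" using s1 s2 y(3) by auto
    ultimately show ?thesis using y by (intro exI[of _ y]) auto
  qed
  then obtain y where y: "\<And>k. k < n \<Longrightarrow> x (Suc k) < y k \<and> y k < x k \<and> h (y k) = r" by metis
  have yin: "y k \<in> {lo..m0}" "lo < y k" "y k < m0" if "k < n" for k
    using y[OF that] xin[of k] xin[of "Suc k"] that by auto
  obtain Gx where Gx: "C1_strip (e_max b) lo m0 (G b) Gx" using C1_G[OF m0(1)] unfolding C1_def by blast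
  define tube where "tube k \<delta> E' \<longleftrightarrow> 0 < E' \<and> \<delta> \<le> min (y k - x (Suc k)) (x k - y k) \<and>
      (\<forall>e. 0 < e \<longrightarrow> e \<le> E' \<longrightarrow> (\<exists>\<xi>. (\<forall>t. \<bar>\<xi> t - y k\<bar> < \<delta> \<and> \<xi> t < m0) \<and>
        limit_cycle (field (\<lambda>k. e * b k)) (range (\<lambda>t. pt (\<xi> t) t))))" for k \<delta> E'
  have "\<exists>\<delta> E'. tube k \<delta> E'" if k: "k < n" for k
  proof -
    have neg: "z < 0" if "z \<in> {lo..m0}" for z using that m0(1) by auto
    have Mz: "M b (y k) = 0"
      using y[OF k] mel0[OF yin(1)[OF k]] unfolding Mb h_def by (simp add: field_simps)
    have iM: "((\<lambda>t. G b 0 (y k) t) has_integral 0) {0..2 * pi}"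
      using G_has_integral[OF neg[OF yin(1)[OF k]], of b] Mz unfolding M_def by simp
    note gi = C1_strip_integral[OF Gx less_imp_le[OF e_max_pos] yin(1)[OF k]]
    have intG: "integral {0..2 * pi} (G b 0 z) = M b z" if "z \<in> {lo..m0}" for z
      unfolding M_def by (rule integral_unique[OF G_has_integral[OF neg[OF that]]])
    have at: "at (y k) within {lo..m0} = at (y k)"
      by (rule at_within_interior) (use yin[OF k] in \<open>simp add: interior_atLeastAtMost_real\<close>)
    have "((\<lambda>z. integral {0..2 * pi} (G b 0 z)) has_real_derivative M' b (y k)) (at (y k) within {lo..m0})"
      unfolding has_field_derivative_def
      by (rule has_derivative_transform[OF yin(1)[OF k] _ dM[OF yin(1)[OF k], unfolded has_field_derivative_def]])
        (rule intG)
    then have "integral {0..2 * pi} (Gx 0 (y k)) = M' b (y k)" using gi(1) unfolding at by (metis DERIV_unique)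
    then have iGx: "((\<lambda>t. Gx 0 (y k) t) has_integral M' b (y k)) {0..2 * pi}" using gi(3) by (metis integrable_integral)
    have nz: "M' b (y k) \<noteq> 0"
    proof
      assume "M' b (y k) = 0"
      then have 1: "M' b0 (y k) = r * melnikov' 0 (y k)" unfolding Mb' by simp
      have 2: "M b0 (y k) = r * melnikov 0 (y k)" using Mz unfolding Mb by simp
      have "h' (y k) = 0" unfolding h'_def 1 2 by simp
      then show False using r(3)[OF yin(1)[OF k]] y[OF k] by blast
    qed
    have d0: "0 < min (y k - x (Suc k)) (x k - y k)" using y[OF k] by simp
    show ?thesis
    proof (rule limit_cycle_near[OF m0(1) yin(2,3)[OF k] d0 iM Gx iGx nz])
      fix \<delta> E'
      assume "0 < \<delta>" "\<delta> \<le> min (y k - x (Suc k)) (x k - y k)" "0 < E'"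
        "\<And>e. 0 < e \<Longrightarrow> e \<le> E' \<Longrightarrow> \<exists>\<xi>. (\<forall>t. \<bar>\<xi> t - y k\<bar> < \<delta> \<and> \<xi> t < m0) \<and>
          limit_cycle (field (\<lambda>k. e * b k)) (range (\<lambda>t. pt (\<xi> t) t))"
      then show "\<exists>\<delta> E'. tube k \<delta> E'" unfolding tube_def by blast
    qed
  qed
  then obtain \<delta> E' where tb: "\<And>k. k < n \<Longrightarrow> tube k (\<delta> k) (E' k)" by metis
  have E': "0 < E' k" and \<delta>: "\<delta> k \<le> min (y k - x (Suc k)) (x k - y k)" if "k < n" for k
    using tb[OF that] unfolding tube_def by blast+
  have cyc: "\<exists>\<xi>. (\<forall>t. \<bar>\<xi> t - y k\<bar> < \<delta> k \<and> \<xi> t < m0) \<and>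
        limit_cycle (field (\<lambda>k. e * b k)) (range (\<lambda>t. pt (\<xi> t) t))"
    if "k < n" "0 < e" "e \<le> E' k" for k e
    using tb[OF that(1)] that(2,3) unfolding tube_def by blast
  define bs where "bs = (\<Sum>k\<le>n. \<bar>b k\<bar>) + 1"
  have bs: "0 < bs" "\<And>k. k \<le> n \<Longrightarrow> \<bar>b k\<bar> \<le> bs"
  proof -
    show "0 < bs" unfolding bs_def by (simp add: sum_nonneg add_nonneg_pos)
    fix k assume "k \<le> n"
    then have "\<bar>b k\<bar> \<le> (\<Sum>k\<le>n. \<bar>b k\<bar>)" by (intro member_le_sum) auto
    then show "\<bar>b k\<bar> \<le> bs" unfolding bs_def by simp
  qed
  define e where "e = Min (insert (\<epsilon> / bs) (E' ` {..<n}))"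
  have e: "0 < e" "e \<le> \<epsilon> / bs" "\<And>k. k < n \<Longrightarrow> e \<le> E' k"
    unfolding e_def using \<epsilon> bs(1) E' by auto
  define good where "good k \<xi> \<longleftrightarrow> (\<forall>t. \<bar>\<xi> t - y k\<bar> < \<delta> k \<and> \<xi> t < m0) \<and>
      limit_cycle (field (\<lambda>k. e * b k)) (range (\<lambda>t. pt (\<xi> t) t))" for k \<xi>
  have "\<exists>\<xi>. good k \<xi>" if "k < n" for k
    unfolding good_def using cyc[OF that e(1) e(3)[OF that]] .
  then obtain \<xi> where gd: "\<And>k. k < n \<Longrightarrow> good k (\<xi> k)" by metis
  have \<xi>: "\<bar>\<xi> k t - y k\<bar> < \<delta> k" "\<xi> k t < m0"
      "limit_cycle (field (\<lambda>k. e * b k)) (range (\<lambda>t. pt (\<xi> k t) t))" if "k < n" for k t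
    using gd[OF that] unfolding good_def by blast+
  define \<gamma> where "\<gamma> k = range (\<lambda>t. pt (\<xi> k t) t)" for k
  have pot\<gamma>: "x (Suc k) < pot z \<and> pot z < x k" if kz: "k < n" "z \<in> \<gamma> k" for k z
  proof -
    obtain t where t: "z = pt (\<xi> k t) t" using kz(2) unfolding \<gamma>_def by auto
    have "\<xi> k t < 0" using \<xi>(2)[OF kz(1), of t] m0(1) by simp
    then have "pot z = \<xi> k t" using radius(3) t by simp
    then show ?thesis using \<xi>(1)[OF kz(1), of t] \<delta>[OF kz(1)] by (auto simp: abs_less_iff)
  qed
  have ne: "\<gamma> k \<noteq> \<gamma> j" if kj: "j < k" "k < n" for j k
  proof
    assume eq: "\<gamma> k = \<gamma> j"
    have "pt (\<xi> k 0) 0 \<in> \<gamma> k" unfolding \<gamma>_def by auto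
    then have "pot (pt (\<xi> k 0) 0) < x k" "x (Suc j) < pot (pt (\<xi> k 0) 0)"
      using pot\<gamma>[OF kj(2)] pot\<gamma>[of j] kj eq by auto
    moreover have "x k \<le> x (Suc j)" using xdec[of "Suc j" k] kj(1) by (cases "k = Suc j") auto
    ultimately show False by simp
  qed
  have inj: "inj_on \<gamma> {..<n}"
  proof (rule inj_onI)
    fix j k assume "j \<in> {..<n}" "k \<in> {..<n}" "\<gamma> j = \<gamma> k"
    then show "j = k" using ne[of j k] ne[of k j] by (cases j k rule: linorder_cases) auto
  qed
  show ?thesis
  proof (intro exI[of _ "\<lambda>k. e * b k"] conjI allI impI exI[of _ "\<gamma> ` {..<n}"] ballI)
    show "\<bar>e * b k\<bar> \<le> \<epsilon>" if "k \<le> n" for k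
    proof -
      have "\<bar>e * b k\<bar> = e * \<bar>b k\<bar>" using e(1) by (simp add: abs_mult)
      also have "\<dots> \<le> (\<epsilon> / bs) * bs" using e(1,2) bs(2)[OF that] by (intro mult_mono) auto
      finally show ?thesis using bs(1) by simp
    qed
    show "finite (\<gamma> ` {..<n})" by simp
    show "card (\<gamma> ` {..<n}) = n" using card_image[OF inj] by simp
    fix g assume "g \<in> \<gamma> ` {..<n}"
    then obtain k where k: "k < n" "g = \<gamma> k" by auto
    show "limit_cycle (field (\<lambda>k. e * b k)) g" unfolding k(2) \<gamma>_def by (rule \<xi>(3)[OF k(1)])
    have "m0 < 0" using m0(1) by simp
    then have "hausdorff_dist g boundary \<le> B * exp (m0 / lam_total)"
      unfolding k(2) \<gamma>_def using hausdorff_curve(1)[OF B(2), of "\<xi> k" m0] \<xi>(2)[OF k(1)] by (simp add: less_imp_le)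
    then show "hausdorff_dist g boundary < \<epsilon>" using m0(2) by simp
  qed
qed

end

section \<open>Degree and coefficient topology\<close>

lemma eval2_simps:
  "eval2 (p + q) z = eval2 p z + eval2 q z"
  "eval2 (p * q) z = eval2 p z * eval2 q z"
  "eval2 [:[:r:]:] z = r"
  "eval2 [:[:r, s:], [:t:]:] z = r + s * fst z + t * snd z"
  "eval2 [:[:0, 1:]:] z = fst z"
  "eval2 [:0, 1:] z = snd z"
  by (simp_all add: eval2_def split_beta)

lemma eval2_sum: "eval2 (\<Sum>i\<in>A. f i) z = (\<Sum>i\<in>A. eval2 (f i) z)"
  by (induction A rule: infinite_finite_induct) (simp_all add: eval2_simps, simp_all add: eval2_def split_beta)

lemma eval2_prod: "eval2 (\<Prod>i\<in>A. f i) z = (\<Prod>i\<in>A. eval2 (f i) z)"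
  by (induction A rule: infinite_finite_induct) (simp_all add: eval2_simps, simp_all add: eval2_def split_beta)

lemma coeff2_simps:
  "coeff2 (p + q) m = coeff2 p m + coeff2 q m"
  "coeff2 ([:[:r:]:] * p) m = r * coeff2 p m"
  by (cases m; simp add: coeff2_def)+

lemma coeff2_sum: "coeff2 (\<Sum>i\<in>A. f i) m = (\<Sum>i\<in>A. coeff2 (f i) m)"
  by (cases m) (simp add: coeff2_def coeff_sum)

text \<open>An upper bound for the total degree that is easy to propagate through sums and products.\<close>

definition degree_bounded :: "real poly poly \<Rightarrow> nat \<Rightarrow> bool" where
  "degree_bounded p d \<longleftrightarrow> (\<forall>i j. coeff2 p (i, j) \<noteq> 0 \<longrightarrow> i + j \<le> d)"

lemma degree_bounded_add: "degree_bounded p d \<Longrightarrow> degree_bounded q d \<Longrightarrow> degree_bounded (p + q) d"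
  unfolding degree_bounded_def coeff2_simps by (metis add.right_neutral)

lemma degree_bounded_sum: "(\<And>i. i \<in> A \<Longrightarrow> degree_bounded (f i) d) \<Longrightarrow> degree_bounded (\<Sum>i\<in>A. f i) d"
  unfolding degree_bounded_def coeff2_sum by (metis (no_types, lifting) sum.neutral)

lemma degree_bounded_mult:
  assumes "degree_bounded p d" "degree_bounded q d'" shows "degree_bounded (p * q) (d + d')"
  unfolding degree_bounded_def
proof (intro allI impI)
  fix i j assume nz: "coeff2 (p * q) (i, j) \<noteq> 0"
  have "coeff2 (p * q) (i, j) = (\<Sum>b\<le>j. \<Sum>a\<le>i. coeff2 p (a, b) * coeff2 q (i - a, j - b))"
    by (simp add: coeff2_def coeff_mult coeff_sum)
  then obtain b a where "b \<le> j" "a \<le> i" "coeff2 p (a, b) * coeff2 q (i - a, j - b) \<noteq> 0"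
    using nz by (metis (no_types, lifting) atMost_iff sum.neutral)
  then have "coeff2 p (a, b) \<noteq> 0" "coeff2 q (i - a, j - b) \<noteq> 0" by auto
  then have "a + b \<le> d" "(i - a) + (j - b) \<le> d'" using assms unfolding degree_bounded_def by blast+
  then show "i + j \<le> d + d'" using \<open>b \<le> j\<close> \<open>a \<le> i\<close> by simp
qed

lemma degree_bounded_const: "degree_bounded [:[:r:]:] 0"
  unfolding degree_bounded_def coeff2_def by (auto simp: coeff_pCons split: nat.splits)

lemma degree_bounded_linear:
  "degree_bounded [:[:r, s:], [:t:]:] 1" "degree_bounded [:[:0, 1:]:] 1" "degree_bounded [:0, 1:] 1"
  unfolding degree_bounded_def coeff2_def by (auto simp: coeff_pCons split: nat.splits)

lemma degree_bounded_mono: "degree_bounded p d \<Longrightarrow> d \<le> d' \<Longrightarrow> degree_bounded p d'"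
  unfolding degree_bounded_def by (meson order_trans)

lemma degree_bounded_prod:
  assumes "finite A" "\<And>i. i \<in> A \<Longrightarrow> degree_bounded (f i) 1"
  shows "degree_bounded (\<Prod>i\<in>A. f i) (card A)"
  using assms
proof (induction A rule: finite_induct)
  case empty
  then show ?case using degree_bounded_const[of 1] by (simp add: one_pCons)
next
  case (insert x F)
  then show ?case using degree_bounded_mult[of "f x" 1 "\<Prod>i\<in>F. f i" "card F"] by simp
qed

lemma total_degree_le:
  assumes "degree_bounded p d" shows "total_degree p \<le> d"
proof -
  have "{i + j | i j. coeff2 p (i, j) \<noteq> 0} \<subseteq> {..d}" using assms unfolding degree_bounded_def by auto
  then show ?thesis unfolding total_degree_def by (subst Max_le_iff) (auto intro: finite_subset)
qed

lemma le_total_degree: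
  assumes "degree_bounded p d" "coeff2 p (i, j) \<noteq> 0" shows "i + j \<le> total_degree p"
proof -
  have "{i + j | i j. coeff2 p (i, j) \<noteq> 0} \<subseteq> {..d}" using assms unfolding degree_bounded_def by auto
  then have "finite {i + j | i j. coeff2 p (i, j) \<noteq> 0}" by (rule finite_subset) simp
  then show ?thesis unfolding total_degree_def using assms(2) by (intro Max_ge) auto
qed

lemma power_ratio_tendsto_0: "k < d \<Longrightarrow> ((\<lambda>t::real. t ^ k / t ^ d) \<longlongrightarrow> 0) at_top"
proof -
  assume "k < d"
  then have "filterlim (\<lambda>t::real. t ^ (d - k)) at_infinity at_top"
    by (intro filterlim_at_top_imp_at_infinity filterlim_pow_at_top filterlim_ident) simp
  then have "((\<lambda>t::real. 1 / t ^ (d - k)) \<longlongrightarrow> 0) at_top" by (rule tendsto_divide_0[OF tendsto_const])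
  moreover have "\<forall>\<^sub>F t::real in at_top. 1 / t ^ (d - k) = t ^ k / t ^ d"
    using eventually_gt_at_top[of 0]
  proof eventually_elim
    case (elim t)
    have "t ^ d = t ^ k * t ^ (d - k)" using \<open>k < d\<close> by (simp add: power_add[symmetric])
    then show ?case using elim by simp
  qed
  ultimately show ?thesis by (rule Lim_transform_eventually)
qed

text \<open>A polynomial of degree at most \<open>d\<close> grows along rays slower than \<open>t ^ Suc d\<close>. This is used to bound degrees from below.\<close>

lemma eval2_growth:
  assumes "degree_bounded p d"
  shows "((\<lambda>t. eval2 p (t *\<^sub>R z) / t ^ Suc d) \<longlongrightarrow> 0) at_top"
proof -
  obtain x y where z: "z = (x, y)" by (cases z)
  have "eval2 p (t *\<^sub>R z) / t ^ Suc d = (\<Sum>j\<le>degree p. \<Sum>i\<le>degree (coeff p j).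
      (coeff2 p (i, j) * x ^ i * y ^ j) * (t ^ (i + j) / t ^ Suc d))" for t
  proof -
    have "poly p [:t * y:] = (\<Sum>j\<le>degree p. coeff p j * [:t * y:] ^ j)" by (rule poly_altdef)
    then have "eval2 p (t *\<^sub>R z) = (\<Sum>j\<le>degree p. poly (coeff p j) (t * x) * (t * y) ^ j)"
      unfolding eval2_def z by (simp add: poly_sum)
    also have "\<dots> = (\<Sum>j\<le>degree p. \<Sum>i\<le>degree (coeff p j). coeff2 p (i, j) * x ^ i * y ^ j * t ^ (i + j))"
      by (simp add: poly_altdef coeff2_def sum_distrib_left sum_distrib_right power_mult_distrib power_add mult_ac)
    finally show ?thesis by (simp add: sum_divide_distrib)
  qed
  moreover have "((\<lambda>t. \<Sum>j\<le>degree p. \<Sum>i\<le>degree (coeff p j).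
      (coeff2 p (i, j) * x ^ i * y ^ j) * (t ^ (i + j) / t ^ Suc d)) \<longlongrightarrow> 0) at_top"
  proof (intro tendsto_null_sum)
    fix i j
    show "((\<lambda>t. (coeff2 p (i, j) * x ^ i * y ^ j) * (t ^ (i + j) / t ^ Suc d)) \<longlongrightarrow> 0) at_top"
    proof (cases "coeff2 p (i, j) = 0")
      case False
      then have "i + j < Suc d" using assms unfolding degree_bounded_def by (simp add: less_Suc_eq_le)
      then show ?thesis by (intro tendsto_mult_right_zero power_ratio_tendsto_0)
    qed simp
  qed
  ultimately show ?thesis by simp
qed

lemma limitin_pullback:
  assumes "X \<in> A" "\<And>e. Y e \<in> A" "limitin T (\<lambda>e. f (Y e)) (f X) F"
  shows "limitin (pullback_topology A f T) Y X F"
  unfolding limitin_def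
proof (intro conjI allI impI)
  show "X \<in> topspace (pullback_topology A f T)"
    using assms(1) limitin_topspace[OF assms(3)] by (simp add: topspace_pullback_topology)
  fix U assume "openin (pullback_topology A f T) U \<and> X \<in> U"
  then obtain V where V: "openin T V" "U = f -` V \<inter> A" "f X \<in> V"
    unfolding openin_pullback_topology by auto
  then have "\<forall>\<^sub>F e in F. f (Y e) \<in> V" using assms(3) unfolding limitin_def by blast
  then show "\<forall>\<^sub>F e in F. Y e \<in> U" by eventually_elim (simp add: V(2) assms(2))
qed

context polygon_field
begin

definition side_poly :: "nat \<Rightarrow> real poly poly" where
  "side_poly j = [:[:1, fst (u j):], [:snd (u j):]:]"

definition others_poly :: "nat \<Rightarrow> real poly poly" where
  "others_poly i = (\<Prod>j\<in>{..<n} - {i}. side_poly j)"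

definition component1 :: "(nat \<Rightarrow> real) \<Rightarrow> real poly poly" where
  "component1 b = ([:[:0, 1:]:] + [:[:c:]:]) * (\<Sum>i<n. [:[:lam i * snd (u i):]:] * others_poly i)
     + (\<Sum>i<n. [:[:b (Suc i):]:] * (others_poly i * [:[:0, 1:]:]))
     + [:[:b 0:]:] * (\<Prod>j<n. side_poly j)"

definition component2 :: "(nat \<Rightarrow> real) \<Rightarrow> real poly poly" where
  "component2 b = ([:[:0, 1:]:] + [:[:c:]:]) * (\<Sum>i<n. [:[:lam i * - fst (u i):]:] * others_poly i)
     + (\<Sum>i<n. [:[:b (Suc i):]:] * (others_poly i * [:0, 1:]))"

lemma eval_side_poly: "eval2 (side_poly j) z = side j z"
  unfolding side_poly_def eval2_simps by (simp add: side_def inner_prod_def)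

lemma field_poly: "field b = poly_vfield (component1 b, component2 b)"
proof
  fix z
  have o: "eval2 (others_poly i) z = others i z" for i
    unfolding others_poly_def others_def eval2_prod eval_side_poly ..
  have 1: "eval2 (component1 b) z = fst (field b z)"
    unfolding component1_def eval2_simps eval2_sum eval2_prod o eval_side_poly
    by (simp add: field_def sides_def fst_sum rot_def sum_distrib_left sum_distrib_right mult_ac)
  have 2: "eval2 (component2 b) z = snd (field b z)"
    unfolding component2_def eval2_simps eval2_sum eval2_prod o eval_side_poly
    by (simp add: field_def snd_sum rot_def sum_distrib_left sum_distrib_right mult_ac)
  show "field b z = poly_vfield (component1 b, component2 b) z"
    unfolding poly_vfield_def by (simp add: 1 2)
qed

lemma degree_others: "i < n \<Longrightarrow> degree_bounded (others_poly i) (n - 1)"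
  using degree_bounded_prod[of "{..<n} - {i}" side_poly] degree_bounded_linear(1)
  unfolding others_poly_def side_poly_def by simp

lemma degree_components: "degree_bounded (component1 b) n" "degree_bounded (component2 b) n"
proof -
  have n1: "Suc (n - 1) = n" using n_pos by simp
  have lin: "degree_bounded ([:[:0, 1:]:] + [:[:c:]:]) 1"
    by (intro degree_bounded_add degree_bounded_linear degree_bounded_mono[OF degree_bounded_const]) simp
  have co: "degree_bounded ([:[:r:]:] * others_poly i) (n - 1)" if "i < n" for r i
    using degree_bounded_mult[OF degree_bounded_const degree_others[OF that], of r] by simp
  have A: "degree_bounded (([:[:0, 1:]:] + [:[:c:]:]) * (\<Sum>i<n. [:[:r i:]:] * others_poly i)) n" for r
    using degree_bounded_mult[OF lin degree_bounded_sum[of "{..<n}" "\<lambda>i. [:[:r i:]:] * others_poly i" "n - 1"]] co n1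
    by simp
  have Bd: "degree_bounded (\<Sum>i<n. [:[:r i:]:] * (others_poly i * q)) n" if q: "degree_bounded q 1" for r q
  proof (rule degree_bounded_sum)
    fix i assume "i \<in> {..<n}"
    then have "degree_bounded (others_poly i * q) n"
      using degree_bounded_mult[OF degree_others q] n1 by simp
    from degree_bounded_mult[OF degree_bounded_const this] show "degree_bounded ([:[:r i:]:] * (others_poly i * q)) n" by simp
  qed
  have Cd: "degree_bounded ([:[:r:]:] * (\<Prod>j<n. side_poly j)) n" for r
  proof -
    have "degree_bounded (\<Prod>j<n. side_poly j) n"
      using degree_bounded_prod[of "{..<n}" side_poly] degree_bounded_linear(1) unfolding side_poly_def by simp
    from degree_bounded_mult[OF degree_bounded_const this] show ?thesis by simp
  qed
  show "degree_bounded (component1 b) n" unfolding component1_def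
    by (intro degree_bounded_add A Bd Cd degree_bounded_linear)
  show "degree_bounded (component2 b) n" unfolding component2_def
    by (intro degree_bounded_add A Bd degree_bounded_linear)
qed

text \<open>Finitely many linear forms have a common point of non-vanishing, as the product of their restrictions to the line
  \<open>fst z = 1\<close> is a non-zero polynomial.\<close>

lemma generic_direction: "\<exists>z. (\<forall>j<n. u j \<bullet> z \<noteq> 0) \<and> lam_total * fst z + r * snd z \<noteq> 0"
proof -
  define q where "q = [:lam_total, r:] * (\<Prod>j<n. [:fst (u j), snd (u j):])"
  have "u j \<noteq> 0" for j using turn_ne[of j] by (auto simp: wedge_def)
  then have "[:fst (u j), snd (u j):] \<noteq> 0" for j by (simp add: prod_eq_iff)
  then have "(\<Prod>j<n. [:fst (u j), snd (u j):]) \<noteq> 0" by (subst prod_zero_iff) auto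
  moreover have "[:lam_total, r:] \<noteq> 0" using lam_total_pos by simp
  ultimately have "q \<noteq> 0" unfolding q_def by (metis mult_eq_0_iff)
  then have "finite {s. poly q s = 0}" by (rule poly_roots_finite)
  then obtain s where "poly q s \<noteq> 0" using infinite_UNIV_char_0[where 'a = real] by (metis (mono_tags) UNIV_eq_I mem_Collect_eq)
  moreover have "poly q s = (lam_total + s * r) * (\<Prod>j<n. fst (u j) + s * snd (u j))"
    unfolding q_def poly_mult poly_prod by simp
  ultimately have "lam_total + s * r \<noteq> 0" "(\<Prod>j<n. fst (u j) + s * snd (u j)) \<noteq> 0" by auto
  then have "(\<forall>j<n. u j \<bullet> (1, s) \<noteq> 0) \<and> lam_total * fst (1, s) + r * snd (1, s) \<noteq> 0"
    by (auto simp: inner_prod_def mult.commute)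
  then show ?thesis by blast
qed

text \<open>Along a generic ray the angular momentum \<open>wedge z (field b z)\<close> grows with the order \<open>t ^ (n + 1)\<close>, which excludes that
  both components have degree below \<open>n\<close>.\<close>

lemma field_degree: "field b \<in> poly_vfields n"
proof -
  have "total_degree (component1 b) = n \<or> total_degree (component2 b) = n"
  proof (rule ccontr)
    assume "\<not> ?thesis"
    then have lt: "total_degree (component1 b) < n" "total_degree (component2 b) < n"
      using total_degree_le[OF degree_components(1), of b] total_degree_le[OF degree_components(2), of b] by simp_all
    have db: "degree_bounded (component1 b) (n - 1)" "degree_bounded (component2 b) (n - 1)"
      unfolding degree_bounded_def
      using le_total_degree[OF degree_components(1)] le_total_degree[OF degree_components(2)] lt by fastforce+
    obtain z where z: "\<And>j. j < n \<Longrightarrow> u j \<bullet> z \<noteq> 0" "lam_total * fst z + b 0 * snd z \<noteq> 0"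
      using generic_direction[of "b 0"] by blast
    define prd where "prd = (\<Prod>j<n. u j \<bullet> z)"
    have n1: "Suc (n - 1) = n" using n_pos by simp
    have lim1: "((\<lambda>t. fst z * (eval2 (component2 b) (t *\<^sub>R z) / t ^ n) - snd z * (eval2 (component1 b) (t *\<^sub>R z) / t ^ n)) \<longlongrightarrow>
        fst z * 0 - snd z * 0) at_top"
      using eval2_growth[OF db(1), of z] eval2_growth[OF db(2), of z] unfolding n1 by (intro tendsto_intros)
    have inv: "((\<lambda>t::real. 1 / t) \<longlongrightarrow> 0) at_top"
      using power_ratio_tendsto_0[of 0 1] by simp
    have ls: "((\<lambda>t. side j (t *\<^sub>R z) / t) \<longlongrightarrow> u j \<bullet> z) at_top" for j
    proof -
      have "((\<lambda>t. 1 / t + u j \<bullet> z) \<longlongrightarrow> 0 + u j \<bullet> z) at_top" by (intro tendsto_intros inv)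
      moreover have "\<forall>\<^sub>F t in at_top. 1 / t + u j \<bullet> z = side j (t *\<^sub>R z) / t"
        using eventually_gt_at_top[of 0] by eventually_elim (simp add: side_def add_divide_distrib)
      ultimately show ?thesis using Lim_transform_eventually by fastforce
    qed
    have lS: "((\<lambda>t. \<Prod>j<n. side j (t *\<^sub>R z) / t) \<longlongrightarrow> prd) at_top" unfolding prd_def by (intro tendsto_prod ls)
    have lO: "((\<lambda>t. \<Prod>j\<in>{..<n} - {i}. side j (t *\<^sub>R z) / t) \<longlongrightarrow> (\<Prod>j\<in>{..<n} - {i}. u j \<bullet> z)) at_top" for i
      by (intro tendsto_prod ls)
    have lc: "((\<lambda>t. fst z + c * (1 / t)) \<longlongrightarrow> fst z + c * 0) at_top" by (intro tendsto_intros inv)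
    have lim2: "((\<lambda>t. - (fst z + c * (1 / t)) * (\<Sum>i<n. lam i * (u i \<bullet> z) * (\<Prod>j\<in>{..<n} - {i}. side j (t *\<^sub>R z) / t))
        - b 0 * (\<Prod>j<n. side j (t *\<^sub>R z) / t) * snd z) \<longlongrightarrow>
        - (fst z + c * 0) * (\<Sum>i<n. lam i * (u i \<bullet> z) * (\<Prod>j\<in>{..<n} - {i}. u j \<bullet> z)) - b 0 * prd * snd z) at_top"
      by (intro tendsto_intros lc lO lS)
    have "\<forall>\<^sub>F t in at_top. fst z * (eval2 (component2 b) (t *\<^sub>R z) / t ^ n) - snd z * (eval2 (component1 b) (t *\<^sub>R z) / t ^ n) =
       - (fst z + c * (1 / t)) * (\<Sum>i<n. lam i * (u i \<bullet> z) * (\<Prod>j\<in>{..<n} - {i}. side j (t *\<^sub>R z) / t))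
        - b 0 * (\<Prod>j<n. side j (t *\<^sub>R z) / t) * snd z"
      using eventually_gt_at_top[of 0]
    proof eventually_elim
      case (elim t)
      have e: "eval2 (component1 b) (t *\<^sub>R z) = fst (field b (t *\<^sub>R z))" "eval2 (component2 b) (t *\<^sub>R z) = snd (field b (t *\<^sub>R z))"
        unfolding field_poly poly_vfield_def by simp_all
      have w: "wedge (t *\<^sub>R z) (field b (t *\<^sub>R z)) = t * (fst z * snd (field b (t *\<^sub>R z)) - snd z * fst (field b (t *\<^sub>R z)))"
        by (simp add: wedge_def algebra_simps)
      have oi: "others i (t *\<^sub>R z) = t ^ (n - 1) * (\<Prod>j\<in>{..<n} - {i}. side j (t *\<^sub>R z) / t)" if "i < n" for i
        unfolding others_def prod_dividef using elim that by simp
      have si: "sides (t *\<^sub>R z) = t ^ n * (\<Prod>j<n. side j (t *\<^sub>R z) / t)"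
        unfolding sides_def prod_dividef using elim by simp
      have tn: "t * t ^ (n - 1) = t ^ n" using n1 by (metis power_Suc)
      have di: "angular_weight (t *\<^sub>R z) = - (t ^ n * (\<Sum>i<n. lam i * (u i \<bullet> z) * (\<Prod>j\<in>{..<n} - {i}. side j (t *\<^sub>R z) / t)))"
      proof -
        have "lam i * (side i (t *\<^sub>R z) - 1) * others i (t *\<^sub>R z) =
            t ^ n * (lam i * (u i \<bullet> z) * (\<Prod>j\<in>{..<n} - {i}. side j (t *\<^sub>R z) / t))" if "i \<in> {..<n}" for i
          using oi[of i] that tn[symmetric] by (simp add: side_def)
        from sum.cong[OF refl this] show ?thesis unfolding angular_weight_eq sum_distrib_left by (rule arg_cong)
      qed
      have "t * (fst z * snd (field b (t *\<^sub>R z)) - snd z * fst (field b (t *\<^sub>R z))) =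
        t ^ n * t * (- (fst z + c * (1 / t)) * (\<Sum>i<n. lam i * (u i \<bullet> z) * (\<Prod>j\<in>{..<n} - {i}. side j (t *\<^sub>R z) / t))
        - b 0 * (\<Prod>j<n. side j (t *\<^sub>R z) / t) * snd z)"
        unfolding w[symmetric] wedge_field di si using elim by (simp add: field_simps)
      then have "fst z * snd (field b (t *\<^sub>R z)) - snd z * fst (field b (t *\<^sub>R z)) =
        t ^ n * (- (fst z + c * (1 / t)) * (\<Sum>i<n. lam i * (u i \<bullet> z) * (\<Prod>j\<in>{..<n} - {i}. side j (t *\<^sub>R z) / t))
        - b 0 * (\<Prod>j<n. side j (t *\<^sub>R z) / t) * snd z)"
        using elim by (simp only: mult.assoc mult.left_commute[of "t ^ n" t] mult_left_cancel[OF less_imp_neq[OF elim, symmetric]])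
      then show ?case unfolding e using elim by (simp add: field_simps)
    qed
    from Lim_transform_eventually[OF lim1 this]
    have "0 = - (fst z + c * 0) * (\<Sum>i<n. lam i * (u i \<bullet> z) * (\<Prod>j\<in>{..<n} - {i}. u j \<bullet> z)) - b 0 * prd * snd z"
      using LIMSEQ_unique tendsto_unique[OF trivial_limit_at_top_linorder _ lim2] by fastforce
    also have "(\<Sum>i<n. lam i * (u i \<bullet> z) * (\<Prod>j\<in>{..<n} - {i}. u j \<bullet> z)) = lam_total * prd"
    proof -
      have "lam i * (u i \<bullet> z) * (\<Prod>j\<in>{..<n} - {i}. u j \<bullet> z) = lam i * prd" if "i \<in> {..<n}" for i
        unfolding prd_def using prod.remove[of "{..<n}" i "\<lambda>j. u j \<bullet> z"] that by simp
      from sum.cong[OF refl this] show ?thesis unfolding lam_total_def sum_distrib_right .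
    qed
    finally have "(lam_total * fst z + b 0 * snd z) * prd = 0" by (simp add: algebra_simps)
    moreover have "prd \<noteq> 0" unfolding prd_def using z(1) by simp
    ultimately show False using z(2) by simp
  qed
  then have "max (total_degree (component1 b)) (total_degree (component2 b)) = n"
    using total_degree_le[OF degree_components(1), of b] total_degree_le[OF degree_components(2), of b] by (auto simp: max_def)
  then show ?thesis unfolding poly_vfields_def field_poly by blast
qed

text \<open>The coefficients of the field depend affinely on \<open>b\<close>.\<close>

lemma field_limit:
  assumes "\<And>k. k \<le> n \<Longrightarrow> ((\<lambda>\<epsilon>. b \<epsilon> k) \<longlongrightarrow> 0) (at_right 0)"
  shows "limitin (coeff_topology n) (\<lambda>\<epsilon>. field (b \<epsilon>)) base_field (at_right (0::real))"
  unfolding coeff_topology_def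
proof (rule limitin_pullback)
  show "base_field \<in> poly_vfields n" "\<And>\<epsilon>. field (b \<epsilon>) \<in> poly_vfields n" by (rule field_degree)+
  have c1: "((\<lambda>\<epsilon>. coeff2 (component1 (b \<epsilon>)) m) \<longlongrightarrow> coeff2 (component1 (\<lambda>_. 0)) m) (at_right 0)" for m
  proof -
    have "((\<lambda>\<epsilon>. coeff2 (component1 (b \<epsilon>)) m) \<longlongrightarrow>
        coeff2 (([:[:0, 1:]:] + [:[:c:]:]) * (\<Sum>i<n. [:[:lam i * snd (u i):]:] * others_poly i)) m
        + (\<Sum>i<n. 0 * coeff2 (others_poly i * [:[:0, 1:]:]) m) + 0 * coeff2 (\<Prod>j<n. side_poly j) m) (at_right 0)"
      unfolding component1_def coeff2_simps(1)[of _ "[:[:_:]:] * _"] coeff2_simps(1)[of _ "sum _ _"]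
        coeff2_sum coeff2_simps(2)
      by (intro tendsto_intros assms) auto
    then show ?thesis unfolding component1_def coeff2_simps(1)[of _ "[:[:_:]:] * _"] coeff2_simps(1)[of _ "sum _ _"]
        coeff2_sum coeff2_simps(2) by simp
  qed
  have c2: "((\<lambda>\<epsilon>. coeff2 (component2 (b \<epsilon>)) m) \<longlongrightarrow> coeff2 (component2 (\<lambda>_. 0)) m) (at_right 0)" for m
  proof -
    have "((\<lambda>\<epsilon>. coeff2 (component2 (b \<epsilon>)) m) \<longlongrightarrow>
        coeff2 (([:[:0, 1:]:] + [:[:c:]:]) * (\<Sum>i<n. [:[:lam i * - fst (u i):]:] * others_poly i)) m
        + (\<Sum>i<n. 0 * coeff2 (others_poly i * [:0, 1:]) m)) (at_right 0)"
      unfolding component2_def coeff2_simps(1)[of _ "sum _ _"] coeff2_sum coeff2_simps(2)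
      by (intro tendsto_intros assms) auto
    then show ?thesis unfolding component2_def coeff2_simps(1)[of _ "sum _ _"] coeff2_sum coeff2_simps(2) by simp
  qed
  show "limitin (product_topology (\<lambda>_. euclidean) {(i, j). i + j \<le> n}) (\<lambda>\<epsilon>. coeff_vector n (field (b \<epsilon>)))
      (coeff_vector n base_field) (at_right 0)"
    unfolding field_poly coeff_vector_poly_vfield limitin_componentwise
    using c1 c2 by (auto intro!: tendsto_Pair)
qed

end

section \<open>A polygon with prescribed weights\<close>

definition vertex_weight :: "nat \<Rightarrow> nat \<Rightarrow> real" where
  "vertex_weight n j = 1 / (real (j mod n) + 1)"

text \<open>Subtracting this weighted mean moves the weighted centre of the points \<open>(j, j\<^sup>2)\<close> to the origin.\<close>

definition parabola_mean :: "nat \<Rightarrow> real \<times> real" where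
  "parabola_mean n = (1 / (\<Sum>j<n. vertex_weight n j)) *\<^sub>R
     (\<Sum>j<n. vertex_weight n j *\<^sub>R (real j, (real j)\<^sup>2))"

definition normal_vector :: "nat \<Rightarrow> nat \<Rightarrow> real \<times> real" where
  "normal_vector n j = (real (j mod n), (real (j mod n))\<^sup>2) - parabola_mean n"

text \<open>Points on a parabola are in convex position: the orientation of a triple is a Vandermonde determinant. The origin is a
  weighted mean of the points with positive weights, hence it lies inside.\<close>

lemma polygon_example:
  assumes n: "3 \<le> n" shows "polygon n (normal_vector n) (vertex_weight n)"
proof -
  let ?u = "normal_vector n" and ?l = "vertex_weight n"
  have lpos: "0 < ?l j" for j unfolding vertex_weight_def by simp
  have Lpos: "0 < (\<Sum>j<n. ?l j)" using lpos n by (intro sum_pos) (auto simp: lessThan_empty_iff)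
  have center: "(\<Sum>j<n. ?l j *\<^sub>R ?u j) = 0"
  proof -
    have "(\<Sum>j<n. ?l j *\<^sub>R ?u j) = (\<Sum>j<n. ?l j *\<^sub>R (real j, (real j)\<^sup>2)) - (\<Sum>j<n. ?l j) *\<^sub>R parabola_mean n"
      unfolding scaleR_sum_left sum_subtractf[symmetric]
      by (rule sum.cong) (simp_all only: normal_vector_def scaleR_diff_right mod_less lessThan_iff)
    also have "(\<Sum>j<n. ?l j) *\<^sub>R parabola_mean n = (\<Sum>j<n. ?l j *\<^sub>R (real j, (real j)\<^sup>2))"
      unfolding parabola_mean_def using Lpos by simp
    finally show ?thesis by simp
  qed
  define \<Delta> where "\<Delta> j k = wedge (?u j) (?u (Suc j)) + wedge (?u (Suc j)) (?u k) + wedge (?u k) (?u j)" for j k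
  have vandermonde: "\<Delta> j k = (real (Suc j mod n) - real (j mod n)) * (real (k mod n) - real (j mod n)) *
      (real (k mod n) - real (Suc j mod n))" for j k
    unfolding \<Delta>_def normal_vector_def wedge_def by (simp add: power2_eq_square algebra_simps)
  have pos: "0 < \<Delta> j k" if k: "k mod n \<noteq> j mod n" "k mod n \<noteq> Suc j mod n" for j k
  proof (cases "Suc (j mod n) = n")
    case True
    then have "Suc j mod n = 0" by (metis mod_Suc)
    moreover have "k mod n < n" using n by simp
    moreover from this have "k mod n < j mod n" using True k(1) by linarith
    ultimately have "real (j mod n) > 0" "real (k mod n) > 0" "real (k mod n) < real (j mod n)"
      using True k n by auto
    then show ?thesis unfolding vandermonde \<open>Suc j mod n = 0\<close>
      by (auto simp: zero_less_mult_iff mult_less_0_iff)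
  next
    case False
    then have s: "Suc j mod n = Suc (j mod n)" by (simp add: mod_Suc)
    have "k mod n < j mod n \<or> Suc (j mod n) < k mod n" using k s by linarith
    then have "real (k mod n) < real (j mod n) \<or> real (j mod n) + 1 < real (k mod n)" by linarith
    then show ?thesis unfolding vandermonde s by (auto simp: zero_less_mult_iff mult_less_0_iff)
  qed
  have nonneg: "0 \<le> \<Delta> j k" for j k
  proof (cases "k mod n = j mod n \<or> k mod n = Suc j mod n")
    case True
    then show ?thesis unfolding vandermonde by auto
  qed (use pos in \<open>simp add: less_imp_le\<close>)
  have turn: "0 < wedge (?u j) (?u (Suc j))" for j
  proof -
    have "(\<Sum>k<n. ?l k * \<Delta> j k) = (\<Sum>k<n. ?l k) * wedge (?u j) (?u (Suc j))
        + wedge (?u (Suc j)) (\<Sum>k<n. ?l k *\<^sub>R ?u k) - wedge (?u j) (\<Sum>k<n. ?l k *\<^sub>R ?u k)"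
      unfolding \<Delta>_def wedge_sum_right wedge_scaleR_right sum_distrib_right sum.distrib[symmetric] sum_subtractf[symmetric]
      by (rule sum.cong) (simp_all add: wedge_swap[of "?u _" "?u j"] algebra_simps)
    then have eq: "(\<Sum>k<n. ?l k * \<Delta> j k) = (\<Sum>k<n. ?l k) * wedge (?u j) (?u (Suc j))"
      unfolding center by (simp add: wedge_def)
    define k where "k = Suc (Suc j) mod n"
    have "k mod n \<noteq> j mod n" "k mod n \<noteq> Suc j mod n"
      unfolding k_def using mod_add_neq[of 2 n j] mod_add_neq[of 1 n "Suc j"] n by auto
    then have "0 < ?l k * \<Delta> j k" using pos lpos by simp
    moreover have "k < n" unfolding k_def using n by simp
    ultimately have "0 < (\<Sum>k<n. ?l k * \<Delta> j k)"
      using nonneg lpos by (intro sum_pos2[of _ k]) (auto simp: less_imp_le)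
    then show ?thesis unfolding eq using Lpos by (simp add: zero_less_mult_iff)
  qed
  show ?thesis
    by unfold_locales (use n lpos center turn pos in \<open>auto simp: \<Delta>_def normal_vector_def vertex_weight_def\<close>)
qed

theorem proposition10:
  fixes n :: nat
  assumes "3 \<le> n"
  shows "\<exists>X \<Gamma>. X \<in> poly_vfields n \<and> hyperbolic_polycycle X n \<Gamma> \<and>
           cyclicity_at_least (coeff_topology n) X \<Gamma> n"
proof -
  interpret polygon n "normal_vector n" "vertex_weight n" by (rule polygon_example[OF assms])
  obtain B where B: "0 < B" "\<And>z. norm z \<le> B * gauge z" by (rule norm_le_gauge) (rule that)
  obtain r0 where r0: "0 < r0" "\<And>x t. x \<le> - 1 \<Longrightarrow> r0 \<le> radius x t" by (rule radius_lower) (rule that)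
  obtain e0 where e0: "0 < e0" "\<And>z. z \<in> inside \<Longrightarrow> r0 \<le> norm z \<Longrightarrow> e0 \<le> decay z"
    by (rule decay_lower[OF r0(1)]) (rule that)
  obtain L where L: "0 < L" "\<And>z. z \<in> inside \<Longrightarrow> e0 \<le> decay z \<Longrightarrow> norm (grad z) \<le> L * decay z"
    by (rule grad_le_decay[OF e0(1)]) (rule that)
  define c where "c = B + 1 + 4 * B ^ 4 * L / r0\<^sup>2"
  have "0 \<le> 4 * B ^ 4 * L / r0\<^sup>2" using B(1) L(1) by simp
  then have cB: "B < c" unfolding c_def by linarith
  interpret polygon_exponents n "normal_vector n" "vertex_weight n" c B r0 e0 L
  proof unfold_locales
    fix z assume "gauge z \<le> 1"
    then have "norm z \<le> B" using order_trans[OF B(2)[of z] mult_left_mono[of "gauge z" 1 B]] B(1) by simp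
    then show "0 < fst z + c" using norm_fst_le[of "fst z" "snd z"] cB by simp
  qed (use B r0 e0 L in \<open>simp_all add: c_def vertex_weight_def\<close>)
  have "\<forall>\<epsilon>. \<exists>b. 0 < \<epsilon> \<longrightarrow> (\<forall>k\<le>n. \<bar>b k\<bar> \<le> \<epsilon>) \<and> (\<exists>C. finite C \<and> card C = n \<and>
      (\<forall>\<gamma>\<in>C. limit_cycle (field b) \<gamma> \<and> hausdorff_dist \<gamma> boundary < \<epsilon>))"
    using many_limit_cycles by blast
  then obtain b where b: "\<And>\<epsilon> k. 0 < \<epsilon> \<Longrightarrow> k \<le> n \<Longrightarrow> \<bar>b \<epsilon> k\<bar> \<le> \<epsilon>"
      "\<And>\<epsilon>. 0 < \<epsilon> \<Longrightarrow> \<exists>C. finite C \<and> card C = n \<and>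
      (\<forall>\<gamma>\<in>C. limit_cycle (field (b \<epsilon>)) \<gamma> \<and> hausdorff_dist \<gamma> boundary < \<epsilon>)"
    by metis
  have "cyclicity_at_least (coeff_topology n) base_field boundary n"
    unfolding cyclicity_at_least_def topspace_coeff_topology
  proof (intro exI[of _ "\<lambda>\<epsilon>. field (b \<epsilon>)"] conjI allI impI)
    show "field (b \<epsilon>) \<in> poly_vfields n" for \<epsilon> by (rule field_degree)
    show "\<exists>C. finite C \<and> card C = n \<and> (\<forall>\<gamma>\<in>C. limit_cycle (field (b \<epsilon>)) \<gamma> \<and> hausdorff_dist \<gamma> boundary < \<epsilon>)"
      if "0 < \<epsilon>" for \<epsilon> by (rule b(2)[OF that])
    show "limitin (coeff_topology n) (\<lambda>\<epsilon>. field (b \<epsilon>)) base_field (at_right 0)"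
    proof (rule field_limit)
      fix k assume k: "k \<le> n"
      show "((\<lambda>\<epsilon>. b \<epsilon> k) \<longlongrightarrow> 0) (at_right 0)"
      proof (rule tendsto_0_le[where K = 1 and f = "\<lambda>\<epsilon>. \<epsilon>"])
        show "\<forall>\<^sub>F \<epsilon> in at_right 0. norm (b \<epsilon> k) \<le> norm \<epsilon> * 1"
          using eventually_at_right_less[of 0] by eventually_elim (use b(1) k in simp)
      qed (rule tendsto_ident_at)
    qed
  qed
  then show ?thesis using field_degree base_field_hyperbolic_polycycle by blast
qed

end
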